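(* Let $\lambda\in\mathbb{C}^N$ and let $\mathcal{J}_{\lambda}$ be the subcategory of modules in category $\mathcal{J}$ for $\mathcal{H}_N$ supported on $\lambda+\mathbb{Z}^N$. For $N=2m\geq 2$, there is a one-to-one correspondence between the finite dimensional irreducible modules for $\mathfrak{sp}_N\oplus\mathfrak{a}_N$ and the irreducible modules in $\mathcal{J}_{\lambda}$. This correspondence maps a finite dimensional irreducible module $V$ for $\mathfrak{sp}_N\oplus\mathfrak{a}_N$ to $A_N\otimes V$. The action of $\mathcal{H}_N$ on $A_N\otimes V$ is given, for $s\in\mathbb{Z}^N$ and $v\in V$, by $$d_a(t^{s}\otimes v)=(s_a+\lambda_a)\,t^s\otimes v\qquad(a=1,\dots,N),$$ and, for all $r\in\mathbb{Z}^N$, $$\begin{aligned} h(r)(t^{s}\otimes v)={}&\sum_{i=1}^m\bigl(r_{m+i}(s_i+\mu_{m+i})-r_i(s_{m+i}+\mu_i)\bigr)\,t^{r+s}\otimes v\\ &+t^{r+s}\otimes\sum_{i=1}^m\left(r_{m+i}^2\varphi(E_{m+i,i})+r_ir_{m+i}\varphi(E_{i,i}-E_{m+i,m+i})-r_i^2\varphi(E_{i,m+i})\right)v\\ &+t^{r+s}\otimes\sum_{\substack{i,j=1\\ i<j}}^m\bigl(r_{m+i}r_{m+j}\varphi(E_{m+j,i}+E_{m+i,j})+r_ir_{m+j}\varphi(E_{i,j}-E_{m+j,m+i})\\ &\qquad\qquad\qquad-r_ir_j\varphi(E_{i,m+j}+E_{j,m+i})\bigr)v, \end{aligned}$$ where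 $\mu_i$ is the action of $C_i\in\mathfrak{a}_N$ (a scalar), and $\varphi$ is an irreducible representation of $\mathfrak{sp}_N$ (the one on $V$).
   Context: Notation. $N=2m$ is even, $N\ge2$. $A_N=\mathbb{C}[t_1^{\pm1},\dots,t_N^{\pm1}]$, with $t^r=t_1^{r_1}\cdots t_N^{r_N}$ for $r\in\mathbb{Z}^N$. All vector spaces and tensor products are over $\mathbb{C}$. $A_N$ acts on $A_N\otimes V$ by multiplication on the left factor. The Lie algebra $\mathcal{H}_N$. Let $d_i=t_i\frac{\partial}{\partial t_i}$, and for $r\in\mathbb{Z}^N$ let $h(r)=\sum_{i=1}^m\left(r_{m+i}t^rd_i-r_it^rd_{m+i}\right)\in\mathrm{Der}(A_N)$ (so $h(0)=0$). The Lie algebra of Hamiltonian vector fields on the torus is $\mathcal{H}_N=\mathrm{Span}_{\mathbb{C}}\{d_i,h(r)\mid 1\le i\le N,\ r\in\mathbb{Z}^N\}\subset\mathrm{Der}(A_N)$. Its brackets are $[d_i,d_j]=0$, $[d_i,h(r)]=r_ih(r)$, $[h(r),h(s)]=\sum_{i=1}^m(r_{m+i}s_i-r_is_{m+i})h(r+s)$. Category $\mathcal{J}$. An $\mathcal{H}_N$-module $J$ (which is also an $A_N$-module) belongs to category $\mathcal{J}$ if: (J1) the action of $d_i$ on $J$ is diagonalizable for all $i\in\{1,\dots,N\}$; (J2) $J$ is a free $A_N$-module of finite rank; (J3) for all $X\in\mathcal{H}_N$, $f\in A_N$, $v\in J$, $X(fv)=(Xf)v+f(Xv)$. Submodules (in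 particular in the definition of irreducible) are required to be invariant under both $A_N$ and $\mathcal{H}_N$. The weight spaces of $J$ are $J_\mu=\{v\in J\mid d_iv=\mu_iv\text{ for all }i\}$, $\mu\in\mathbb{C}^N$. For fixed $\lambda\in\mathbb{C}^N$, $\mathcal{J}_\lambda$ is the subcategory of $\mathcal{J}$ of modules all of whose weights lie in $\lambda+\mathbb{Z}^N$. $E_{a,b}$ is the $N\times N$ matrix with $1$ in entry $(a,b)$ and zeros elsewhere. $\mathfrak{sp}_N$ is the symplectic Lie algebra spanned by the matrices $E_{i,j}-E_{m+j,m+i}$, $E_{i,m+j}+E_{j,m+i}$, $E_{m+i,j}+E_{m+j,i}$ for $i,j\in\{1,\dots,m\}$, with the commutator bracket. $\mathfrak{a}_N=\mathrm{Span}_{\mathbb{C}}\{C_1,\dots,C_N\}$ is the $N$-dimensional abelian Lie algebra, and $\mathfrak{sp}_N\oplus\mathfrak{a}_N$ is the direct sum of Lie algebras.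
   Formalization: The printed formula for h(r) is not an action for m≥2 with nontrivial φ; the formal statement adds to the sum over i<j the missing term r_j r_{m+i} φ(E_{j,i} − E_{m+i,m+j}). Nothing else is changed. *)

theory Defs
  imports "HOL-Analysis.Analysis" "HOL-Library.Poly_Mapping" "HOL-Library.Function_Algebras"
begin

section \<open>Lie algebras and their modules\<close>

text \<open>
  All vector spaces are complex. A Lie algebra, and likewise a module, is a subspace (the carrier)
  of an ambient type that is a complex vector space with an explicit scalar multiplication.
\<close>

record 'l lie_alg =
  lie_carrier :: "'l set"
  lie_scale :: "complex \<Rightarrow> 'l \<Rightarrow> 'l"
  lie_bracket :: "'l \<Rightarrow> 'l \<Rightarrow> 'l"

record ('l, 'v) lie_mod =
  mcarrier :: "'v set"
  mscale :: "complex \<Rightarrow> 'v \<Rightarrow> 'v"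
  mact :: "'l \<Rightarrow> 'v \<Rightarrow> 'v"

definition lie_module ::
  "'l::ab_group_add lie_alg \<Rightarrow> ('l, 'v::ab_group_add, 'z) lie_mod_scheme \<Rightarrow> bool" where
  "lie_module L V \<longleftrightarrow>
     vector_space (mscale V) \<and> module.subspace (mscale V) (mcarrier V) \<and>
     (\<forall>x\<in>lie_carrier L. \<forall>v\<in>mcarrier V. mact V x v \<in> mcarrier V) \<and>
     (\<forall>x\<in>lie_carrier L. \<forall>v\<in>mcarrier V. \<forall>w\<in>mcarrier V.
        mact V x (v + w) = mact V x v + mact V x w) \<and>
     (\<forall>x\<in>lie_carrier L. \<forall>c. \<forall>v\<in>mcarrier V. mact V x (mscale V c v) = mscale V c (mact V x v)) \<and>
     (\<forall>x\<in>lie_carrier L. \<forall>y\<in>lie_carrier L. \<forall>v\<in>mcarrier V.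
        mact V (x + y) v = mact V x v + mact V y v) \<and>
     (\<forall>c. \<forall>x\<in>lie_carrier L. \<forall>v\<in>mcarrier V. mact V (lie_scale L c x) v = mscale V c (mact V x v)) \<and>
     (\<forall>x\<in>lie_carrier L. \<forall>y\<in>lie_carrier L. \<forall>v\<in>mcarrier V.
        mact V (lie_bracket L x y) v = mact V x (mact V y v) - mact V y (mact V x v))"

definition finite_dimensional :: "('l, 'v::ab_group_add, 'z) lie_mod_scheme \<Rightarrow> bool" where
  "finite_dimensional V \<longleftrightarrow> (\<exists>B. finite B \<and> module.span (mscale V) B = mcarrier V)"

definition irreducible_lie_module ::
  "'l::ab_group_add lie_alg \<Rightarrow> ('l, 'v::ab_group_add, 'z) lie_mod_scheme \<Rightarrow> bool" where
  "irreducible_lie_module L V \<longleftrightarrow>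
     lie_module L V \<and> mcarrier V \<noteq> {0} \<and>
     (\<forall>W. W \<subseteq> mcarrier V \<and> module.subspace (mscale V) W \<and>
          (\<forall>x\<in>lie_carrier L. \<forall>w\<in>W. mact V x w \<in> W) \<longrightarrow> W = {0} \<or> W = mcarrier V)"

definition isomorphic_lie_modules ::
  "'l lie_alg \<Rightarrow> ('l, 'v::ab_group_add, 'y) lie_mod_scheme \<Rightarrow>
    ('l, 'w::ab_group_add, 'z) lie_mod_scheme \<Rightarrow> bool" where
  "isomorphic_lie_modules L V W \<longleftrightarrow>
     (\<exists>T. bij_betw T (mcarrier V) (mcarrier W) \<and>
        (\<forall>u\<in>mcarrier V. \<forall>v\<in>mcarrier V. T (u + v) = T u + T v) \<and>
        (\<forall>c. \<forall>v\<in>mcarrier V. T (mscale V c v) = mscale W c (T v)) \<and>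
        (\<forall>x\<in>lie_carrier L. \<forall>v\<in>mcarrier V. T (mact V x v) = mact W x (T v)))"


section \<open>Laurent polynomials and Hamiltonian vector fields on the torus\<close>

text \<open>
  With \<open>m = CARD('m)\<close>, the index set \<open>{1, \<dots>, N}\<close> is \<open>'m + 'm\<close>: \<open>Inl i\<close> stands for \<open>i\<close> and \<open>Inr i\<close>
  for \<open>m + i\<close>. A Laurent polynomial is the finitely supported family of its coefficients, and
  multiplication on \<^typ>\<open>'a \<Rightarrow>\<^sub>0 'b\<close> is convolution.
\<close>

type_synonym 'm index = "'m + 'm"
type_synonym 'm lattice = "int ^ 'm index"
type_synonym 'm laurent = "'m lattice \<Rightarrow>\<^sub>0 complex"

definition const :: "complex \<Rightarrow> 'm::finite laurent" where
  "const c = Poly_Mapping.single 0 c"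

definition tpow :: "'m::finite lattice \<Rightarrow> 'm laurent" where
  "tpow r = Poly_Mapping.single r 1"

definition d :: "'m::finite index \<Rightarrow> 'm laurent \<Rightarrow> 'm laurent" where
  "d a = Poly_Mapping.mapp (\<lambda>s c. of_int (s $ a) * c)"

definition h :: "'m::finite lattice \<Rightarrow> 'm laurent \<Rightarrow> 'm laurent" where
  "h r = (\<lambda>f. \<Sum>i\<in>UNIV. const (of_int (r $ Inr i)) * tpow r * d (Inl i) f
                       - const (of_int (r $ Inl i)) * tpow r * d (Inr i) f)"

lemma d_tpow: "d a (tpow s) = const (of_int (s $ a)) * tpow s"
  unfolding d_def tpow_def const_def mult_single
  by (rule poly_mapping_eqI) (simp add: lookup_mapp lookup_single when_def)

lemma h_tpow:
  "h r (tpow s) =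
     const (\<Sum>i\<in>UNIV. of_int (r $ Inr i) * of_int (s $ Inl i) - of_int (r $ Inl i) * of_int (s $ Inr i))
     * tpow (r + s)"
proof -
  have const: "const x * tpow r * (const y * tpow s) = const (x * y) * tpow (r + s)" for x y
    by (simp only: const_def tpow_def mult_single add_0_left add_0_right mult_1_left mult_1_right)
  have diff: "const (x - y) = const x - (const y :: 'a laurent)" for x y
    by (simp add: const_def single_diff)
  have sum: "const (\<Sum>i\<in>S. k i) = (\<Sum>i\<in>S. const (k i) :: 'a laurent)" for k and S :: "'a set"
    by (induction S rule: infinite_finite_induct) (simp_all add: const_def single_add)
  show ?thesis
    unfolding h_def d_tpow const sum diff sum_distrib_right left_diff_distrib ..
qed

definition ham :: "('m::finite laurent \<Rightarrow> 'm laurent) lie_alg" where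
  "ham = \<lparr> lie_carrier = module.span (\<lambda>c X f. const c * X f) (range d \<union> range h),
           lie_scale = (\<lambda>c X f. const c * X f),
           lie_bracket = (\<lambda>X Y f. X (Y f) - Y (X f)) \<rparr>"


section \<open>Category J\<close>

text \<open>
  A module with compatible actions of the Laurent polynomials and of the Hamiltonian vector fields.
\<close>

record ('m, 'v) ah_mod = "('m laurent \<Rightarrow> 'm laurent, 'v) lie_mod" +
  ascale :: "'m laurent \<Rightarrow> 'v \<Rightarrow> 'v"

definition diagonalizable_on ::
  "(complex \<Rightarrow> 'v::ab_group_add \<Rightarrow> 'v) \<Rightarrow> 'v set \<Rightarrow> ('v \<Rightarrow> 'v) \<Rightarrow> bool" where
  "diagonalizable_on sc V T \<longleftrightarrow>
     (\<exists>B. \<not> module.dependent sc B \<and> module.span sc B = V \<and> (\<forall>b\<in>B. \<exists>c. T b = sc c b))"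

definition category_J :: "('m::finite, 'v::ab_group_add) ah_mod \<Rightarrow> bool" where
  "category_J J \<longleftrightarrow>
     lie_module ham J \<and>
     module (ascale J) \<and> module.subspace (ascale J) (mcarrier J) \<and>
     (\<forall>c v. mscale J c v = ascale J (const c) v) \<and>
     (\<forall>i. diagonalizable_on (mscale J) (mcarrier J) (mact J (d i))) \<and>
     (\<exists>B. finite B \<and> \<not> module.dependent (ascale J) B \<and> module.span (ascale J) B = mcarrier J) \<and>
     (\<forall>X\<in>lie_carrier ham. \<forall>f. \<forall>v\<in>mcarrier J.
        mact J X (ascale J f v) = ascale J (X f) v + ascale J f (mact J X v))"

definition weight_space ::
  "('m::finite, 'v::ab_group_add) ah_mod \<Rightarrow> complex ^ 'm index \<Rightarrow> 'v set" where
  "weight_space J \<mu> = {v \<in> mcarrier J. \<forall>i. mact J (d i) v = mscale J (\<mu> $ i) v}"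

definition category_J_at ::
  "complex ^ 'm::finite index \<Rightarrow> ('m, 'v::ab_group_add) ah_mod \<Rightarrow> bool" where
  "category_J_at lam J \<longleftrightarrow>
     category_J J \<and>
     (\<forall>\<mu>. weight_space J \<mu> \<noteq> {0} \<longrightarrow> (\<exists>r :: 'm lattice. \<forall>i. \<mu> $ i = lam $ i + of_int (r $ i)))"

definition irreducible_ah_module :: "('m::finite, 'v::ab_group_add) ah_mod \<Rightarrow> bool" where
  "irreducible_ah_module J \<longleftrightarrow>
     mcarrier J \<noteq> {0} \<and>
     (\<forall>W. W \<subseteq> mcarrier J \<and> module.subspace (ascale J) W \<and>
          (\<forall>X\<in>lie_carrier ham. \<forall>w\<in>W. mact J X w \<in> W) \<longrightarrow> W = {0} \<or> W = mcarrier J)"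

definition isomorphic_ah_modules ::
  "('m::finite, 'v::ab_group_add) ah_mod \<Rightarrow> ('m, 'w::ab_group_add) ah_mod \<Rightarrow> bool" where
  "isomorphic_ah_modules J K \<longleftrightarrow>
     (\<exists>T. bij_betw T (mcarrier J) (mcarrier K) \<and>
        (\<forall>u\<in>mcarrier J. \<forall>v\<in>mcarrier J. T (u + v) = T u + T v) \<and>
        (\<forall>f. \<forall>v\<in>mcarrier J. T (ascale J f v) = ascale K f (T v)) \<and>
        (\<forall>X\<in>lie_carrier ham. \<forall>v\<in>mcarrier J. T (mact J X v) = mact K X (T v)))"


section \<open>The Lie algebra \<open>sp\<^sub>N \<oplus> a\<^sub>N\<close>\<close>

definition E :: "'n::finite \<Rightarrow> 'n \<Rightarrow> complex ^ 'n ^ 'n" where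
  "E a b = (\<chi> i j. if i = a \<and> j = b then 1 else 0)"

definition mat_scale :: "complex \<Rightarrow> complex ^ 'n::finite ^ 'n \<Rightarrow> complex ^ 'n ^ 'n" where
  "mat_scale c M = (\<chi> i j. c * M $ i $ j)"

definition sp :: "(complex ^ 'm::finite index ^ 'm index) lie_alg" where
  "sp = \<lparr> lie_carrier = module.span mat_scale
            ({E (Inl i) (Inl j) - E (Inr j) (Inr i) | i j. True} \<union>
             {E (Inl i) (Inr j) + E (Inl j) (Inr i) | i j. True} \<union>
             {E (Inr i) (Inl j) + E (Inr j) (Inl i) | i j. True}),
          lie_scale = mat_scale,
          lie_bracket = (\<lambda>X Y. X ** Y - Y ** X) \<rparr>"

definition abelian :: "(complex ^ 'n::finite) lie_alg" where
  "abelian = \<lparr> lie_carrier = UNIV, lie_scale = (*s), lie_bracket = (\<lambda>_ _. 0) \<rparr>"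

definition C :: "'n::finite \<Rightarrow> complex ^ 'n" where
  "C a = axis a 1"

definition lie_sum :: "'k lie_alg \<Rightarrow> 'l lie_alg \<Rightarrow> ('k \<times> 'l) lie_alg" where
  "lie_sum K L =
     \<lparr> lie_carrier = lie_carrier K \<times> lie_carrier L,
       lie_scale = (\<lambda>c (x, y). (lie_scale K c x, lie_scale L c y)),
       lie_bracket = (\<lambda>(x, y) (x', y'). (lie_bracket K x x', lie_bracket L y y')) \<rparr>"

type_synonym 'm spa = "(complex ^ 'm index ^ 'm index) \<times> (complex ^ 'm index)"

abbreviation sp_a :: "'m::finite spa lie_alg" where
  "sp_a \<equiv> lie_sum sp abelian"

definition restrict_sp ::
  "('m::finite spa, 'v) lie_mod \<Rightarrow> (complex ^ 'm index ^ 'm index, 'v) lie_mod" where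
  "restrict_sp V = \<lparr> mcarrier = mcarrier V, mscale = mscale V, mact = (\<lambda>M. mact V (M, 0)) \<rparr>"

definition acts_by_scalars :: "('m::finite spa, 'v) lie_mod \<Rightarrow> complex ^ 'm index \<Rightarrow> bool" where
  "acts_by_scalars V \<mu> \<longleftrightarrow> (\<forall>a. \<forall>v\<in>mcarrier V. mact V (0, C a) v = mscale V (\<mu> $ a) v)"


section \<open>The modules \<open>A\<^sub>N \<otimes> V\<close>\<close>

text \<open>
  Since the monomials form a basis of the Laurent polynomials, the tensor product with \<open>V\<close> is the
  space of finitely supported families of elements of \<open>V\<close> indexed by the exponents; see the
  universal property below.
\<close>

definition tensor_carrier :: "'v::zero set \<Rightarrow> ('m::finite lattice \<Rightarrow>\<^sub>0 'v) set" where
  "tensor_carrier V = {g. \<forall>s. Poly_Mapping.lookup g s \<in> V}"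

definition tensor ::
  "(complex \<Rightarrow> 'v \<Rightarrow> 'v) \<Rightarrow> 'm::finite laurent \<Rightarrow> 'v::comm_monoid_add \<Rightarrow> 'm lattice \<Rightarrow>\<^sub>0 'v" where
  "tensor sc f v =
     (\<Sum>p\<in>Poly_Mapping.keys f. Poly_Mapping.single p (sc (Poly_Mapping.lookup f p) v))"

definition tensor_ascale ::
  "(complex \<Rightarrow> 'v \<Rightarrow> 'v) \<Rightarrow> 'm::finite laurent \<Rightarrow> ('m lattice \<Rightarrow>\<^sub>0 'v::comm_monoid_add) \<Rightarrow> 'm lattice \<Rightarrow>\<^sub>0 'v"
  where
  "tensor_ascale sc f g =
     (\<Sum>s\<in>Poly_Mapping.keys g. tensor sc (f * tpow s) (Poly_Mapping.lookup g s))"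

lemma sum_single_lookup:
  "(\<Sum>s\<in>Poly_Mapping.keys f. Poly_Mapping.single s (Poly_Mapping.lookup f s)) = f"
proof (rule poly_mapping_eqI)
  fix t
  have "Poly_Mapping.lookup (\<Sum>s\<in>Poly_Mapping.keys f. Poly_Mapping.single s (Poly_Mapping.lookup f s)) t =
        (\<Sum>s\<in>Poly_Mapping.keys f. if s = t then Poly_Mapping.lookup f s else 0)"
    unfolding lookup_sum by (intro sum.cong) (auto simp: lookup_single when_def)
  then show "Poly_Mapping.lookup (\<Sum>s\<in>Poly_Mapping.keys f. Poly_Mapping.single s (Poly_Mapping.lookup f s)) t =
        Poly_Mapping.lookup f t"
    by (simp add: in_keys_iff)
qed

context
  fixes sc :: "complex \<Rightarrow> 'v::ab_group_add \<Rightarrow> 'v"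
  assumes sc: "vector_space sc"
begin

interpretation vector_space sc by (fact sc)

lemma lookup_tensor: "Poly_Mapping.lookup (tensor sc f v) s = sc (Poly_Mapping.lookup f s) v"
proof -
  have "Poly_Mapping.lookup (tensor sc f v) s =
        (\<Sum>p\<in>Poly_Mapping.keys f. if p = s then sc (Poly_Mapping.lookup f p) v else 0)"
    unfolding tensor_def lookup_sum by (intro sum.cong) (auto simp: lookup_single when_def)
  also have "\<dots> = sc (Poly_Mapping.lookup f s) v"
    by (simp add: in_keys_iff)
  finally show ?thesis .
qed

lemma tensor_ascale_const:
  "Poly_Mapping.lookup (tensor_ascale sc (const c) g) s = sc c (Poly_Mapping.lookup g s)"
proof -
  have "Poly_Mapping.lookup (tensor_ascale sc (const c) g) s =
        (\<Sum>p\<in>Poly_Mapping.keys g. if p = s then sc c (Poly_Mapping.lookup g p) else 0)"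
    unfolding tensor_ascale_def lookup_sum lookup_tensor
    by (intro sum.cong) (auto simp: const_def tpow_def mult_single lookup_single when_def)
  also have "\<dots> = sc c (Poly_Mapping.lookup g s)"
    by (simp add: in_keys_iff)
  finally show ?thesis .
qed

lemma tensor_bilinear:
  "tensor sc (f + g) v = tensor sc f v + tensor sc g v"
  "tensor sc f (v + w) = tensor sc f v + tensor sc f w"
  "tensor sc (const c * f) v = tensor_ascale sc (const c) (tensor sc f v)"
  "tensor sc f (sc c v) = tensor_ascale sc (const c) (tensor sc f v)"
proof -
  have *: "Poly_Mapping.lookup (const c * f) s = c * Poly_Mapping.lookup f s" for s
    by (simp add: const_def lookup_mult lookup_single Sum_any_when_equal when_mult
        flip: Poly_Mapping.map.rep_eq)
  show "tensor sc (f + g) v = tensor sc f v + tensor sc g v"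
    by (rule poly_mapping_eqI) (simp add: lookup_tensor lookup_add scale_left_distrib)
  show "tensor sc f (v + w) = tensor sc f v + tensor sc f w"
    by (rule poly_mapping_eqI) (simp add: lookup_tensor lookup_add scale_right_distrib)
  show "tensor sc (const c * f) v = tensor_ascale sc (const c) (tensor sc f v)"
    by (rule poly_mapping_eqI) (simp add: lookup_tensor tensor_ascale_const *)
  show "tensor sc f (sc c v) = tensor_ascale sc (const c) (tensor sc f v)"
    by (rule poly_mapping_eqI) (simp add: lookup_tensor tensor_ascale_const mult.commute)
qed

lemma tensor_in_carrier:
  "module.subspace sc V \<Longrightarrow> v \<in> V \<Longrightarrow> tensor sc f v \<in> tensor_carrier V"
  by (simp add: tensor_carrier_def lookup_tensor subspace_scale)

lemma tensor_universal:
  fixes sc' :: "complex \<Rightarrow> 'w::ab_group_add \<Rightarrow> 'w" and B :: "'m::finite laurent \<Rightarrow> 'v \<Rightarrow> 'w"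
  assumes sc': "vector_space sc'" and V: "module.subspace sc V"
    and B_left: "\<And>f g v. v \<in> V \<Longrightarrow> B (f + g) v = B f v + B g v"
    and B_right: "\<And>f v w. v \<in> V \<Longrightarrow> w \<in> V \<Longrightarrow> B f (v + w) = B f v + B f w"
    and B_left_scale: "\<And>c f v. v \<in> V \<Longrightarrow> B (const c * f) v = sc' c (B f v)"
    and B_right_scale: "\<And>c f v. v \<in> V \<Longrightarrow> B f (sc c v) = sc' c (B f v)"
  defines "linear_ext \<equiv> \<lambda>F.
      (\<forall>f. \<forall>v\<in>V. F (tensor sc f v) = B f v) \<and>
      (\<forall>g\<in>tensor_carrier V. \<forall>g'\<in>tensor_carrier V. F (g + g') = F g + F g') \<and>
      (\<forall>c. \<forall>g\<in>tensor_carrier V. F (tensor_ascale sc (const c) g) = sc' c (F g))"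
  shows "\<exists>F. linear_ext F"
    and "linear_ext F \<Longrightarrow> linear_ext G \<Longrightarrow> g \<in> tensor_carrier V \<Longrightarrow> F g = G g"
proof -
  interpret W: vector_space sc' by (fact sc')
  have B0: "B f 0 = 0" for f
    using B_right[of 0 0 f] subspace_0[OF V] by simp
  have B0': "B 0 v = 0" if "v \<in> V" for v
    using B_left[of v 0 0] that by simp
  have B_sum: "B (\<Sum>s\<in>S. k s) v = (\<Sum>s\<in>S. B (k s) v)" if "v \<in> V" for S v and k :: "'m lattice \<Rightarrow> _"
    by (induction S rule: infinite_finite_induct) (simp_all add: B0' B_left that)
  define K where "K g = (\<Sum>s\<in>Poly_Mapping.keys g. B (tpow s) (Poly_Mapping.lookup g s))" for g
  have in_V: "Poly_Mapping.lookup g s \<in> V" if "g \<in> tensor_carrier V" for g s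
    using that by (simp add: tensor_carrier_def)
  have "K (tensor sc f v) = B f v" if v: "v \<in> V" for f v
  proof -
    have "K (tensor sc f v) = (\<Sum>s\<in>Poly_Mapping.keys f. B (tpow s) (sc (Poly_Mapping.lookup f s) v))"
      unfolding K_def lookup_tensor
      by (intro sum.mono_neutral_left)
        (auto simp: in_keys_iff lookup_tensor B0)
    also have "\<dots> = (\<Sum>s\<in>Poly_Mapping.keys f. B (const (Poly_Mapping.lookup f s) * tpow s) v)"
      by (simp add: B_right_scale B_left_scale v)
    also have "\<dots> = B (\<Sum>s\<in>Poly_Mapping.keys f. const (Poly_Mapping.lookup f s) * tpow s) v"
      by (simp add: B_sum v)
    also have "(\<Sum>s\<in>Poly_Mapping.keys f. const (Poly_Mapping.lookup f s) * tpow s) = f"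
      by (simp add: const_def tpow_def mult_single sum_single_lookup)
    finally show ?thesis .
  qed
  moreover have "K (g + g') = K g + K g'"
    if "g \<in> tensor_carrier V" "g' \<in> tensor_carrier V" for g g'
    unfolding K_def using that by (intro setsum_keys_plus_distrib) (auto simp: B0 B_right in_V)
  moreover have "K (tensor_ascale sc (const c) g) = sc' c (K g)" if "g \<in> tensor_carrier V" for c g
  proof -
    have "K (tensor_ascale sc (const c) g) =
          (\<Sum>s\<in>Poly_Mapping.keys g. B (tpow s) (sc c (Poly_Mapping.lookup g s)))"
      unfolding K_def tensor_ascale_const
      by (intro sum.mono_neutral_left)
        (auto simp: in_keys_iff tensor_ascale_const B0)
    then show ?thesis
      by (simp add: K_def B_right_scale in_V that W.scale_sum_right)
  qed
  ultimately show "\<exists>F. linear_ext F"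
    unfolding linear_ext_def by blast

  assume F: "linear_ext F" and G: "linear_ext G" and g: "g \<in> tensor_carrier V"
  have expand: "(\<Sum>s\<in>Poly_Mapping.keys g. tensor sc (tpow s) (Poly_Mapping.lookup g s)) = g"
    by (simp add: tensor_def tpow_def sum_single_lookup)
  have in_T: "tensor sc (tpow s) (Poly_Mapping.lookup g s) \<in> tensor_carrier V" for s
    by (intro tensor_in_carrier V in_V g)
  have sum_T: "(\<Sum>s\<in>S. tensor sc (tpow s) (Poly_Mapping.lookup g s)) \<in> tensor_carrier V" for S
    using in_T by (auto simp: tensor_carrier_def lookup_sum intro!: subspace_sum V)
  have ext_sum: "H (\<Sum>s\<in>S. tensor sc (tpow s) (Poly_Mapping.lookup g s)) =
      (\<Sum>s\<in>S. B (tpow s) (Poly_Mapping.lookup g s))" if H: "linear_ext H" "finite S" for H S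
    using \<open>finite S\<close>
  proof (induction S rule: finite_induct)
    case empty
    have "(0 :: 'm lattice \<Rightarrow>\<^sub>0 'v) \<in> tensor_carrier V"
      by (simp add: tensor_carrier_def subspace_0 V)
    then have "H (0 + 0) = H 0 + H 0"
      using H unfolding linear_ext_def by blast
    then show ?case by simp
  next
    case (insert x S)
    then show ?case
      using H in_T sum_T in_V[OF g] unfolding linear_ext_def by simp
  qed
  show "F g = G g"
    using ext_sum[OF F, of "Poly_Mapping.keys g"] ext_sum[OF G, of "Poly_Mapping.keys g"]
    by (simp add: expand)
qed

end

text \<open>
  In the last sum, the term with coefficient \<open>r\<^sub>j r\<^sub>m\<^sub>+\<^sub>i\<close> (the term before it with \<open>i\<close> and \<open>j\<close>
  interchanged) is missing from the printed formula, where that sum has only the other three terms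
  over \<open>i < j\<close>. Without it the formula does not define an action for
  \<open>m \<ge> 2\<close>. Writing \<open>\<Phi>(r)\<close> for the sum of the terms quadratic in \<open>r\<close> and
  \<open>\<omega>(r, s) = \<Sum>\<^sub>i (r\<^sub>m\<^sub>+\<^sub>i s\<^sub>i - r\<^sub>i s\<^sub>m\<^sub>+\<^sub>i)\<close>, the relation \<open>[h(r), h(s)] = \<omega>(r, s) h(r + s)\<close> forces
  \<open>[\<Phi>(r), \<Phi>(s)] = \<omega>(r, s) (\<Phi>(r + s) - \<Phi>(r) - \<Phi>(s))\<close>. For \<open>m = 2\<close>, \<open>r = (1, 1, 0, 0)\<close> and
  \<open>s = (0, 0, 1, 0)\<close> the coefficient of \<open>E\<^sub>2\<^sub>,\<^sub>1 - E\<^sub>3\<^sub>,\<^sub>4\<close> is \<open>-1\<close> on both sides, and it would be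
  \<open>0\<close> on the right-hand side without that term.
\<close>

definition tensor_module ::
  "complex ^ 'm::{finite,linorder} index \<Rightarrow> complex ^ 'm index \<Rightarrow>
    ('m spa, 'v::ab_group_add) lie_mod \<Rightarrow> ('m, 'm lattice \<Rightarrow>\<^sub>0 'v) ah_mod \<Rightarrow> bool" where
  "tensor_module lam \<mu> V J \<longleftrightarrow>
     (let sc = mscale V;
          \<phi> = (\<lambda>M. mact V (M, 0));
          n = (\<lambda>k :: int. of_int k :: complex)
      in
      lie_module ham J \<and>
      mcarrier J = tensor_carrier (mcarrier V) \<and>
      ascale J = tensor_ascale sc \<and>
      mscale J = (\<lambda>c. tensor_ascale sc (const c)) \<and>
      (\<forall>a s. \<forall>v\<in>mcarrier V.
         mact J (d a) (tensor sc (tpow s) v) = mscale J (n (s $ a) + lam $ a) (tensor sc (tpow s) v)) \<and>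
      (\<forall>r s. \<forall>v\<in>mcarrier V.
         mact J (h r) (tensor sc (tpow s) v) =
           mscale J
             (\<Sum>i\<in>UNIV. n (r $ Inr i) * (n (s $ Inl i) + \<mu> $ Inr i)
                      - n (r $ Inl i) * (n (s $ Inr i) + \<mu> $ Inl i))
             (tensor sc (tpow (r + s)) v)
         + tensor sc (tpow (r + s))
             (\<Sum>i\<in>UNIV.
                sc (n (r $ Inr i) ^ 2) (\<phi> (E (Inr i) (Inl i)) v)
              + sc (n (r $ Inl i) * n (r $ Inr i)) (\<phi> (E (Inl i) (Inl i) - E (Inr i) (Inr i)) v)
              - sc (n (r $ Inl i) ^ 2) (\<phi> (E (Inl i) (Inr i)) v))
         + tensor sc (tpow (r + s))
             (\<Sum>i\<in>UNIV. \<Sum>j\<in>{j. i < j}.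
                sc (n (r $ Inr i) * n (r $ Inr j)) (\<phi> (E (Inr j) (Inl i) + E (Inr i) (Inl j)) v)
              + sc (n (r $ Inl i) * n (r $ Inr j)) (\<phi> (E (Inl i) (Inl j) - E (Inr j) (Inr i)) v)
              + sc (n (r $ Inl j) * n (r $ Inr i)) (\<phi> (E (Inl j) (Inl i) - E (Inr i) (Inr j)) v)
              - sc (n (r $ Inl i) * n (r $ Inl j)) (\<phi> (E (Inl i) (Inr j) + E (Inl j) (Inr i)) v))))"

end

theory Submission
  imports Defs "HOL-Computational_Algebra.Fundamental_Theorem_Algebra"
begin

text \<open>
  Let \<open>U\<close> be the weight space of weight \<open>\<lambda>\<close> of a module in the category. The operators
  \<open>D r = t\<^sup>-\<^sup>r h(r)\<close> act on \<open>U\<close>, and \<open>[D r, D s] = \<omega>(r, s) (D (r + s) - D r - D s)\<close>.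
  On the finite-dimensional space spanned by the matrix coefficients of \<open>D\<close>, this relation yields the
  operators sending \<open>G\<close> to \<open>s \<mapsto> \<omega>(r, s) (G (s + r) - G s - G r)\<close>. Their only eigenvalue is zero: a
  joint eigenfunction of the operators of \<open>r\<close> and \<open>2 r\<close> would be supported on a single level set of
  \<open>\<omega>(r, \<cdot>)\<close>, which the operators of the other lattice points do not allow. Hence \<open>D\<close> is
  a polynomial function away from the origin.

  If its degree is at least three, its top differences span an abelian ideal consisting of sums of
  commutators; by Jacobson's lemma these are nilpotent, so by irreducibility they vanish. Hence \<open>D\<close> is
  quadratic. Its odd part is linear and central, which gives the action of \<open>a\<^sub>N\<close>; its even part is a
  quadratic form whose values \<open>D r\<close> satisfy the relations of the rank one matrices \<open>r (J r)\<^sup>T\<close> in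
  \<open>sp\<^sub>N\<close>. As these span \<open>sp\<^sub>N\<close>, the even part is an action of \<open>sp\<^sub>N\<close>.
\<close>

section \<open>Linear operators on finite-dimensional subspaces\<close>

text \<open>The relation is best read by degree. If \<open>D\<close> is a sum of homogeneous parts
  D_k, comparing bidegrees shows that for k, l >= 2 the commutator of D_k(r) and D_l(s) is
  \<open>om r s\<close> times the part of D_(k+l-2)(r + s) of degree k - 1 in r and l - 1 in s,
  while D_1 commutes with these D_k. Two parts of degree M have a bracket of degree 2 M - 2, which
  exceeds M exactly when M >= 3. Hence the threshold three: top parts of degree at least three
  commute, quadratic parts close under brackets like sp_N, and linear parts are central once D_0 =
  0. Two obstacles shape the proof. The relation is void where \<open>om r s = 0\<close>, so
  differences are first known to vanish off a hyperplane, and this has to be carried across it along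
  transverse lines. And h(0) = 0 says nothing about the value at the origin of a polynomial that
  agrees with \<open>D\<close> elsewhere. That value turns out to be a scalar; a nonzero one would
  make a nonzero scalar a commutator, so it is zero.\<close>

definition endo_on :: "(complex \<Rightarrow> 'v::ab_group_add \<Rightarrow> 'v) \<Rightarrow> 'v set \<Rightarrow> ('v \<Rightarrow> 'v) \<Rightarrow> bool" where
  "endo_on sc U T \<longleftrightarrow>
     (\<forall>u\<in>U. T u \<in> U) \<and> (\<forall>u\<in>U. \<forall>v\<in>U. T (u + v) = T u + T v) \<and> (\<forall>c. \<forall>u\<in>U. T (sc c u) = sc c (T u))"

definition shifted :: "(complex \<Rightarrow> 'v::ab_group_add \<Rightarrow> 'v) \<Rightarrow> ('v \<Rightarrow> 'v) \<Rightarrow> complex \<Rightarrow> 'v \<Rightarrow> 'v" where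
  "shifted sc T z v = T v - sc z v"

locale complex_space = vector_space sc for sc :: "complex \<Rightarrow> 'v::ab_group_add \<Rightarrow> 'v"

text \<open>The finite set need only span a superspace of \<open>U\<close>, so the same
  \<open>B\<close> serves every subspace of \<open>U\<close>, and \<open>card B\<close> bounds
  nilpotency indices there too.\<close>

locale fd_space = complex_space sc for sc :: "complex \<Rightarrow> 'v::ab_group_add \<Rightarrow> 'v" +
  fixes U B :: "'v set"
  assumes subspace_U: "subspace U" and finite_B: "finite B" and U_span: "U \<subseteq> span B"
begin

abbreviation "endo \<equiv> endo_on sc U"
abbreviation "shift \<equiv> shifted sc"

lemma U_closed [simp, intro]:
  "0 \<in> U" "u \<in> U \<Longrightarrow> v \<in> U \<Longrightarrow> u + v \<in> U" "u \<in> U \<Longrightarrow> sc c u \<in> U"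
  "u \<in> U \<Longrightarrow> v \<in> U \<Longrightarrow> u - v \<in> U" "u \<in> U \<Longrightarrow> - u \<in> U"
  using subspace_0[OF subspace_U] subspace_add[OF subspace_U] subspace_scale[OF subspace_U]
    subspace_diff[OF subspace_U] subspace_neg[OF subspace_U] by auto

lemma U_sum: "(\<And>i. i \<in> I \<Longrightarrow> f i \<in> U) \<Longrightarrow> (\<Sum>i\<in>I. f i) \<in> U"
  using subspace_sum[OF subspace_U] .

lemma endoD:
  assumes "endo T"
  shows "u \<in> U \<Longrightarrow> T u \<in> U" "u \<in> U \<Longrightarrow> v \<in> U \<Longrightarrow> T (u + v) = T u + T v"
    "u \<in> U \<Longrightarrow> T (sc c u) = sc c (T u)" "T 0 = 0"
    "u \<in> U \<Longrightarrow> v \<in> U \<Longrightarrow> T (u - v) = T u - T v" "u \<in> U \<Longrightarrow> T (- u) = - T u"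
proof -
  show 1: "u \<in> U \<Longrightarrow> T u \<in> U" and 2: "u \<in> U \<Longrightarrow> v \<in> U \<Longrightarrow> T (u + v) = T u + T v"
    and 3: "u \<in> U \<Longrightarrow> T (sc c u) = sc c (T u)" for u v c
    using assms by (auto simp: endo_on_def)
  show 4: "T 0 = 0" using 3[of 0 0] by simp
  show 6: "u \<in> U \<Longrightarrow> T (- u) = - T u" for u
    using 2[of u "- u"] 4 by (simp add: eq_neg_iff_add_eq_0 add.commute)
  show "u \<in> U \<Longrightarrow> v \<in> U \<Longrightarrow> T (u - v) = T u - T v"
    using 2[of u "- v"] 6[of v] by simp
qed

lemma endo_sum: "endo T \<Longrightarrow> (\<And>i. i \<in> I \<Longrightarrow> f i \<in> U) \<Longrightarrow> T (\<Sum>i\<in>I. f i) = (\<Sum>i\<in>I. T (f i))"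
  by (induction I rule: infinite_finite_induct) (simp_all add: endoD U_sum)

lemma endo_shift: "endo T \<Longrightarrow> endo (shift T z)"
  unfolding endo_on_def shifted_def
  by (auto simp: algebra_simps)

lemma endo_funpow: "endo T \<Longrightarrow> endo (T ^^ n)"
  by (induction n) (auto simp: endo_on_def)

lemma foldr_shift_in_U: "endo T \<Longrightarrow> w \<in> U \<Longrightarrow> foldr (shift T) zs w \<in> U"
  by (induction zs) (auto intro: endoD endo_shift)

text \<open>By the fundamental theorem of algebra a root can be split off: if q = (X - z) p
  annihilates \<open>w\<close>, then p annihilates \<open>shift T z w\<close>. Iterating gives a
  product of linear factors.\<close>

lemma poly_annihilates_imp_factors:
  assumes "endo T" "w \<in> U" "q \<noteq> 0" "degree q \<le> n" "(\<Sum>i\<le>n. sc (coeff q i) ((T ^^ i) w)) = 0"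
  shows "\<exists>zs. length zs \<le> n \<and> foldr (shift T) zs w = 0"
  using assms(2-)
proof (induction n arbitrary: q w)
  case 0
  then have "coeff q 0 \<noteq> 0" by (metis le_0_eq leading_coeff_neq_0)
  with 0 show ?case by (intro exI[of _ "[]"]) simp
next
  case (Suc n)
  show ?case
  proof (cases "degree q = 0")
    case True
    then have "(\<Sum>i\<le>Suc n. sc (coeff q i) ((T ^^ i) w)) = sc (coeff q 0) w"
      by (subst sum.mono_neutral_right[of _ "{0}"]) (auto simp: coeff_eq_0)
    moreover have "coeff q 0 \<noteq> 0" using True Suc.prems(2) by (metis leading_coeff_neq_0)
    ultimately show ?thesis using Suc.prems(4) by (intro exI[of _ "[]"]) simp
  next
    case False
    then have "\<not> constant (poly q)" by (simp add: constant_degree)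
    then obtain z where "poly q z = 0" using fundamental_theorem_of_algebra by blast
    then obtain p where q: "q = [:- z, 1:] * p" by (auto simp: poly_eq_0_iff_dvd elim: dvdE)
    have p: "p \<noteq> 0" using q Suc.prems(2) by auto
    have "degree q = Suc (degree p)" unfolding q using p by (subst degree_mult_eq) auto
    with Suc.prems(3) have deg: "degree p \<le> n" by simp
    have co: "coeff q i = (case i of 0 \<Rightarrow> 0 | Suc j \<Rightarrow> coeff p j) - z * coeff p i" for i
      by (simp add: q coeff_pCons split: nat.split)
    let ?w = "shift T z w"
    have w': "?w \<in> U" using endo_shift[OF assms(1)] Suc.prems(1) by (rule endoD)
    have Tp: "(T ^^ i) ?w = (T ^^ Suc i) w - sc z ((T ^^ i) w)" for i
      using endoD[OF endo_funpow[OF assms(1), of i]] endoD[OF assms(1)] Suc.prems(1)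
      by (simp add: shifted_def funpow_swap1)
    have "(\<Sum>i\<le>n. sc (coeff p i) ((T ^^ i) ?w)) =
        (\<Sum>i\<le>n. sc (coeff p i) ((T ^^ Suc i) w)) - (\<Sum>i\<le>n. sc (z * coeff p i) ((T ^^ i) w))"
      by (simp add: Tp scale_right_diff_distrib sum_subtractf mult.commute)
    also have "(\<Sum>i\<le>n. sc (z * coeff p i) ((T ^^ i) w)) = (\<Sum>i\<le>Suc n. sc (z * coeff p i) ((T ^^ i) w))"
      using deg by (simp add: coeff_eq_0)
    also have "(\<Sum>i\<le>n. sc (coeff p i) ((T ^^ Suc i) w)) =
        (\<Sum>i\<le>Suc n. sc (case i of 0 \<Rightarrow> 0 | Suc j \<Rightarrow> coeff p j) ((T ^^ i) w))"
      by (simp add: sum.atMost_Suc_shift del: sum.atMost_Suc)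
    also have "\<dots> - (\<Sum>i\<le>Suc n. sc (z * coeff p i) ((T ^^ i) w)) = (\<Sum>i\<le>Suc n. sc (coeff q i) ((T ^^ i) w))"
      by (simp only: co scale_left_diff_distrib sum_subtractf)
    finally have "(\<Sum>i\<le>n. sc (coeff p i) ((T ^^ i) ?w)) = 0" using Suc.prems(4) by simp
    from Suc.IH[OF w' p deg this] obtain zs where zs: "length zs \<le> n" "foldr (shift T) zs ?w = 0" by blast
    \<comment> \<open>\<open>foldr\<close> applies the last entry of the list first, hence the root
      goes to the end.\<close>
    then show ?thesis by (intro exI[of _ "zs @ [z]"]) simp
  qed
qed

text \<open>The vectors w, T w, ..., T^n w with n = \<open>card B\<close> are too many to be
  independent in the span of \<open>B\<close>.\<close>

lemma annihilating_factors:
  assumes "endo T" "w \<in> U"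
  obtains zs where "length zs \<le> card B" "foldr (shift T) zs w = 0"
proof -
  let ?n = "card B"
  let ?f = "\<lambda>i. (T ^^ i) w"
  have fU: "?f i \<in> U" for i using endo_funpow[OF assms(1)] assms(2) by (rule endoD)
  have "\<exists>c. (\<exists>i\<le>?n. c i \<noteq> 0) \<and> (\<Sum>i\<le>?n. sc (c i) (?f i)) = 0"
  \<comment> \<open>Dependence is a notion about sets, so a coincidence of two powers, itself a
    linear relation, is treated apart.\<close>
  proof (cases "inj_on ?f {..?n}")
    case True
    have "dependent (?f ` {..?n})"
    proof (rule ccontr)
      assume "independent (?f ` {..?n})"
      from independent_span_bound[OF finite_B this] fU U_span True
      show False by (auto simp: card_image)
    qed
    then obtain u where u: "\<exists>v\<in>?f ` {..?n}. u v \<noteq> 0" "(\<Sum>v\<in>?f ` {..?n}. sc (u v) v) = 0"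
      by (subst (asm) dependent_finite) auto
    then show ?thesis using True by (intro exI[of _ "\<lambda>i. u (?f i)"]) (auto simp: sum.reindex)
  next
    case False
    then obtain i j where ij: "i \<le> ?n" "j \<le> ?n" "i \<noteq> j" "?f i = ?f j" by (auto simp: inj_on_def)
    let ?c = "\<lambda>k. if k = i then 1 else if k = j then - 1 else 0 :: complex"
    have "(\<Sum>k\<le>?n. sc (?c k) (?f k)) = (\<Sum>k\<in>{i, j}. sc (?c k) (?f k))"
      using ij by (intro sum.mono_neutral_right) auto
    also have "\<dots> = 0" using ij by simp
    finally show ?thesis using ij(1) by (intro exI[of _ ?c]) auto
  qed
  then obtain c where c: "\<exists>i\<le>?n. c i \<noteq> 0" "(\<Sum>i\<le>?n. sc (c i) (?f i)) = 0" by blast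
  let ?q = "\<Sum>i\<le>?n. monom (c i) i"
  have co: "coeff ?q i = (if i \<le> ?n then c i else 0)" for i
    by (simp add: coeff_sum)
  have "?q \<noteq> 0" using c(1) co by (metis coeff_0)
  moreover have "degree ?q \<le> ?n" by (rule degree_le) (simp add: co)
  moreover have "(\<Sum>i\<le>?n. sc (coeff ?q i) (?f i)) = 0" using c(2) by (simp add: co)
  ultimately show ?thesis using poly_annihilates_imp_factors[OF assms] that by blast
qed

text \<open>Some product of shifts annihilates a nonzero vector of \<open>W\<close>. The last
  nonzero partial product is an eigenvector, and it stays in \<open>W\<close> because
  \<open>W\<close> is stable.\<close>

lemma eigenvector_exists:
  assumes T: "endo T" and W: "subspace W" "W \<subseteq> U" "\<And>w. w \<in> W \<Longrightarrow> T w \<in> W" "W \<noteq> {0}"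
  obtains z w where "w \<in> W" "w \<noteq> 0" "T w = sc z w"
proof -
  obtain w where w: "w \<in> W" "w \<noteq> 0" using W(4) subspace_0[OF W(1)] by blast
  obtain zs where "foldr (shift T) zs w = 0" using annihilating_factors[OF T] w W(2) by blast
  then show thesis
  proof (induction zs)
    case Nil then show ?case using w by simp
  next
    case (Cons z zs)
    let ?v = "foldr (shift T) zs w"
    have "foldr (shift T) ys w \<in> W" for ys
      by (induction ys) (auto simp: w shifted_def intro: subspace_diff subspace_scale W)
    then have "?v \<in> W" .
    moreover have "T ?v = sc z ?v" using Cons.prems by (simp add: shifted_def[of sc T z ?v])
    ultimately show ?case using Cons.IH that by blast
  qed
qed

lemma funpow_commute: "(T ^^ n) (T w) = T ((T ^^ n) w)"
  by (simp add: funpow_swap1)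

text \<open>Factors \<open>shift T z\<close> with nonzero \<open>z\<close> are injective on
  \<open>U\<close> and can be cancelled from an annihilating product, which leaves a power of
  \<open>T\<close> with at most \<open>card B\<close> factors.\<close>

lemma nilpotent_of_no_eigenvalue:
  assumes T: "endo T" and no: "\<And>z w. w \<in> U \<Longrightarrow> T w = sc z w \<Longrightarrow> z \<noteq> 0 \<Longrightarrow> w = 0" and w: "w \<in> U"
  shows "(T ^^ card B) w = 0"
proof -
  obtain zs where zs: "length zs \<le> card B" "foldr (shift T) zs w = 0"
    using annihilating_factors[OF T w] .
  have "foldr (shift T) zs w = 0 \<Longrightarrow> w \<in> U \<Longrightarrow> (T ^^ length zs) w = 0" for w
  proof (induction zs arbitrary: w)
    case (Cons z zs)
    let ?v = "foldr (shift T) zs w"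
    have v: "?v \<in> U" using foldr_shift_in_U[OF T Cons.prems(2)] .
    have ev: "T ?v = sc z ?v" using Cons.prems(1) by (simp add: shifted_def[of sc T z ?v])
    have Tw: "T w \<in> U" using endoD[OF T] Cons.prems by blast
    have comm: "foldr (shift T) ys (T w) = T (foldr (shift T) ys w)" for ys
      using foldr_shift_in_U[OF T Cons.prems(2)]
      by (induction ys) (simp_all add: shifted_def endoD[OF T])
    show ?case
    proof (cases "z = 0")
      case True
      then have "foldr (shift T) zs (T w) = 0" using ev comm by simp
      then show ?thesis using Cons.IH[OF _ Tw] by (simp add: funpow_swap1)
    next
      case False
      then have "?v = 0" using no v ev by blast
      from Cons.IH[OF this Cons.prems(2)] show ?thesis using endoD(4)[OF T] by simp
    qed
  qed simp
  then have *: "(T ^^ length zs) w = 0" using zs w by blast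
  have "(T ^^ k) 0 = 0" for k using endoD(4)[OF endo_funpow[OF T]] .
  then have "(T ^^ (card B - length zs + length zs)) w = 0" by (simp only: funpow_add * comp_apply)
  with zs(1) show ?thesis by simp
qed

text \<open>On the space of all vectors killed by some power of \<open>T\<close> the only eigenvalue
  is 0, so the preceding lemma applies to it with the same \<open>B\<close>.\<close>

lemma nilpotency_index_bound:
  assumes T: "endo T" and w: "w \<in> U" and n: "(T ^^ n) w = 0"
  shows "(T ^^ card B) w = 0"
proof -
  let ?W = "{u \<in> U. \<exists>n. (T ^^ n) u = 0}"
  have Tk0: "(T ^^ k) 0 = 0" for k using endoD(4)[OF endo_funpow[OF T]] .
  have mono: "(T ^^ (k + n)) u = 0" if "(T ^^ n) u = 0" for k n u
    using that Tk0 by (simp add: funpow_add)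
  have sub: "subspace ?W"
  proof (rule subspaceI)
    show "x + y \<in> ?W" if xy: "x \<in> ?W" "y \<in> ?W" for x y
    proof -
      from xy obtain n m where nm: "(T ^^ n) x = 0" "(T ^^ m) y = 0" by blast
      have "(T ^^ (m + n)) (x + y) = 0"
        using xy mono[OF nm(1), of m] mono[OF nm(2), of n] endoD(2)[OF endo_funpow[OF T]]
        by (simp add: add.commute)
      then show ?thesis using xy by blast
    qed
  qed (use Tk0 endoD(3)[OF endo_funpow[OF T]] in auto)
  interpret W: fd_space sc ?W B
    using sub finite_B U_span by unfold_locales auto
  have TW: "endo_on sc ?W T" unfolding endo_on_def
  proof (intro conjI ballI allI)
    fix u assume u: "u \<in> ?W"
    then obtain n where "(T ^^ n) u = 0" by blast
    then have "(T ^^ n) (T u) = 0" by (simp add: funpow_commute endoD(4)[OF T])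
    then show "T u \<in> ?W" using u endoD(1)[OF T] by blast
  qed (use endoD[OF T] in auto)
  show ?thesis
  proof (rule W.nilpotent_of_no_eigenvalue[OF TW])
    show "w \<in> ?W" using w n by blast
    show "v = 0" if v: "v \<in> ?W" "T v = sc z v" "z \<noteq> 0" for z v
    proof -
      obtain n where n: "(T ^^ n) v = 0" using v by blast
      have "(T ^^ n) v = sc (z ^ n) v"
        using v by (induction n) (auto simp: endoD[OF T] mult.commute)
      then show ?thesis using n v(3) by simp
    qed
  qed
qed

text \<open>
  A form of Jacobson's lemma: were \<open>F\<close> injective, \<open>D\<close> would send each layer of the filtration of a
  generalized eigenspace of \<open>Z\<close> injectively into the next one.
\<close>

lemma commutator_not_injective:
  assumes D: "endo D" and Z: "endo Z" and F: "endo F" and U: "U \<noteq> {0}"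
    and comm: "\<And>u. u \<in> U \<Longrightarrow> F u = D (Z u) - Z (D u)"
    and FZ: "\<And>u. u \<in> U \<Longrightarrow> F (Z u) = Z (F u)"
  obtains u where "u \<in> U" "u \<noteq> 0" "F u = 0"
proof -
  have "\<exists>u\<in>U. u \<noteq> 0 \<and> F u = 0"
  proof (rule ccontr)
    assume "\<not> ?thesis"
    then have inj: "F u = 0 \<Longrightarrow> u \<in> U \<Longrightarrow> u = 0" for u by blast
    obtain z w where w: "w \<in> U" "w \<noteq> 0" "Z w = sc z w"
      by (rule eigenvector_exists[OF Z subspace_U subset_refl endoD(1)[OF Z] U])
    let ?S = "shift Z z"
    have S: "endo ?S" using endo_shift[OF Z] .
    note Sn = endoD[OF endo_funpow[OF S]]
    have FS: "F (?S u) = ?S (F u)" if "u \<in> U" for u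
      using that FZ by (simp add: shifted_def endoD[OF F] endoD[OF Z])
    have FSn: "F ((?S ^^ n) u) = (?S ^^ n) (F u)" if "u \<in> U" for u n
      using that by (induction n) (auto simp: FS Sn)
    have DS: "D (?S u) = ?S (D u) + F u" if "u \<in> U" for u
      using that comm[OF that] by (simp add: shifted_def endoD[OF D] endoD[OF Z])
    \<comment> \<open>The derivation rule for a power: \<open>F\<close> is the commutator of
      \<open>D\<close> with \<open>?S\<close> and commutes with \<open>?S\<close>.\<close>
    have DSn: "D ((?S ^^ n) u) = (?S ^^ n) (D u) + sc (of_nat n) (F ((?S ^^ (n - 1)) u))"
      if u: "u \<in> U" for u n
    proof (induction n)
      case (Suc n)
      have "D ((?S ^^ Suc n) u) = ?S (D ((?S ^^ n) u)) + F ((?S ^^ n) u)"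
        using DS[of "(?S ^^ n) u"] u Sn(1) by simp
      also have "?S (D ((?S ^^ n) u)) = (?S ^^ Suc n) (D u) + sc (of_nat n) (F ((?S ^^ n) u))"
      proof (cases n)
        case 0 then show ?thesis by (simp add: u)
      next
        case (Suc m)
        then show ?thesis using Suc.IH u
          by (simp add: endoD[OF S] endoD[OF D] endoD[OF F] Sn FS)
      qed
      finally show ?case by (simp add: scale_left_distrib algebra_simps)
    qed (simp add: u)
    \<comment> \<open>\<open>D\<close> raises the exact nilpotency order with respect to
      \<open>?S\<close> by one: what remains is a nonzero multiple of
      \<open>F ((?S ^^ n) u)\<close>, which is nonzero by injectivity.\<close>
    have step: "(?S ^^ Suc (Suc n)) (D u) = 0 \<and> (?S ^^ Suc n) (D u) \<noteq> 0"
      if u: "u \<in> U" "(?S ^^ Suc n) u = 0" "(?S ^^ n) u \<noteq> 0" for u n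
    proof
      have s2: "(?S ^^ Suc (Suc n)) u = 0" using u(2) endoD(4)[OF S] by simp
      show "(?S ^^ Suc (Suc n)) (D u) = 0"
        using DSn[OF u(1), of "Suc (Suc n)"] s2 u(2) endoD(4)[OF D] endoD(4)[OF F] by simp
      show "(?S ^^ Suc n) (D u) \<noteq> 0"
      proof
        assume "(?S ^^ Suc n) (D u) = 0"
        then have "sc (of_nat (Suc n)) (F ((?S ^^ n) u)) = 0"
          using DSn[OF u(1), of "Suc n"] u(2) endoD(4)[OF D] by simp
        then have "F ((?S ^^ n) u) = 0" using scale_eq_0_iff of_nat_neq_0 by blast
        then show False using inj Sn(1) u by blast
      qed
    qed
    have Dw: "(D ^^ n) w \<in> U" for n using endoD(1)[OF endo_funpow[OF D] w(1)] .
    have *: "(?S ^^ Suc n) ((D ^^ n) w) = 0 \<and> (?S ^^ n) ((D ^^ n) w) \<noteq> 0" for n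
    proof (induction n)
      case 0 then show ?case using w by (simp add: shifted_def)
    next
      case (Suc n)
      then show ?case using step[OF Dw, of n n] by simp
    qed
    \<comment> \<open>Starting from an eigenvector, every order occurs, against the bound
      \<open>card B\<close>.\<close>
    show False
      using *[of "card B"] nilpotency_index_bound[OF S Dw] by blast
  qed
  then show thesis using that by blast
qed

lemma generalized_null_space_subspace:
  assumes F: "endo F"
  shows "subspace {u \<in> U. (F ^^ n) u = 0}"
  using endoD[OF endo_funpow[OF F]] by (intro subspaceI) auto

text \<open>With [D, F] = G and G commuting with F, moving \<open>D\<close> past F^(n+1) costs (n+1)
  G F^n. For n = \<open>card B\<close> the powers of F kill \<open>u\<close>, so F^(n+1) kills
  \<open>D u\<close>, and the index bound lowers the exponent to n again.\<close>

lemma generalized_null_space_stable: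
  assumes D: "endo D" and F: "endo F" and G: "endo G"
    and comm: "\<And>u. u \<in> U \<Longrightarrow> G u = D (F u) - F (D u)"
    and GF: "\<And>u. u \<in> U \<Longrightarrow> G (F u) = F (G u)"
    and u: "u \<in> U" "(F ^^ card B) u = 0"
  shows "(F ^^ card B) (D u) = 0"
proof -
  note Fn = endoD[OF endo_funpow[OF F]]
  have GFn: "G ((F ^^ n) v) = (F ^^ n) (G v)" if "v \<in> U" for v n
    using that by (induction n) (auto simp: GF Fn)
  have DFn: "D ((F ^^ n) u) = (F ^^ n) (D u) + sc (of_nat n) (G ((F ^^ (n - 1)) u))" for n
  proof (induction n)
    case (Suc n)
    have "D ((F ^^ Suc n) u) = F (D ((F ^^ n) u)) + G ((F ^^ n) u)"
      using comm[of "(F ^^ n) u"] u Fn(1) by simp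
    also have "F (D ((F ^^ n) u)) = (F ^^ Suc n) (D u) + sc (of_nat n) (G ((F ^^ n) u))"
      by (cases n) (use Suc.IH u in \<open>simp_all add: endoD[OF F] endoD[OF D] endoD[OF G] Fn GF\<close>)
    finally show ?case by (simp add: scale_left_distrib algebra_simps)
  qed simp
  have "(F ^^ Suc (card B)) (D u) = 0"
    using DFn[of "Suc (card B)"] u endoD(4)[OF F] endoD(4)[OF D] endoD(4)[OF G] by simp
  then show ?thesis using nilpotency_index_bound[OF F, of "D u"] endoD(1)[OF D u(1)] by blast
qed

text \<open>Induction on the set: from a vector killed by \<open>S\<close>, pass to its last nonzero
  image under powers of the new \<open>F\<close>. Commutation keeps it in the kernels of the members
  of \<open>S\<close>.\<close>

lemma commuting_nilpotents_common_kernel: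
  assumes "finite S" and E: "\<And>F. F \<in> S \<Longrightarrow> endo F" and U: "U \<noteq> {0}"
    and nil: "\<And>F u. F \<in> S \<Longrightarrow> u \<in> U \<Longrightarrow> (F ^^ card B) u = 0"
    and comm: "\<And>F G u. F \<in> S \<Longrightarrow> G \<in> S \<Longrightarrow> u \<in> U \<Longrightarrow> F (G u) = G (F u)"
  obtains u where "u \<in> U" "u \<noteq> 0" "\<And>F. F \<in> S \<Longrightarrow> F u = 0"
proof -
  have "\<exists>u\<in>U. u \<noteq> 0 \<and> (\<forall>F\<in>S. F u = 0)"
    using assms
  proof (induction S rule: finite_induct)
    case empty
    show ?case using U U_closed(1) by auto
  next
    case (insert F S)
    have "\<exists>u\<in>U. u \<noteq> 0 \<and> (\<forall>G\<in>S. G u = 0)"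
      by (rule insert.IH) (simp_all add: insert.prems)
    then obtain u where u: "u \<in> U" "u \<noteq> 0" "\<forall>G\<in>S. G u = 0" by blast
    have F: "endo F" using insert.prems(1) by simp
    define n where "n = (LEAST n. (F ^^ n) u = 0)"
    have n: "(F ^^ n) u = 0" unfolding n_def using insert.prems(3)[of F u] u by (auto intro: LeastI)
    then have "n \<noteq> 0" using u by (intro notI) simp
    then obtain m where m: "n = Suc m" by (cases n) auto
    have "(F ^^ m) u \<noteq> 0" using not_less_Least[of m "\<lambda>n. (F ^^ n) u = 0"] m n_def by auto
    moreover have "G ((F ^^ m) u) = 0" if "G \<in> S" for G
    proof -
      have "G ((F ^^ k) u) = 0" for k
        using insert.prems(4)[of G F] that u endoD(1)[OF endo_funpow[OF F] u(1)] endoD(4)[OF F]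
        by (induction k) auto
      then show ?thesis .
    qed
    moreover have "F ((F ^^ m) u) = 0" using n m by simp
    ultimately show ?case using endoD(1)[OF endo_funpow[OF F] u(1)] by blast
  qed
  then show thesis using that by blast
qed

text \<open>An eigenspace of \<open>T\<close> is stable under the irreducible family
  \<open>A\<close>, hence is all of \<open>U\<close>.\<close>

lemma schur_scalar:
  assumes "endo T" and U: "U \<noteq> {0}"
    and irr: "\<And>W. subspace W \<Longrightarrow> W \<subseteq> U \<Longrightarrow> (\<And>x w. x \<in> X \<Longrightarrow> w \<in> W \<Longrightarrow> A x w \<in> W) \<Longrightarrow> W = {0} \<or> W = U"
    and A: "\<And>x. x \<in> X \<Longrightarrow> endo (A x)"
    and comm: "\<And>x u. x \<in> X \<Longrightarrow> u \<in> U \<Longrightarrow> T (A x u) = A x (T u)"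
  obtains z where "\<And>u. u \<in> U \<Longrightarrow> T u = sc z u"
proof -
  obtain z w where w: "w \<in> U" "w \<noteq> 0" "T w = sc z w"
    by (rule eigenvector_exists[OF assms(1) subspace_U subset_refl endoD(1)[OF assms(1)] U])
  let ?W = "{u \<in> U. T u = sc z u}"
  have "subspace ?W"
    using endoD[OF assms(1)] by (intro subspaceI) (auto simp: scale_right_distrib scale_left_commute)
  moreover have "A x w \<in> ?W" if "x \<in> X" "w \<in> ?W" for x w
    using that comm[of x w] endoD[OF A[OF that(1)]] by auto
  ultimately have "?W = {0} \<or> ?W = U" using irr[of ?W] by blast
  then show thesis using w that by blast
qed

end

text \<open>Applying \<open>T i - wt p i\<close> to the sum deletes the component \<open>w p\<close>
  and multiplies \<open>w q\<close> by a nonzero number, so induction on the number of components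
  isolates \<open>w q\<close>. With \<open>W = {0}\<close> this is the independence of vectors of
  different weights.\<close>

lemma weight_components_in_stable_subspace:
  fixes sc :: "complex \<Rightarrow> 'v::ab_group_add \<Rightarrow> 'v" and T :: "'i \<Rightarrow> 'v \<Rightarrow> 'v" and wt :: "'r \<Rightarrow> 'i \<Rightarrow> complex"
  assumes "vector_space sc" and W: "module.subspace sc W" and V: "module.subspace sc V"
    and stable: "\<And>i v. v \<in> W \<Longrightarrow> T i v \<in> W"
    and T: "\<And>i. endo_on sc V (T i)"
    and distinct: "\<And>r s. r \<noteq> s \<Longrightarrow> \<exists>i. wt r i \<noteq> wt s i"
    and "finite R" "\<And>r. r \<in> R \<Longrightarrow> w r \<in> V" "\<And>r i. r \<in> R \<Longrightarrow> T i (w r) = sc (wt r i) (w r)"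
      "(\<Sum>r\<in>R. w r) \<in> W" "q \<in> R"
  shows "w q \<in> W"
  using assms(7-)
proof (induction "card R" arbitrary: R w q rule: less_induct)
  case less
  interpret vector_space sc by fact
  show ?case
  proof (cases "R = {q}")
    case True with less.prems show ?thesis by simp
  next
    case False
    then obtain p where p: "p \<in> R" "p \<noteq> q" using less.prems(5) by blast
    then obtain i where i: "wt p i \<noteq> wt q i" using distinct by blast
    have sumV: "(\<Sum>r\<in>S. w r) \<in> V" if "S \<subseteq> R" for S using subspace_sum[OF V] less.prems(2) that by blast
    have Tsum: "T i (\<Sum>r\<in>S. w r) = (\<Sum>r\<in>S. T i (w r))" if "finite S" "S \<subseteq> R" for S
      using that
    proof (induction S rule: finite_induct)
      case empty
      have "T i (sc 0 0) = sc 0 (T i 0)" using T[of i] subspace_0[OF V] unfolding endo_on_def by blast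
      then show ?case by simp
    next
      case (insert x S)
      then show ?case using T[of i] less.prems(2) sumV[of S] unfolding endo_on_def by simp
    qed
    have eq: "T i (\<Sum>r\<in>R. w r) - sc (wt p i) (\<Sum>r\<in>R. w r) = (\<Sum>r\<in>R. sc (wt r i - wt p i) (w r))"
      using less.prems by (simp add: Tsum scale_sum_right sum_subtractf[symmetric] scale_left_diff_distrib)
    also have "\<dots> = (\<Sum>r\<in>R - {p}. sc (wt r i - wt p i) (w r))"
      using less.prems(1) p by (subst sum.remove[of R p]) auto
    finally have eq2: "(\<Sum>r\<in>R - {p}. sc (wt r i - wt p i) (w r)) =
        T i (\<Sum>r\<in>R. w r) - sc (wt p i) (\<Sum>r\<in>R. w r)" by simp
    have inW: "(\<Sum>r\<in>R - {p}. sc (wt r i - wt p i) (w r)) \<in> W"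
      unfolding eq2 using stable[OF less.prems(4)] less.prems(4)
      by (intro subspace_diff[OF W] subspace_scale[OF W])
    have "card (R - {p}) < card R" using p less.prems(1) by (intro psubset_card_mono) auto
    then have "sc (wt q i - wt p i) (w q) \<in> W"
    proof (rule less.hyps[of _ "\<lambda>r. sc (wt r i - wt p i) (w r)" q])
      show "T i' (sc (wt r i - wt p i) (w r)) = sc (wt r i') (sc (wt r i - wt p i) (w r))"
        if "r \<in> R - {p}" for r i'
        using that T[of i'] less.prems(2,3)[of r] unfolding endo_on_def
        by (simp add: mult.commute)
    qed (use less.prems p inW V in \<open>auto intro: subspace_scale\<close>)
    then have "sc (inverse (wt q i - wt p i)) (sc (wt q i - wt p i) (w q)) \<in> W"
      using subspace_scale[OF W] by blast
    then show ?thesis using i by simp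
  qed
qed

section \<open>The symplectic form on the lattice\<close>

definition om :: "'m::finite lattice \<Rightarrow> 'm lattice \<Rightarrow> int" where
  "om r s = (\<Sum>i\<in>UNIV. r $ Inr i * s $ Inl i - r $ Inl i * s $ Inr i)"

abbreviation unit_vec :: "'n::finite \<Rightarrow> int ^ 'n" where
  "unit_vec a \<equiv> axis a 1"

text \<open>\<open>swap_index\<close> exchanges the two members of a symplectic pair, and
  \<open>index_sign a\<close> is the value of \<open>om\<close> on \<open>unit_vec a\<close> and its
  partner.\<close>

fun swap_index :: "'m index \<Rightarrow> 'm index" where
  "swap_index (Inl i) = Inr i"
| "swap_index (Inr i) = Inl i"

fun index_sign :: "'m index \<Rightarrow> int" where
  "index_sign (Inl i) = - 1"
| "index_sign (Inr i) = 1"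

lemma swap_swap_index [simp]: "swap_index (swap_index a) = a"
  by (cases a) auto

lemma swap_index_eq_iff [simp]: "swap_index a = swap_index b \<longleftrightarrow> a = b"
  by (metis swap_swap_index)

lemma swap_index_neq [simp]: "swap_index a \<noteq> a" "a \<noteq> swap_index a"
  by (cases a; simp)+

lemma index_sign_neq_0 [simp]: "index_sign a \<noteq> 0"
  by (cases a) auto

lemma om_add_left: "om (r + r') s = om r s + om r' s"
  and om_add_right: "om r (s + s') = om r s + om r s'"
  and om_diff_left: "om (r - r') s = om r s - om r' s"
  and om_diff_right: "om r (s - s') = om r s - om r s'"
  and om_minus_left: "om (- r) s = - om r s"
  and om_minus_right: "om r (- s) = - om r s"
  and om_zero_left: "om 0 s = 0"
  and om_zero_right: "om r 0 = 0"
  unfolding om_def by (simp_all add: algebra_simps sum.distrib sum_subtractf sum_negf)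

lemma om_scale_left: "om (k *s r) s = k * om r s"
  and om_scale_right: "om r (k *s s) = k * om r s"
  unfolding om_def by (simp_all add: algebra_simps sum_distrib_left)

lemmas om_linear = om_add_left om_add_right om_diff_left om_diff_right om_minus_left om_minus_right
  om_zero_left om_zero_right om_scale_left om_scale_right

lemma om_commute: "om s r = - om r s"
  unfolding om_def by (simp add: sum_negf[symmetric] algebra_simps)

lemma om_self [simp]: "om r r = 0"
  unfolding om_def by (simp add: mult.commute)

lemma om_unit_left: "om (unit_vec a) s = index_sign a * s $ swap_index a"
  by (cases a) (auto simp: om_def axis_def if_distrib[of "\<lambda>x. x * _"] sum_negf cong: if_cong)

lemma lattice_expand: "(r :: int ^ 'n::finite) = (\<Sum>a\<in>UNIV. r $ a *s unit_vec a)"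
  by (simp add: vec_eq_iff axis_def if_distrib[of "\<lambda>x. _ * x"] cong: if_cong)

lemma lattice_induct:
  fixes r :: "int ^ 'n::finite"
  assumes zero: "Q 0" and add: "\<And>x y. Q x \<Longrightarrow> Q y \<Longrightarrow> Q (x + y)" and neg: "\<And>x. Q x \<Longrightarrow> Q (- x)"
    and unit: "\<And>a. Q (unit_vec a)"
  shows "Q r"
proof -
  have nat: "Q (int k *s x)" if "Q x" for k x
    using that by (induction k) (auto simp: vector_sadd_rdistrib intro: zero add)
  have int: "Q (k *s x)" if x: "Q x" for k x
  proof (cases "k \<ge> 0")
    case True
    then show ?thesis using nat[OF x, of "nat k"] by simp
  next
    case False
    then have "Q (- (int (nat (- k)) *s x))" using neg nat[OF x] by blast
    moreover have "- (int (nat (- k)) *s x) = k *s x" using False by (simp add: vec_eq_iff)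
    ultimately show ?thesis by simp
  qed
  have "Q (\<Sum>a\<in>A. r $ a *s unit_vec a)" if "finite A" for A
    using that by (induction A rule: finite_induct) (auto intro: zero add int unit)
  from this[of UNIV] show ?thesis by (simp flip: lattice_expand)
qed


section \<open>Finite differences\<close>

text \<open>The forward difference with step \<open>x\<close>.\<close>

definition dl :: "'g::ab_group_add \<Rightarrow> ('g \<Rightarrow> 'b::ab_group_add) \<Rightarrow> 'g \<Rightarrow> 'b" where
  "dl x H s = H (s + x) - H s"

lemma dl_commute: "dl x (dl y H) = dl y (dl x H)"
  by (rule ext) (simp add: dl_def algebra_simps)

lemma dl_funpow_commute: "dl x ((dl y ^^ n) H) = (dl y ^^ n) (dl x H)"
proof (induction n)
  case (Suc n)
  then show ?case using dl_commute[of x y "(dl y ^^ n) H"] by simp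
qed simp

lemma dl_funpow_funpow_commute: "(dl x ^^ m) ((dl y ^^ n) H) = (dl y ^^ n) ((dl x ^^ m) H)"
proof (induction m)
  case (Suc m)
  then show ?case using dl_funpow_commute[of x n y "(dl x ^^ m) H"] by simp
qed simp

lemma dl_0 [simp]: "dl x (\<lambda>s. 0) = (\<lambda>s. 0)"
  by (simp add: dl_def fun_eq_iff)

lemma dl_funpow_0 [simp]: "(dl x ^^ n) (\<lambda>s. 0) = (\<lambda>s. 0)"
  by (induction n) simp_all

lemma dl_funpow_cong:
  fixes y :: "int ^ 'n::finite"
  assumes "\<And>j. j \<le> n \<Longrightarrow> H (s + int j *s y) = K (s + int j *s y)"
  shows "(dl y ^^ n) H s = (dl y ^^ n) K s"
  using assms
proof (induction n arbitrary: H K)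
  case 0 then show ?case using "0"[of 0] by simp
next
  case (Suc n)
  have "(dl y ^^ n) (dl y H) s = (dl y ^^ n) (dl y K) s"
  proof (rule Suc.IH)
    fix j assume "j \<le> n"
    then show "dl y H (s + int j *s y) = dl y K (s + int j *s y)"
      using Suc.prems[of j] Suc.prems[of "Suc j"] by (simp add: dl_def vector_sadd_rdistrib ac_simps)
  qed
  then show ?case by (simp add: funpow_swap1)
qed

text \<open>The n-th difference is the alternating binomial sum over s, s + y, ..., s + n y; here
  only the first term, with sign (-1)^n, survives.\<close>

lemma dl_funpow_only_start:
  fixes y :: "int ^ 'n::finite"
  assumes "\<And>j. 1 \<le> j \<Longrightarrow> j \<le> n \<Longrightarrow> H (s + int j *s y) = 0"
  shows "(dl y ^^ n) H s = (if even n then H s else - H s)"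
  using assms
proof (induction n arbitrary: H)
  case (Suc n)
  have "dl y H (s + int j *s y) = 0" if "1 \<le> j" "j \<le> n" for j
    using Suc.prems[of j] Suc.prems[of "Suc j"] that
    by (simp add: dl_def vector_sadd_rdistrib ac_simps)
  then have "(dl y ^^ n) (dl y H) s = (if even n then dl y H s else - dl y H s)" by (rule Suc.IH)
  moreover have "dl y H s = - H s" using Suc.prems[of 1] by (simp add: dl_def)
  ultimately show ?case by (simp add: funpow_swap1)
qed simp

text \<open>Transports vanishing along the direction \<open>y\<close>. This is how exceptional
  points, on a hyperplane or at the origin, are reached.\<close>

lemma dl_funpow_propagate:
  fixes y :: "int ^ 'n::finite"
  assumes "(dl y ^^ n) H s = 0" "\<And>j. 1 \<le> j \<Longrightarrow> j \<le> n \<Longrightarrow> H (s + int j *s y) = 0"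
  shows "H s = 0"
  using dl_funpow_only_start[of n H s y] assms by (simp split: if_splits)

lemma dl_additive: "dl x (\<lambda>s. H s + K s) = (\<lambda>s. dl x H s + dl x K s)"
  by (simp add: dl_def fun_eq_iff)

lemma dl_diff: "dl x (\<lambda>s. H s - K s) = (\<lambda>s. dl x H s - dl x K s)"
  by (simp add: dl_def fun_eq_iff)

lemma dl_sum: "dl x (\<lambda>s. \<Sum>i\<in>I. H i s) = (\<lambda>s. \<Sum>i\<in>I. dl x (H i) s)"
  by (simp add: dl_def fun_eq_iff sum_subtractf)

lemma dl_funpow_diff: "(dl x ^^ n) (\<lambda>s. H s - K s) = (\<lambda>s. (dl x ^^ n) H s - (dl x ^^ n) K s)"
  by (induction n) (simp_all add: dl_diff)


text \<open>\<open>pdeg k H\<close>: \<open>H\<close> is a polynomial function of degree less than \<open>k\<close>.\<close>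

primrec pdeg :: "nat \<Rightarrow> ('g::ab_group_add \<Rightarrow> 'b::ab_group_add) \<Rightarrow> bool" where
  "pdeg 0 H \<longleftrightarrow> H = (\<lambda>s. 0)"
| "pdeg (Suc k) H \<longleftrightarrow> (\<forall>x. pdeg k (dl x H))"

lemma pdeg_zero [simp]: "pdeg k (\<lambda>s. 0)"
  by (induction k) simp_all

lemma pdeg_Suc: "pdeg k H \<Longrightarrow> pdeg (Suc k) H"
  by (induction k arbitrary: H) simp_all

lemma pdeg_mono: "pdeg k H \<Longrightarrow> k \<le> l \<Longrightarrow> pdeg l H"
  by (induction l) (auto simp: le_Suc_eq simp del: pdeg.simps(2) intro: pdeg_Suc)

lemma pdeg_add: "pdeg k H \<Longrightarrow> pdeg k K \<Longrightarrow> pdeg k (\<lambda>s. H s + K s)"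
  by (induction k arbitrary: H K) (simp_all add: dl_additive)

lemma pdeg_diff: "pdeg k H \<Longrightarrow> pdeg k K \<Longrightarrow> pdeg k (\<lambda>s. H s - K s)"
  by (induction k arbitrary: H K) (simp_all add: dl_diff)

lemma pdeg_translate: "pdeg k H \<Longrightarrow> pdeg k (\<lambda>s. H (s + y))"
proof (induction k arbitrary: H)
  case (Suc k)
  have "dl x (\<lambda>s. H (s + y)) = (\<lambda>s. dl x H (s + y))" for x
    by (simp add: dl_def fun_eq_iff algebra_simps)
  then show ?case using Suc by simp
qed simp

lemma pdeg_const: "pdeg (Suc 0) (\<lambda>s. c)"
  by (simp add: dl_def fun_eq_iff)

lemma pdeg_funpow: "pdeg k H \<Longrightarrow> (dl y ^^ k) H = (\<lambda>s. 0)"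
  by (induction k arbitrary: H) (simp_all add: funpow_swap1)

text \<open>The steps \<open>x\<close> for which \<open>dl x H\<close> has smaller degree form a
  subgroup, because \<open>dl (x + y) H\<close> is a translate of \<open>dl x H\<close> plus
  \<open>dl y H\<close>.\<close>

lemma pdeg_Suc_of_units:
  fixes H :: "int ^ 'n::finite \<Rightarrow> 'b::ab_group_add"
  assumes "\<And>a. pdeg k (dl (unit_vec a) H)"
  shows "pdeg (Suc k) H"
proof -
  have "pdeg k (dl x H)" for x
  proof (induction x rule: lattice_induct)
    case 1
    show ?case by (simp add: dl_def)
  next
    case (2 x y)
    have "dl (x + y) H = (\<lambda>s. dl x H (s + y) + dl y H s)"
      by (simp add: dl_def fun_eq_iff algebra_simps)
    then show ?case using 2 by (simp add: pdeg_add pdeg_translate)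
  next
    case (3 x)
    have "dl (- x) H = (\<lambda>s. 0 - dl x H (s + (- x)))"
      by (simp add: dl_def fun_eq_iff algebra_simps)
    then show ?case using pdeg_diff[OF pdeg_zero pdeg_translate[OF 3, of "- x"]] by simp
  qed (rule assms)
  then show ?thesis by simp
qed

text \<open>Degree bounds in the single coordinates add up to a bound for the total degree: each
  difference in a coordinate uses up one from its exponent.\<close>

lemma pdeg_of_units:
  fixes H :: "int ^ 'n::finite \<Rightarrow> 'b::ab_group_add"
  assumes "\<And>a. (dl (unit_vec a) ^^ n a) H = (\<lambda>s. 0)"
  shows "pdeg (\<Sum>a\<in>UNIV. n a) H"
  using assms
proof (induction "\<Sum>a\<in>UNIV. n a" arbitrary: n H)
  case 0
  then have "n a = 0" for a by simp
  then show ?case using 0(2)[of undefined] 0(1) by simp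
next
  case (Suc k)
  show ?case
  proof (cases "\<exists>a. n a = 0")
    case True
    then obtain a where "n a = 0" by blast
    with Suc.prems[of a] show ?thesis by simp
  next
    case False
    have "pdeg k (dl (unit_vec a) H)" for a
    proof -
      let ?n = "n(a := n a - 1)"
      have na: "n a = Suc (n a - 1)" using False by (metis not_gr0 Suc_diff_1)
      have "(\<Sum>b\<in>UNIV. n b) = n a + (\<Sum>b\<in>UNIV - {a}. n b)" by (simp add: sum.remove)
      moreover have "(\<Sum>b\<in>UNIV. ?n b) = ?n a + (\<Sum>b\<in>UNIV - {a}. ?n b)" by (rule sum.remove) auto
      moreover have "(\<Sum>b\<in>UNIV - {a}. ?n b) = (\<Sum>b\<in>UNIV - {a}. n b)" by (rule sum.cong) auto
      ultimately have k: "k = (\<Sum>b\<in>UNIV. ?n b)" using Suc.hyps(2) na by simp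
      have "(dl (unit_vec b) ^^ ?n b) (dl (unit_vec a) H) = (\<lambda>s. 0)" for b
      proof (cases "b = a")
        case True
        have "(dl (unit_vec a) ^^ (n a - 1)) (dl (unit_vec a) H) = (dl (unit_vec a) ^^ Suc (n a - 1)) H"
          by (simp add: funpow_swap1)
        then show ?thesis using True Suc.prems[of a] na by simp
      next
        case False
        then show ?thesis using Suc.prems[of b] by (simp add: dl_funpow_commute[symmetric])
      qed
      from Suc.hyps(1)[OF k this] show ?thesis using k by simp
    qed
    then show ?thesis using Suc.hyps(2) pdeg_Suc_of_units by metis
  qed
qed


section \<open>Mixed differences in several directions\<close>

definition dls :: "'g::ab_group_add list \<Rightarrow> ('g \<Rightarrow> 'b::ab_group_add) \<Rightarrow> 'g \<Rightarrow> 'b" where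
  "dls xs H = foldr dl xs H"

lemma dls_simps [simp]: "dls [] H = H" "dls (x # xs) H = dl x (dls xs H)"
  by (simp_all add: dls_def)

lemma dl_dls: "dl x (dls xs H) = dls xs (dl x H)"
  by (induction xs) (simp_all, metis dl_commute)

lemma dls_mset: "mset xs = mset ys \<Longrightarrow> dls xs H = dls ys H"
proof -
  assume "mset xs = mset ys"
  then have "fold dl (rev xs) H = fold dl (rev ys) H"
    by (intro fun_cong[OF fold_multiset_equiv]) (auto simp: fun_eq_iff dl_commute)
  then show ?thesis by (simp add: dls_def foldr_conv_fold)
qed

lemma pdeg_dls: "pdeg (length xs + k) H \<Longrightarrow> pdeg k (dls xs H)"
  by (induction xs arbitrary: H) (simp_all add: dl_dls)

lemma pdeg_dls_zero: "pdeg k H \<Longrightarrow> k \<le> length xs \<Longrightarrow> dls xs H = (\<lambda>s. 0)"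
  using pdeg_dls[of xs 0 H] pdeg_mono by fastforce

lemma pdeg_of_unit_lists:
  fixes H :: "int ^ 'n::finite \<Rightarrow> 'b::ab_group_add"
  assumes "\<And>bs. length bs = k \<Longrightarrow> dls (map unit_vec bs) H = (\<lambda>s. 0)"
  shows "pdeg k H"
  using assms
proof (induction k arbitrary: H)
  case 0 then show ?case using "0"[of "[]"] by simp
next
  case (Suc k)
  have "pdeg k (dl (unit_vec a) H)" for a
    by (rule Suc.IH) (use Suc.prems[of "a # _"] in \<open>simp add: dl_dls\<close>)
  then show ?case by (rule pdeg_Suc_of_units)
qed

lemma dls_diff: "dls xs (\<lambda>s. H s - K s) = (\<lambda>s. dls xs H s - dls xs K s)"
  by (induction xs) (simp_all add: dl_diff)

lemma dls_sum: "dls xs (\<lambda>s. \<Sum>i\<in>I. H i s) = (\<lambda>s. \<Sum>i\<in>I. dls xs (H i) s)"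
  by (induction xs) (simp_all add: dl_sum)

lemma pdeg1_const: "pdeg (Suc 0) H \<Longrightarrow> H s = H 0"
  by (drule pdeg.simps(2)[THEN iffD1, rule_format, of _ _ s], drule pdeg.simps(1)[THEN iffD1])
    (simp add: dl_def fun_eq_iff, metis add_0 eq_iff_diff_eq_0)

text \<open>The differences of an affine function do not depend on the base point, so the step
  \<open>x\<close> may be taken at \<open>y\<close> instead of 0.\<close>

lemma dl_affine_add:
  assumes "pdeg 2 H" shows "dl (x + y) H 0 = dl x H 0 + dl y H 0"
proof -
  have "pdeg (Suc 0) (dl x H)" using assms by (simp add: numeral_2_eq_2)
  from pdeg1_const[OF this, of y] show ?thesis by (simp add: dl_def algebra_simps)
qed

context vector_space
begin

lemma dl_times_additive:
  assumes "\<And>s t. l (s + t) = l s + l t"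
  shows "dl x (\<lambda>s. scale (l s) (H s)) = (\<lambda>s. scale (l s) (dl x H s) + scale (l x) (H (s + x)))"
  by (simp add: fun_eq_iff dl_def assms scale_left_distrib scale_right_diff_distrib)

lemma dl_scale: "dl x (\<lambda>s. scale c (H s)) = (\<lambda>s. scale c (dl x H s))"
  by (simp add: fun_eq_iff dl_def scale_right_diff_distrib)

lemma pdeg_scale: "pdeg k H \<Longrightarrow> pdeg k (\<lambda>s. scale c (H s))"
  by (induction k arbitrary: H) (simp_all add: dl_scale)

lemma pdeg_times_additive:
  assumes l: "\<And>s t. l (s + t) = l s + l t"
  shows "pdeg k H \<Longrightarrow> pdeg (Suc k) (\<lambda>s. scale (l s) (H s))"
proof (induction k arbitrary: H)
  case (Suc k)
  have "pdeg (Suc k) (\<lambda>s. scale (l s) (dl x H s) + scale (l x) (H (s + x)))" for x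
    using Suc.IH[of "dl x H"] Suc.prems
    by (intro pdeg_add pdeg_scale pdeg_translate) simp_all
  then show ?case by (subst pdeg.simps) (simp add: dl_times_additive[OF l] del: pdeg.simps)
qed simp

text \<open>Leibniz rule for differences. The difference of the additive \<open>l\<close> in
  direction \<open>x\<close> is the constant \<open>l x\<close>, so at most one direction can fall
  on \<open>l\<close>; the remaining ones act on \<open>H\<close>, with the base point moved by that
  direction.\<close>

lemma dls_times_additive:
  assumes l: "\<And>s t. l (s + t) = l s + l t"
  shows "dls xs (\<lambda>s. scale (l s) (H s)) = (\<lambda>s. scale (l s) (dls xs H s) +
    (\<Sum>i<length xs. scale (l (xs ! i)) (dls (take i xs @ drop (Suc i) xs) H (s + xs ! i))))"
proof (induction xs)
  case (Cons x xs)
  have tr: "dl x (\<lambda>s. K (s + y)) = (\<lambda>s. dl x K (s + y))" for K :: "_ \<Rightarrow> 'b" and y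
    by (simp add: dl_def fun_eq_iff algebra_simps)
  show ?case
    by (simp add: Cons dl_additive dl_times_additive[OF l] dl_sum dl_scale tr
        sum.lessThan_Suc_shift add.assoc fun_eq_iff del: sum.lessThan_Suc)
qed simp

end

lemma unit_vec_nth: "unit_vec a $ b = (if b = a then 1 else 0 :: int)"
  by (simp add: axis_def)

section \<open>Polynomiality of matrix coefficients\<close>

definition fun_scale :: "complex \<Rightarrow> ('a \<Rightarrow> complex) \<Rightarrow> 'a \<Rightarrow> complex" where
  "fun_scale c f = (\<lambda>x. c * f x)"

lemma vector_space_fun_scale: "vector_space fun_scale"
  by unfold_locales (simp_all add: fun_scale_def fun_eq_iff algebra_simps)

definition xop :: "'m::finite lattice \<Rightarrow> ('m lattice \<Rightarrow> complex) \<Rightarrow> 'm lattice \<Rightarrow> complex" where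
  "xop r G = (\<lambda>s. of_int (om r s) * (G (s + r) - G s - G r))"

locale xop_closed = fd_space fun_scale P Bf for P Bf :: "('m::finite lattice \<Rightarrow> complex) set" +
  assumes xop_closed: "G \<in> P \<Longrightarrow> xop r G \<in> P"
begin

lemma endo_xop: "endo (xop r)"
  unfolding endo_on_def
proof (intro conjI ballI allI)
  show "G \<in> P \<Longrightarrow> xop r G \<in> P" for G by (rule xop_closed)
qed (simp_all add: xop_def fun_scale_def fun_eq_iff algebra_simps)

lemma xop_commute:
  assumes "om r q = 0" shows "xop r (xop q G) = xop q (xop r G)"
proof -
  have "om q r = 0" using assms om_commute[of q r] by simp
  then show ?thesis using assms by (simp add: xop_def om_linear fun_eq_iff algebra_simps)
qed

text \<open>Once the support is known to be a part of one level of \<open>om r\<close>, a vector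
  \<open>t\<close> is chosen that translates this level off itself. On it \<open>xop t\<close> is
  then multiplication by \<open>- om t s\<close>, which takes infinitely many values, in conflict
  with finite dimension.\<close>

lemma xop_eigenvalue_zero:
  assumes G: "G \<in> P" "xop r G = fun_scale \<alpha> G" "\<alpha> \<noteq> 0"
  shows "G = 0"
proof (rule ccontr)
  assume "G \<noteq> 0"
  let ?W = "{G \<in> P. xop r G = fun_scale \<alpha> G}"
  have sub: "subspace ?W"
    by (intro subspaceI) (auto simp: endoD[OF endo_xop] scale_right_distrib scale_left_commute)
  \<comment> \<open>Twice the step gives an operator commuting with \<open>xop r\<close>. Its
    eigenvalue equation is the second condition needed to pin down the level.\<close>
  define q where "q = r + r"
  have oq: "om q s = 2 * om r s" "om r q = 0" for s
    unfolding q_def om_add_left om_add_right by simp_all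
  have stab: "xop q G \<in> ?W" if "G \<in> ?W" for G
    using that xop_closed endoD(3)[OF endo_xop, of G q \<alpha>] by (simp add: xop_commute oq)
  have ne: "?W \<noteq> {0}" using G \<open>G \<noteq> 0\<close> by blast
  obtain \<beta> g where g: "g \<in> ?W" "g \<noteq> 0" "xop q g = fun_scale \<beta> g"
    by (rule eigenvector_exists[OF endo_xop sub _ stab ne]) auto
  have E1: "of_int (om r s) * (g (s + r) - g s - g r) = \<alpha> * g s" for s
    using g(1) by (simp add: xop_def fun_scale_def fun_eq_iff)
  have E2: "2 * of_int (om r s) * (g (s + q) - g s - g q) = \<beta> * g s" for s
    using fun_cong[OF g(3), of s] by (simp add: xop_def fun_scale_def oq)
  \<comment> \<open>Evaluation at \<open>r\<close> and at \<open>q\<close>, where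
    \<open>om r\<close> vanishes.\<close>
  have gr: "g r = 0" using E1[of r] G(3) by simp
  have grr: "g q = 0" using E1[of q] G(3) by (simp add: oq)
  have F1: "of_int (om r s) * (g (s + r) - g s) = \<alpha> * g s" for s using E1[of s] gr by simp
  have F2: "2 * of_int (om r s) * (g (s + r + r) - g s) = \<beta> * g s" for s
    using E2[of s] grr by (simp only: q_def add.assoc diff_0_right)
  \<comment> \<open>With p = \<open>om r s\<close>, one step multiplies \<open>g\<close> by (p +
    \<alpha>) / p, and two steps by 1 + \<beta> / (2 p). As p is unchanged along \<open>r\<close>,
    the square of the first factor equals the second, and this leaves a linear equation for
    p.\<close>
  have level: "om r s \<noteq> 0 \<and> (\<beta> - 4 * \<alpha>) * of_int (om r s) = 2 * \<alpha>\<^sup>2" if "g s \<noteq> 0" for s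
  proof -
    let ?p = "of_int (om r s) :: complex"
    have p0: "om r s \<noteq> 0" using F1[of s] that G(3) by auto
    then have p: "?p \<noteq> 0" by simp
    have a: "?p * g (s + r) = (?p + \<alpha>) * g s" using F1[of s] by (simp add: algebra_simps)
    have b: "?p * g (s + r + r) = (?p + \<alpha>) * g (s + r)"
      using F1[of "s + r"] by (simp add: om_linear algebra_simps)
    have c: "?p * (?p * g (s + r + r)) = (?p + \<alpha>) * ((?p + \<alpha>) * g s)"
      using a b by (metis mult.left_commute)
    have "(2 * ((?p + \<alpha>) * (?p + \<alpha>) - ?p * ?p) - ?p * \<beta>) * g s =
        2 * ((?p + \<alpha>) * ((?p + \<alpha>) * g s)) - 2 * ?p * ?p * g s - ?p * (\<beta> * g s)"
      by (simp only: algebra_simps)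
    also have "\<dots> = 0" unfolding c[symmetric] F2[of s, symmetric] by (simp only: algebra_simps add_0_left)
    finally have "2 * ((?p + \<alpha>) * (?p + \<alpha>) - ?p * ?p) - ?p * \<beta> = 0" using that by simp
    then show ?thesis using p0 by (simp add: algebra_simps power2_eq_square)
  qed
  obtain s0 where s0: "g s0 \<noteq> 0" using g(2) by (auto simp: fun_eq_iff)
  define p where "p = om r s0"
  have p0: "p \<noteq> 0" using level[OF s0] by (simp add: p_def)
  have supp: "om r s = p" if "g s \<noteq> 0" for s
  proof -
    have "(\<beta> - 4 * \<alpha>) * of_int (om r s) = (\<beta> - 4 * \<alpha>) * of_int p"
      using level[OF that] level[OF s0] by (simp add: p_def)
    moreover have "\<beta> - 4 * \<alpha> \<noteq> 0" using level[OF s0] G(3) by auto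
    ultimately show ?thesis by simp
  qed
  \<comment> \<open>Since \<open>om r t = 2 * p\<close>, adding \<open>t\<close> takes the level p
    to 3 p, where \<open>g\<close> vanishes, and \<open>g t = 0\<close> as well.\<close>
  define t where "t = s0 + s0"
  have rt: "om r t = 2 * p" unfolding t_def om_add_right p_def by simp
  have gP: "g \<in> P" using g by simp
  obtain zs where zs: "foldr (shift (xop t)) zs g = 0"
    using annihilating_factors[OF endo_xop gP, of t] .
  \<comment> \<open>Vanishing at \<open>t\<close> and on the levels 3 p, 5 p, ... is preserved by
    every \<open>shift (xop t) z\<close>, so on the level p these operators just multiply by
    \<open>- om t s - z\<close>.\<close>
  have key: "foldr (shift (xop t)) ys g t = 0 \<and>
      (\<forall>k s. 1 \<le> k \<longrightarrow> om r s = (1 + 2 * int k) * p \<longrightarrow> foldr (shift (xop t)) ys g s = 0) \<and>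
      (\<forall>s. om r s = p \<longrightarrow>
        foldr (shift (xop t)) ys g s = prod_list (map (\<lambda>z. - of_int (om t s) - z) ys) * g s)" for ys
  proof (induction ys)
    case Nil
    have "g t = 0" using supp[of t] rt p0 by auto
    moreover have "g s = 0" if "1 \<le> k" "om r s = (1 + 2 * int k) * p" for k s
      using supp[of s] that p0 by auto
    ultimately show ?case by auto
  next
    case (Cons z ys)
    let ?h = "foldr (shift (xop t)) ys g"
    have st: "shift (xop t) z ?h s = of_int (om t s) * (?h (s + t) - ?h s - ?h t) - z * ?h s" for s
      by (simp add: shifted_def xop_def fun_scale_def)
    have up: "?h (s + t) = 0" if "om r s = (1 + 2 * int k) * p" for k s
    proof -
      have "om r (s + t) = (1 + 2 * int (Suc k)) * p" using that rt by (simp add: om_linear algebra_simps)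
      then show ?thesis using Cons by (metis le_add1 plus_1_eq_Suc)
    qed
    have "shift (xop t) z ?h t = 0" using Cons by (simp add: st)
    moreover have "shift (xop t) z ?h s = 0" if "1 \<le> k" "om r s = (1 + 2 * int k) * p" for k s
    proof -
      have "?h s = 0" using Cons that by blast
      then show ?thesis using up[OF that(2)] Cons by (simp add: st)
    qed
    moreover have "shift (xop t) z ?h s = prod_list (map (\<lambda>z. - of_int (om t s) - z) (z # ys)) * g s"
      if "om r s = p" for s
    proof -
      have "?h (s + t) = 0" using up[of s 0] that by simp
      moreover have "?h s = prod_list (map (\<lambda>z. - of_int (om t s) - z) ys) * g s" using Cons that by blast
      ultimately show ?thesis using Cons by (simp add: st algebra_simps)
    qed
    ultimately show ?case by simp
  qed
  \<comment> \<open>The support contains a ray in direction \<open>r\<close>: a zero following a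
    nonzero value would force p + \<alpha> = 0, and then the equation one step earlier makes that
    value zero.\<close>
  have line: "om r (s0 + int k *s r) = p \<and> g (s0 + int k *s r) \<noteq> 0" for k
  proof (induction k)
    case 0 then show ?case using s0 by (simp add: p_def)
  next
    case (Suc k)
    let ?s = "s0 + int k *s r"
    have e: "s0 + int (Suc k) *s r = ?s + r" by (simp add: vector_sadd_rdistrib algebra_simps)
    have "g (?s + r) \<noteq> 0"
    proof
      assume "g (?s + r) = 0"
      then have "(of_int p + \<alpha>) * g ?s = 0" 
        unfolding distrib_right F1[of ?s, symmetric] using Suc by simp
      then have z: "of_int p + \<alpha> = 0" using Suc by simp
      have "of_int p * (g ?s - g (?s - r)) = \<alpha> * g (?s - r)"
        using F1[of "?s - r"] Suc by (simp add: om_linear)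
      then have "of_int p * g ?s = (of_int p + \<alpha>) * g (?s - r)" by (simp add: algebra_simps)
      then show False using z Suc p0 by simp
    qed
    then show ?case using Suc unfolding e by (simp add: om_linear)
  qed
  \<comment> \<open>Along the ray \<open>om t\<close> takes the values - 2 k p, and each of them
    needs its own factor in the annihilating product.\<close>
  have "of_int (2 * int k * p) \<in> set zs" for k
  proof -
    let ?s = "s0 + int k *s r"
    have "prod_list (map (\<lambda>z. - of_int (om t ?s) - z) zs) * g ?s = 0"
      using key[of zs] line[of k] zs by (metis zero_fun_apply)
    then have "prod_list (map (\<lambda>z. - of_int (om t ?s) - z) zs) = 0" using line[of k] by simp
    then obtain z where z: "z \<in> set zs" "- of_int (om t ?s) - z = (0 :: complex)"
      by (auto simp: prod_list_zero_iff)
    have "om t ?s = - (2 * int k * p)"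
      using om_commute[of s0 r] unfolding t_def om_add_left om_add_right om_scale_right p_def by simp
    then show ?thesis using z by simp
  qed
  then have "range (\<lambda>k. of_int (2 * int k * p) :: complex) \<subseteq> set zs" by blast
  then have "finite (range (\<lambda>k. of_int (2 * int k * p) :: complex))" by (rule finite_subset) simp
  moreover have "inj (\<lambda>k. of_int (2 * int k * p) :: complex)"
    using p0 by (auto simp: inj_def simp del: of_int_mult)
  ultimately show False using finite_imageD by blast
qed

text \<open>Even, so that a correction at the origin enters the difference there with sign +1; at
  least 2, so that the special term of \<open>xop_funpow\<close> for \<open>j = 0\<close> is absent;
  and at least \<open>card Bf\<close>.\<close>

definition nil_index :: nat where
  "nil_index = 2 * card Bf + 2"

lemma xop_nilpotent: "G \<in> P \<Longrightarrow> (xop r ^^ nil_index) G = 0"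
proof -
  assume G: "G \<in> P"
  have "(xop r ^^ card Bf) G = 0"
    by (rule nilpotent_of_no_eigenvalue[OF endo_xop _ G]) (use xop_eigenvalue_zero in blast)
  then have "(xop r ^^ (card Bf + 2 + card Bf)) G = 0"
    by (simp only: funpow_add comp_apply endoD(4)[OF endo_funpow[OF endo_xop]])
  then show ?thesis by (simp add: nil_index_def mult_2)
qed

text \<open>\<open>xop r G\<close> vanishes at \<open>r\<close>, and \<open>om r\<close> is constant
  along \<open>r\<close>. So from the second application on the operator is the difference
  multiplied by \<open>om r s\<close>.\<close>

lemma xop_funpow:
  "(xop r ^^ Suc j) G s = of_int (om r s) ^ Suc j * ((dl r ^^ Suc j) G s - (if j = 0 then G r else 0))"
proof (induction j arbitrary: s)
  case 0 show ?case by (simp add: xop_def dl_def)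
next
  case (Suc j)
  let ?H = "(xop r ^^ Suc j) G"
  have "?H r = 0" by (simp only: Suc) simp
  then have "(xop r ^^ Suc (Suc j)) G s = of_int (om r s) * (?H (s + r) - ?H s)"
    by (simp add: xop_def)
  also have "\<dots> = of_int (om r s) ^ Suc (Suc j) * ((dl r ^^ Suc j) G (s + r) - (dl r ^^ Suc j) G s)"
    by (simp only: Suc) (simp add: om_linear algebra_simps)
  also have "(dl r ^^ Suc j) G (s + r) - (dl r ^^ Suc j) G s = (dl r ^^ Suc (Suc j)) G s"
    by (simp only: funpow.simps(2)[of "Suc j"] comp_apply dl_def[of r "(dl r ^^ Suc j) G" s])
  finally show ?case by simp
qed

text \<open>By \<open>xop_funpow\<close> nilpotency of \<open>xop r\<close> says that the difference
  times a power of \<open>om r s\<close> is zero.\<close>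

lemma dl_vanish_off_hyperplane:
  assumes "G \<in> P" "om r s \<noteq> 0"
  shows "(dl r ^^ nil_index) G s = 0"
proof -
  have n: "nil_index = Suc (Suc (2 * card Bf))" by (simp add: nil_index_def)
  have "(xop r ^^ nil_index) G s = 0" using xop_nilpotent[OF assms(1)] by (simp only: zero_fun_apply)
  then show ?thesis using assms(2) unfolding n xop_funpow by simp
qed

text \<open>If \<open>s\<close> lies on the hyperplane of \<open>unit_vec a\<close>, choose a
  direction y that leaves it and for which \<open>om y\<close> is nonzero on the whole segment
  starting at \<open>s\<close>. The y-differences vanish on the segment, hence so does the mixed
  difference at \<open>s\<close>. At s + j y with j >= 1 the difference in direction
  \<open>a\<close> is already zero, and this propagates back to \<open>s\<close>.\<close>

lemma dl_unit_vanish: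
  assumes G: "G \<in> P" and off: "\<And>i. i \<le> nil_index \<Longrightarrow> s + int i *s unit_vec a \<noteq> 0"
  shows "(dl (unit_vec a) ^^ nil_index) G s = 0"
proof (cases "om (unit_vec a) s = 0")
  case False
  then show ?thesis using dl_vanish_off_hyperplane[OF G] by blast
next
  case True
  then have sa: "s $ swap_index a = 0" by (simp add: om_unit_left)
  have "\<exists>y. om (unit_vec a) y \<noteq> 0 \<and> (\<forall>i\<le>nil_index. om y (s + int i *s unit_vec a) \<noteq> 0)"
  proof (cases "\<exists>b. b \<noteq> a \<and> s $ b \<noteq> 0")
    case True
    then obtain b where b: "b \<noteq> a" "s $ b \<noteq> 0" by blast
    define \<delta> where "\<delta> = om (unit_vec (swap_index b)) s"
    have \<delta>: "\<delta> \<noteq> 0" using b by (simp add: \<delta>_def om_unit_left)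
    \<comment> \<open>In \<open>?y\<close> the first summand leaves the hyperplane and the second
      contributes the constant \<open>\<delta>\<close> along the segment. As \<open>j\<close>
      exceeds \<open>\<delta>\<close> in absolute value, a nonzero multiple of \<open>j\<close>
      cannot cancel \<open>\<delta>\<close>.\<close>
    define j where "j = \<bar>\<delta>\<bar> + 1"
    let ?y = "j *s unit_vec (swap_index a) + unit_vec (swap_index b)"
    have "om (unit_vec a) ?y \<noteq> 0" using b by (simp add: om_unit_left unit_vec_nth j_def)
    moreover have "om ?y (s + int i *s unit_vec a) \<noteq> 0" for i
    proof -
      let ?c = "index_sign (swap_index a) * (s $ a + int i)"
      have eq: "om ?y (s + int i *s unit_vec a) = j * ?c + \<delta>"
        using b by (simp add: om_linear om_unit_left \<delta>_def unit_vec_nth algebra_simps)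
      have "\<bar>j * ?c\<bar> \<ge> j" if "?c \<noteq> 0"
      proof -
        have "1 \<le> \<bar>?c\<bar>" using that by linarith
        then have "j * 1 \<le> j * \<bar>?c\<bar>" by (intro mult_left_mono) (auto simp: j_def)
        then show ?thesis by (simp add: abs_mult j_def)
      qed
      then have "j * ?c + \<delta> \<noteq> 0" using \<delta> unfolding j_def
        by (cases "?c = 0") (simp, linarith)
      then show ?thesis using eq by simp
    qed
    ultimately show ?thesis by blast
  next
    case False
    \<comment> \<open>Here \<open>s\<close> lies on the coordinate line of \<open>a\<close>, where
      only the origin is in the way, and the hypothesis excludes it.\<close>
    let ?y = "unit_vec (swap_index a)"
    have "om (unit_vec a) ?y \<noteq> 0" by (simp add: om_unit_left unit_vec_nth)
    moreover have "om ?y (s + int i *s unit_vec a) \<noteq> 0" if i: "i \<le> nil_index" for i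
    proof
      assume "om ?y (s + int i *s unit_vec a) = 0"
      then have "s $ a + int i = 0" by (simp add: om_unit_left unit_vec_nth)
      then have "s + int i *s unit_vec a = 0" using False by (auto simp: vec_eq_iff unit_vec_nth)
      then show False using off[OF i] by blast
    qed
    ultimately show ?thesis by blast
  qed
  then obtain y where y: "om (unit_vec a) y \<noteq> 0" "\<And>i. i \<le> nil_index \<Longrightarrow> om y (s + int i *s unit_vec a) \<noteq> 0"
    by blast
  show ?thesis
  proof (rule dl_funpow_propagate)
    have "(dl (unit_vec a) ^^ nil_index) ((dl y ^^ nil_index) G) s = (dl (unit_vec a) ^^ nil_index) (\<lambda>s. 0) s"
      by (rule dl_funpow_cong) (use dl_vanish_off_hyperplane[OF G] y(2) in simp)
    then show "(dl y ^^ nil_index) ((dl (unit_vec a) ^^ nil_index) G) s = 0"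
      by (simp add: dl_funpow_funpow_commute[of _ y])
    show "(dl (unit_vec a) ^^ nil_index) G (s + int j *s y) = 0" if "1 \<le> j" for j
      by (rule dl_vanish_off_hyperplane[OF G]) (use True y(1) that in \<open>simp add: om_linear\<close>)
  qed
qed

end

section \<open>Correction of the value at the origin\<close>

lemma unit_line_neq_0:
  fixes s :: "int ^ 'n::finite"
  shows "s $ c \<noteq> 0 \<Longrightarrow> c \<noteq> a \<Longrightarrow> s + k *s unit_vec a \<noteq> 0"
  by (auto simp: vec_eq_iff unit_vec_nth)

text \<open>Changing the value at the origin can directly repair one difference, the one in
  direction \<open>b\<close> based at 0, where the correction has sign +1 because \<open>n\<close>
  is even. All other differences that meet the origin follow by propagation in a transverse
  direction.\<close>

lemma dl_fix_origin:
  fixes F :: "'m::finite lattice \<Rightarrow> 'b::ab_group_add" and b :: "'m index"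
  assumes n: "even n"
    and off: "\<And>a s. (\<And>i. i \<le> n \<Longrightarrow> s + int i *s unit_vec a \<noteq> 0) \<Longrightarrow> (dl (unit_vec a) ^^ n) F s = 0"
  defines "F' \<equiv> \<lambda>s. F s - (if s = 0 then (dl (unit_vec b) ^^ n) F 0 else 0)"
  shows "(dl (unit_vec a) ^^ n) F' = (\<lambda>s. 0)"
proof -
  have one: "(dl (unit_vec a) ^^ n) F' s = 0" if "\<And>i. i \<le> n \<Longrightarrow> s + int i *s unit_vec a \<noteq> 0" for a s
  proof -
    have "(dl (unit_vec a) ^^ n) F' s = (dl (unit_vec a) ^^ n) F s"
      by (rule dl_funpow_cong) (use that in \<open>simp add: F'_def\<close>)
    then show ?thesis using off[OF that] by simp
  qed
  have two: "(dl (unit_vec b) ^^ n) F' 0 = 0"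
  proof -
    let ?K = "\<lambda>s. if s = 0 then (dl (unit_vec b) ^^ n) F 0 else 0"
    have "(dl (unit_vec b) ^^ n) ?K 0 = ?K 0"
      by (subst dl_funpow_only_start) (auto simp: n vec_eq_iff unit_vec_nth)
    then show ?thesis unfolding F'_def dl_funpow_diff by simp
  qed
  have hit: "\<exists>i. s = - (int i *s unit_vec a)" if "\<not> (\<forall>i\<le>n. s + int i *s unit_vec a \<noteq> 0)"
    for s :: "'m lattice" and a
    using that by (auto simp: eq_neg_iff_add_eq_0)
  \<comment> \<open>Propagation in direction \<open>b\<close>: the lines in direction
    \<open>a\<close> through the points s + j b, j >= 1, miss the origin.\<close>
  have three: "(dl (unit_vec a) ^^ n) F' s = 0" if "a \<noteq> b" for a s
  proof (cases "\<forall>i\<le>n. s + int i *s unit_vec a \<noteq> 0")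
    case True then show ?thesis using one by blast
  next
    case False
    then obtain i where s: "s = - (int i *s unit_vec a)" using hit by blast
    show ?thesis
    proof (rule dl_funpow_propagate)
      have "(dl (unit_vec b) ^^ n) F' (s + int j *s unit_vec a) = 0" for j
      proof (cases "s + int j *s unit_vec a = 0")
        case True then show ?thesis using two by simp
      next
        case False
        then have "(s + int j *s unit_vec a) $ a \<noteq> 0" by (auto simp: s vec_eq_iff unit_vec_nth)
        then show ?thesis using one unit_line_neq_0 that by blast
      qed
      then have "(dl (unit_vec a) ^^ n) ((dl (unit_vec b) ^^ n) F') s = (dl (unit_vec a) ^^ n) (\<lambda>s. 0) s"
        by (intro dl_funpow_cong) simp
      then show "(dl (unit_vec b) ^^ n) ((dl (unit_vec a) ^^ n) F') s = 0"
        by (simp add: dl_funpow_funpow_commute[of _ "unit_vec b"])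
      show "(dl (unit_vec a) ^^ n) F' (s + int j *s unit_vec b) = 0" if "1 \<le> j" for j
      proof -
        have "(s + int j *s unit_vec b) $ b \<noteq> 0" using that \<open>a \<noteq> b\<close> by (simp add: s unit_vec_nth)
        then show ?thesis using one unit_line_neq_0 \<open>a \<noteq> b\<close> by metis
      qed
    qed
  qed
  \<comment> \<open>The direction \<open>swap_index b\<close>, settled by \<open>three\<close>, now
    serves for the propagation.\<close>
  have four: "(dl (unit_vec b) ^^ n) F' s = 0" for s
  proof (cases "\<forall>i\<le>n. s + int i *s unit_vec b \<noteq> 0")
    case True then show ?thesis using one by blast
  next
    case False
    then obtain i where s: "s = - (int i *s unit_vec b)" using hit by blast
    let ?a = "swap_index b"
    show ?thesis
    proof (rule dl_funpow_propagate)
      have "(dl (unit_vec ?a) ^^ n) F' = (\<lambda>s. 0)" using three[of ?a] by (simp add: fun_eq_iff)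
      then show "(dl (unit_vec ?a) ^^ n) ((dl (unit_vec b) ^^ n) F') s = 0"
        by (simp add: dl_funpow_funpow_commute[of _ "unit_vec ?a"])
      show "(dl (unit_vec b) ^^ n) F' (s + int j *s unit_vec ?a) = 0" if "1 \<le> j" for j
      proof -
        have "(s + int j *s unit_vec ?a) $ ?a \<noteq> 0" using that by (simp add: s unit_vec_nth)
        then show ?thesis using one unit_line_neq_0 by (metis swap_index_neq(1))
      qed
    qed
  qed
  show ?thesis using three four by (cases "a = b") (auto simp: fun_eq_iff)
qed

context fd_space
begin

lemma dl_in_U: "(\<And>s. H s \<in> U) \<Longrightarrow> dl x H s \<in> U"
  by (simp add: dl_def)

lemma dl_funpow_in_U: "(\<And>s. H s \<in> U) \<Longrightarrow> (dl x ^^ n) H s \<in> U"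
  by (induction n arbitrary: s) (simp_all add: dl_in_U)

lemma dls_in_U: "(\<And>s. H s \<in> U) \<Longrightarrow> dls xs H s \<in> U"
  by (induction xs arbitrary: s) (simp_all add: dl_in_U)

lemma dl_funpow_apply:
  assumes "\<And>u v. u \<in> U \<Longrightarrow> v \<in> U \<Longrightarrow> f (u - v) = f u - f v" and H: "\<And>s. H s \<in> U"
  shows "f ((dl x ^^ n) H s) = (dl x ^^ n) (\<lambda>s. f (H s)) s"
proof (induction n arbitrary: s)
  case (Suc n)
  have "f ((dl x ^^ Suc n) H s) = f ((dl x ^^ n) H (s + x)) - f ((dl x ^^ n) H s)"
    using assms(1) dl_funpow_in_U[of H, OF H] by (simp add: dl_def[of x "(dl x ^^ n) H" s])
  then show ?case by (simp add: Suc dl_def[of x "(dl x ^^ n) (\<lambda>s. f (H s))" s])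
qed simp

lemma dls_apply:
  assumes "\<And>u v. u \<in> U \<Longrightarrow> v \<in> U \<Longrightarrow> f (u - v) = f u - f v" and H: "\<And>s. H s \<in> U"
  shows "f (dls xs H s) = dls xs (\<lambda>s. f (H s)) s"
proof (induction xs arbitrary: s)
  case (Cons x xs)
  have "f (dls (x # xs) H s) = f (dls xs H (s + x)) - f (dls xs H s)"
    using assms(1) dls_in_U[of H, OF H] by (simp add: dl_def[of x "dls xs H" s])
  then show ?case by (simp add: Cons dl_def[of x "dls xs (\<lambda>s. f (H s))" s])
qed simp

lemma pdeg_apply:
  assumes f: "\<And>u v. u \<in> U \<Longrightarrow> v \<in> U \<Longrightarrow> f (u - v) = f u - f v"
  shows "(\<And>s. H s \<in> U) \<Longrightarrow> pdeg k H \<Longrightarrow> pdeg k (\<lambda>s. f (H s))"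
proof (induction k arbitrary: H)
  case 0
  then show ?case using f[of 0 0] by simp
next
  case (Suc k)
  have "dl x (\<lambda>s. f (H s)) = (\<lambda>s. f (dl x H s))" for x
    using f Suc.prems(1) by (simp add: dl_def fun_eq_iff)
  then show ?case using Suc.IH[of "dl _ H"] Suc.prems dl_in_U[of H] by simp
qed

lemma endo_diff: "endo S \<Longrightarrow> endo T \<Longrightarrow> endo (\<lambda>u. S u - T u)"
  unfolding endo_on_def by (auto simp: algebra_simps)

lemma endo_add: "endo S \<Longrightarrow> endo T \<Longrightarrow> endo (\<lambda>u. S u + T u)"
  unfolding endo_on_def by (auto simp: algebra_simps)

lemma endo_scale: "endo T \<Longrightarrow> endo (\<lambda>u. sc c (T u))"
  unfolding endo_on_def by (auto simp: algebra_simps)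

lemma endo_compose: "endo S \<Longrightarrow> endo T \<Longrightarrow> endo (\<lambda>u. S (T u))"
  unfolding endo_on_def by auto

lemma endo_dl_funpow: "(\<And>s. endo (D s)) \<Longrightarrow> endo (\<lambda>u. (dl x ^^ n) (\<lambda>s. D s u) t)"
proof (induction n arbitrary: t)
  case (Suc n)
  show ?case using endo_diff[OF Suc.IH[OF Suc.prems, of "t + x"] Suc.IH[OF Suc.prems, of t]]
    by (simp add: dl_def[of x "(dl x ^^ n) _" t])
qed simp

lemma endo_dls: "(\<And>s. endo (D s)) \<Longrightarrow> endo (\<lambda>u. dls xs (\<lambda>s. D s u) t)"
proof (induction xs arbitrary: t)
  case (Cons x xs)
  show ?case using endo_diff[OF Cons.IH[OF Cons.prems, of "t + x"] Cons.IH[OF Cons.prems, of t]]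
    by (simp add: dl_def[of x "dls xs _" t])
qed simp

end

text \<open>\<open>D r\<close> stands for \<open>t\<^sup>-\<^sup>r h(r)\<close> on a weight space; \<open>skew_rel\<close> is the bracket of \<open>\<H>\<^sub>N\<close> in these terms.\<close>

definition (in fd_space) skew_rel :: "('m::finite lattice \<Rightarrow> 'v \<Rightarrow> 'v) \<Rightarrow> 'm lattice \<Rightarrow> 'm lattice \<Rightarrow> 'v \<Rightarrow> bool" where
  "skew_rel D r s u \<longleftrightarrow> D r (D s u) - D s (D r u) = sc (of_int (om r s)) (D (r + s) u - D r u - D s u)"

locale lattice_rep = fd_space sc U B for sc :: "complex \<Rightarrow> 'v::ab_group_add \<Rightarrow> 'v" and U B +
  fixes D :: "'m::finite lattice \<Rightarrow> 'v \<Rightarrow> 'v"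
  assumes endo_D: "endo (D r)"
    and D_rel: "u \<in> U \<Longrightarrow> skew_rel D r s u"
begin

text \<open>The matrix coefficients of \<open>D\<close> in a basis of \<open>U\<close> span a
  finite-dimensional space closed under every \<open>xop r\<close>: by the relation,
  \<open>xop r\<close> sends a coefficient of \<open>D s\<close> to the same coefficient of the
  commutator of \<open>D r\<close> and \<open>D s\<close>.\<close>

lemma matrix_coefficients:
  obtains n where "even n"
    "\<And>u s a. u \<in> U \<Longrightarrow> (\<And>i. i \<le> n \<Longrightarrow> s + int i *s unit_vec a \<noteq> 0) \<Longrightarrow>
       (dl (unit_vec a) ^^ n) (\<lambda>s. D s u) s = 0"
proof -
  obtain E where E: "E \<subseteq> U" "independent E" "U \<subseteq> span E"
    using maximal_independent_subset by blast
  have finE: "finite E" using independent_span_bound[OF finite_B E(2)] E(1) U_span by blast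
  define \<phi> where "\<phi> i v = representation E v i" for i v
  have \<phi>_diff: "\<phi> i (u - v) = \<phi> i u - \<phi> i v" if "u \<in> U" "v \<in> U" for i u v
    using that E representation_diff[of E v u] by (auto simp: \<phi>_def subset_iff)
  have \<phi>_sum: "\<phi> i (\<Sum>j\<in>E. sc (c j) (f j)) = (\<Sum>j\<in>E. c j * \<phi> i (f j))" if "\<And>j. j \<in> E \<Longrightarrow> f j \<in> U" for i c f
    using that E representation_sum[of E E "\<lambda>j. sc (c j) (f j)"] representation_scale[of E]
    by (auto simp: \<phi>_def subset_iff span_scale)
  have \<phi>_scale: "\<phi> i (sc c u) = c * \<phi> i u" if "u \<in> U" for i c u
    using that E representation_scale[of E u c] by (auto simp: \<phi>_def subset_iff)
  have expand: "v = (\<Sum>j\<in>E. sc (\<phi> j v) j)" if "v \<in> U" for v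
    using sum_representation_eq[of E v E] that E finE by (auto simp: \<phi>_def)
  interpret F: vector_space fun_scale by (rule vector_space_fun_scale)
  let ?G = "(\<lambda>(i, j) s. \<phi> i (D s j)) ` (E \<times> E)"
  define P where "P = F.span ?G"
  have F_sum: "(\<lambda>s. \<Sum>j\<in>E. c j * g j s) \<in> P" if "\<And>j. j \<in> E \<Longrightarrow> g j \<in> P" for c :: "'v \<Rightarrow> complex" and g
  proof -
    have "(\<Sum>j\<in>E. fun_scale (c j) (g j)) \<in> P"
      unfolding P_def using that by (intro F.span_sum F.span_scale) (simp add: P_def)
    also have "(\<Sum>j\<in>E. fun_scale (c j) (g j)) = (\<lambda>s. \<Sum>j\<in>E. c j * g j s)"
      using finE by (induction E rule: finite_induct) (simp_all add: fun_eq_iff fun_scale_def)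
    finally show ?thesis .
  qed
  have coeff: "(\<lambda>s. \<phi> i (D s u)) \<in> P" if i: "i \<in> E" and u: "u \<in> U" for i u
  proof -
    have "D s u = (\<Sum>j\<in>E. sc (\<phi> j u) (D s j))" for s
    proof -
      have "D s u = D s (\<Sum>j\<in>E. sc (\<phi> j u) j)" using expand[OF u] by simp
      also have "\<dots> = (\<Sum>j\<in>E. D s (sc (\<phi> j u) j))" using E(1) by (intro endo_sum[OF endo_D]) auto
      also have "\<dots> = (\<Sum>j\<in>E. sc (\<phi> j u) (D s j))"
        using E(1) by (intro sum.cong) (auto simp: endoD[OF endo_D])
      finally show ?thesis .
    qed
    then have "(\<lambda>s. \<phi> i (D s u)) = (\<lambda>s. \<Sum>j\<in>E. \<phi> j u * \<phi> i (D s j))"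
      using E(1) endoD(1)[OF endo_D] by (simp add: \<phi>_sum subset_iff)
    moreover have "(\<lambda>s. \<phi> i (D s j)) \<in> P" if "j \<in> E" for j
      unfolding P_def using i that by (intro F.span_base) auto
    ultimately show ?thesis using F_sum[of "\<lambda>j s. \<phi> i (D s j)" "\<lambda>j. \<phi> j u"] by simp
  qed
  have xop_gen: "xop r (\<lambda>s. \<phi> i (D s j)) \<in> P" if ij: "i \<in> E" "j \<in> E" for r i j
  proof -
    have jU: "j \<in> U" using ij E by blast
    note DU = endoD(1)[OF endo_D]
    have "xop r (\<lambda>s. \<phi> i (D s j)) s = \<phi> i (D r (D s j)) - \<phi> i (D s (D r j))" for s
    proof -
      have "\<phi> i (D r (D s j)) - \<phi> i (D s (D r j)) = \<phi> i (D r (D s j) - D s (D r j))"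
        by (simp add: \<phi>_diff DU jU)
      also have "\<dots> = \<phi> i (sc (of_int (om r s)) (D (r + s) j - D r j - D s j))"
        using D_rel[OF jU, of r s] by (simp add: skew_rel_def)
      also have "\<dots> = of_int (om r s) * (\<phi> i (D (r + s) j) - \<phi> i (D r j) - \<phi> i (D s j))"
        by (simp add: \<phi>_diff \<phi>_scale DU jU)
      finally show ?thesis by (simp add: xop_def algebra_simps)
    qed
    then have eq: "xop r (\<lambda>s. \<phi> i (D s j)) = (\<lambda>s. \<phi> i (D r (D s j))) - (\<lambda>s. \<phi> i (D s (D r j)))"
      by (simp add: fun_eq_iff)
    \<comment> \<open>For fixed \<open>r\<close>, expanding \<open>D s j\<close> in the basis shows
      this function of \<open>s\<close> to be a combination of matrix coefficients, with constants
      taken from \<open>D r\<close>.\<close>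
    have "D r (D s j) = (\<Sum>k\<in>E. sc (\<phi> k (D s j)) (D r k))" for s
    proof -
      have "D r (D s j) = D r (\<Sum>k\<in>E. sc (\<phi> k (D s j)) k)" using expand[OF DU[OF jU]] by simp
      also have "\<dots> = (\<Sum>k\<in>E. D r (sc (\<phi> k (D s j)) k))" using E(1) by (intro endo_sum[OF endo_D]) auto
      also have "\<dots> = (\<Sum>k\<in>E. sc (\<phi> k (D s j)) (D r k))"
        using E(1) by (intro sum.cong) (auto simp: endoD[OF endo_D])
      finally show ?thesis .
    qed
    then have "(\<lambda>s. \<phi> i (D r (D s j))) = (\<lambda>s. \<Sum>k\<in>E. \<phi> i (D r k) * \<phi> k (D s j))"
      using E(1) DU by (simp add: \<phi>_sum subset_iff mult.commute)
    moreover have "(\<lambda>s. \<phi> k (D s j)) \<in> P" if "k \<in> E" for k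
      by (rule coeff[OF that jU])
    ultimately have "(\<lambda>s. \<phi> i (D r (D s j))) \<in> P"
      using F_sum[of "\<lambda>k s. \<phi> k (D s j)" "\<lambda>k. \<phi> i (D r k)"] by simp
    then show ?thesis unfolding eq using coeff[OF ij(1) DU[OF jU]]
      unfolding P_def by (rule F.span_diff)
  qed
  interpret Q: xop_closed P ?G
  proof unfold_locales
    show "F.subspace P" unfolding P_def by (rule F.subspace_span)
    show "finite ?G" using finE by simp
    show "P \<subseteq> F.span ?G" by (simp add: P_def)
    show "xop r G \<in> P" if "G \<in> P" for r G
      using that unfolding P_def
    proof (induction rule: F.span_induct_alt)
      case base
      have "xop r 0 = 0" by (simp add: xop_def fun_eq_iff)
      then show ?case by (simp only: F.span_zero)
    next
      case (step c x y)
      have "xop r (fun_scale c x + y) = fun_scale c (xop r x) + xop r y"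
        by (simp add: xop_def fun_eq_iff fun_scale_def algebra_simps)
      moreover have "xop r x \<in> F.span ?G" using step(1) xop_gen by (auto simp: P_def)
      ultimately show ?case using step(2) by (simp only: F.span_add F.span_scale)
    qed
  qed
  show thesis
  proof (rule that)
    show "even Q.nil_index" by (simp add: Q.nil_index_def)
    fix u s and a :: "'m index"
    assume u: "u \<in> U" and off: "\<And>i. i \<le> Q.nil_index \<Longrightarrow> s + int i *s unit_vec a \<noteq> 0"
    let ?v = "(dl (unit_vec a) ^^ Q.nil_index) (\<lambda>s. D s u) s"
    have H: "D s u \<in> U" for s using endoD(1)[OF endo_D u] .
    have "\<phi> i ?v = 0" if "i \<in> E" for i
      using dl_funpow_apply[of "\<phi> i" "\<lambda>s. D s u", OF \<phi>_diff H] Q.dl_unit_vanish[OF coeff[OF that u] off]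
      by simp
    moreover have "?v = (\<Sum>j\<in>E. sc (\<phi> j ?v) j)" by (rule expand[OF dl_funpow_in_U[OF H]])
    ultimately show "?v = 0" by simp
  qed
qed

text \<open>The correction at the origin might spoil the relation. Its defect \<open>R\<close> is
  polynomial in \<open>s\<close> and zero unless one of r, s, r + s is 0; propagation removes these
  exceptions.\<close>

theorem polynomial_extension:
  obtains D' k where "\<And>r. endo (D' r)" "\<And>r u. r \<noteq> 0 \<Longrightarrow> D' r u = D r u"
    "\<And>u. u \<in> U \<Longrightarrow> pdeg k (\<lambda>s. D' s u)" "\<And>u r s. u \<in> U \<Longrightarrow> skew_rel D' r s u"
proof -
  obtain n where n: "even n"
    "\<And>u s a. u \<in> U \<Longrightarrow> (\<And>i. i \<le> n \<Longrightarrow> s + int i *s unit_vec a \<noteq> 0) \<Longrightarrow>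
       (dl (unit_vec a) ^^ n) (\<lambda>s. D s u) s = 0"
    using matrix_coefficients by metis
  \<comment> \<open>An arbitrary direction, used to normalise the correction.\<close>
  define b :: "'m index" where "b = undefined"
  define D' where "D' s u = D s u - (if s = 0 then (dl (unit_vec b) ^^ n) (\<lambda>s. D s u) 0 else 0)" for s u
  have E': "endo (D' r)" for r
    unfolding D'_def using endo_diff[OF endo_D endo_dl_funpow[OF endo_D]] endo_D
    by (cases "r = 0") simp_all
  \<comment> \<open>The successor makes \<open>k\<close> positive, so that constants have degree
    less than \<open>k\<close>.\<close>
  define k where "k = Suc (\<Sum>a\<in>(UNIV :: 'm index set). n)"
  have pd: "pdeg k (\<lambda>s. D' s u)" if u: "u \<in> U" for u
  proof -
    have "(dl (unit_vec a) ^^ n) (\<lambda>s. D' s u) = (\<lambda>s. 0)" for a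
      unfolding D'_def by (rule dl_fix_origin[OF n(1) n(2)[OF u]])
    then have "pdeg (\<Sum>a\<in>(UNIV :: 'm index set). n) (\<lambda>s. D' s u)" by (rule pdeg_of_units)
    then show ?thesis unfolding k_def by (rule pdeg_Suc)
  qed
  note D'U = endoD(1)[OF E']
  define R where "R r s u = sc (of_int (om r s)) (D' (r + s) u - D' r u - D' s u) - (D' r (D' s u) - D' s (D' r u))" for r s u
  have R_sym: "R s r u = - R r s u" for r s u
    using om_commute[of s r] by (simp add: R_def add.commute[of s r] algebra_simps)
  have R_generic: "R r s u = 0" if "r \<noteq> 0" "s \<noteq> 0" "r + s \<noteq> 0" "u \<in> U" for r s u
    using that D_rel[of u r s] by (simp add: R_def D'_def skew_rel_def)
  have R_pd: "pdeg (Suc k) (\<lambda>s. R r s u)" if u: "u \<in> U" for r u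
  proof -
    have c: "pdeg k (\<lambda>s. D' r u)" by (rule pdeg_mono[OF pdeg_const]) (simp add: k_def)
    have t: "pdeg k (\<lambda>s. D' (r + s) u)" using pdeg_translate[OF pd[OF u], of r] by (simp add: add.commute)
    have 1: "pdeg (Suc k) (\<lambda>s. sc (of_int (om r s)) (D' (r + s) u - D' r u - D' s u))"
      by (rule pdeg_times_additive, simp add: om_linear, intro pdeg_diff c t pd[OF u])
    have 2: "pdeg (Suc k) (\<lambda>s. D' r (D' s u) - D' s (D' r u))"
      by (intro pdeg_Suc pdeg_diff pdeg_apply[of "D' r"] pd) (auto simp: endoD[OF E'] u D'U)
    show ?thesis unfolding R_def by (intro pdeg_diff 1 2)
  qed
  have R_nonzero: "R r s u = 0" if r: "r \<noteq> 0" and u: "u \<in> U" for r s u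
  proof (cases "s = 0 \<or> r + s = 0")
    case True
    obtain c where c: "r $ c \<noteq> 0" using r by (auto simp: vec_eq_iff)
    \<comment> \<open>A coordinate direction other than \<open>c\<close>, in which \<open>r\<close>
      is nonzero: then s + j y with j >= 1 avoids both 0 and - r.\<close>
    let ?y = "unit_vec (swap_index c)"
    show ?thesis
    proof (rule dl_funpow_propagate)
      show "(dl ?y ^^ Suc k) (\<lambda>s. R r s u) s = 0" using pdeg_funpow[OF R_pd[OF u]] by metis
      show "R r (s + int j *s ?y) u = 0" if "1 \<le> j" for j
      proof (rule R_generic[OF r _ _ u])
        have y0: "int j *s ?y \<noteq> 0" using that by (auto simp: vec_eq_iff unit_vec_nth)
        show "s + int j *s ?y \<noteq> 0"
        proof (cases "s = 0")
          case False
          then have "s = - r" using True by (metis add_eq_0_iff)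
          then have "s $ c \<noteq> 0" using c by simp
          then show ?thesis by (rule unit_line_neq_0) simp
        qed (use y0 in simp)
        show "r + (s + int j *s ?y) \<noteq> 0"
        proof (cases "s = 0")
          case True
          then show ?thesis using unit_line_neq_0[OF c, of "swap_index c" "int j"] by simp
        next
          case False
          then have "r + s = 0" using True by blast
          then show ?thesis using y0 by (simp flip: add.assoc)
        qed
      qed
    qed
  next
    case False
    then show ?thesis using R_generic r u by blast
  qed
  have "R r s u = 0" if u: "u \<in> U" for r s u
  proof (cases "r = 0")
    case True
    then show ?thesis using R_nonzero[of s u r] R_sym[of s r u] u
      by (cases "s = 0") (auto simp: R_def om_linear)
  qed (use R_nonzero u in blast)
  then have "skew_rel D' r s u" if "u \<in> U" for r s u
    using that by (simp add: R_def skew_rel_def)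
  then show thesis using that[of D' k] E' pd by (simp add: D'_def)
qed

end

section \<open>Irreducible polynomial representations are quadratic\<close>

text \<open>\<open>D 0 = 0\<close> is not assumed, since the polynomial extension may have changed
  the value at the origin; it is derived in \<open>odd_part_scalar\<close>.\<close>

locale irreducible_lattice_rep = fd_space sc U B for sc :: "complex \<Rightarrow> 'v::ab_group_add \<Rightarrow> 'v" and U B +
  fixes D :: "'m::finite lattice \<Rightarrow> 'v \<Rightarrow> 'v"
  assumes endo_D: "endo (D r)"
    and D_rel: "u \<in> U \<Longrightarrow> skew_rel D r s u"
    and U_nonzero: "U \<noteq> {0}"
    and irr: "subspace W \<Longrightarrow> W \<subseteq> U \<Longrightarrow> (\<And>r w. w \<in> W \<Longrightarrow> D r w \<in> W) \<Longrightarrow> W = {0} \<or> W = U"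
begin

lemma D_U [simp, intro]: "u \<in> U \<Longrightarrow> D r u \<in> U"
  using endoD(1)[OF endo_D] .

lemma D_rel':
  "u \<in> U \<Longrightarrow> D r (D s u) - D s (D r u) = sc (of_int (om r s)) (D (r + s) u - D r u - D s u)"
  using D_rel by (simp add: skew_rel_def)

text \<open>If the degree is at most the length of \<open>xs\<close>, this is the full polarization
  of the homogeneous part of that degree.\<close>

definition top_form :: "'m lattice list \<Rightarrow> 'v \<Rightarrow> 'v" where
  "top_form xs u = dls xs (\<lambda>s. D s u) 0"

lemma endo_top_form: "endo (top_form xs)"
  unfolding top_form_def using endo_dls[OF endo_D] .

lemma top_form_mset: "mset xs = mset ys \<Longrightarrow> top_form xs = top_form ys"
  unfolding top_form_def by (simp add: dls_mset[of xs ys] fun_eq_iff)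

text \<open>Take the mixed difference of the relation in \<open>s\<close>. As
  \<open>om r 0 = 0\<close>, exactly one direction must fall on \<open>om r\<close>, and the others
  together with \<open>dl r\<close> give a top form again. Since the length is at least two, a
  difference is left to kill the constant \<open>D r u\<close>.\<close>

lemma top_form_bracket:
  assumes u: "u \<in> U" and len: "length xs \<ge> 2" and pd: "pdeg (Suc (length xs)) (\<lambda>s. D s u)"
  shows "D r (top_form xs u) - top_form xs (D r u) =
    (\<Sum>i<length xs. sc (of_int (om r (xs ! i))) (top_form (r # take i xs @ drop (Suc i) xs) u))"
proof -
  let ?rm = "\<lambda>i. take i xs @ drop (Suc i) xs"
  let ?H = "dl r (\<lambda>s. D s u)"
  let ?l = "\<lambda>s. of_int (om r s) :: complex"
  have l: "?l (s + t) = ?l s + ?l t" for s t by (simp add: om_linear)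
  have "D r (top_form xs u) = dls xs (\<lambda>s. D r (D s u)) 0"
    unfolding top_form_def using u by (intro dls_apply) (auto simp: endoD[OF endo_D])
  then have "D r (top_form xs u) - top_form xs (D r u) = dls xs (\<lambda>s. D r (D s u) - D s (D r u)) 0"
    by (simp add: top_form_def dls_diff)
  also have "(\<lambda>s. D r (D s u) - D s (D r u)) = (\<lambda>s. sc (?l s) (?H s - D r u))"
    by (simp add: D_rel'[OF u] dl_def add.commute algebra_simps)
  also have "dls xs \<dots> 0 = (\<Sum>i<length xs. sc (?l (xs ! i)) (dls (?rm i) (\<lambda>s. ?H s - D r u) (xs ! i)))"
    by (simp add: dls_times_additive[OF l] om_linear)
  also have "\<dots> = (\<Sum>i<length xs. sc (?l (xs ! i)) (top_form (r # ?rm i) u))"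
  proof (rule sum.cong[OF refl])
    fix i assume i: "i \<in> {..<length xs}"
    have lrm: "Suc (length (?rm i)) = length xs" using i by auto
    have "dls (?rm i) (\<lambda>s. D r u) = (\<lambda>s. 0)"
      by (rule pdeg_dls_zero[OF pdeg_const]) (use lrm len in linarith)
    moreover have "pdeg (Suc 0) (dls (?rm i) ?H)"
    proof (rule pdeg_dls)
      have eq: "length (?rm i) + Suc 0 = length xs" using lrm by simp
      have "pdeg (length xs) ?H" using pd unfolding pdeg.simps(2) by blast
      then show "pdeg (length (?rm i) + Suc 0) ?H" unfolding eq .
    qed
    ultimately have "dls (?rm i) (\<lambda>s. ?H s - D r u) (xs ! i) = dls (?rm i) ?H 0"
      by (simp add: dls_diff pdeg1_const[of "dls (?rm i) ?H" "xs ! i"] del: dls_simps pdeg.simps)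
    also have "\<dots> = top_form (r # ?rm i) u" by (simp add: top_form_def dl_dls del: length_append)
    finally show "sc (?l (xs ! i)) (dls (?rm i) (\<lambda>s. ?H s - D r u) (xs ! i)) =
      sc (?l (xs ! i)) (top_form (r # ?rm i) u)" by simp
  qed
  finally show ?thesis .
qed

text \<open>As a function of \<open>r\<close>, the commutator of \<open>D r\<close> with
  \<open>top_form xs\<close> is a sum of linear forms times affine functions. Its degree is at most
  two, and at least three differences along \<open>ys\<close> annihilate it.\<close>

lemma top_forms_commute:
  assumes u: "u \<in> U" and len: "length xs \<ge> 3" "length ys = length xs"
    and pd: "\<And>u. u \<in> U \<Longrightarrow> pdeg (Suc (length xs)) (\<lambda>s. D s u)"
  shows "top_form ys (top_form xs u) = top_form xs (top_form ys u)"
proof -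
  let ?rm = "\<lambda>i. take i xs @ drop (Suc i) xs"
  let ?K = "\<lambda>i. dls (?rm i) (\<lambda>s. D s u)"
  have "top_form ys (top_form xs u) - top_form xs (top_form ys u) =
      dls ys (\<lambda>r. D r (top_form xs u) - top_form xs (D r u)) 0"
  proof -
    have "top_form xs (top_form ys u) = dls ys (\<lambda>r. top_form xs (D r u)) 0"
      unfolding top_form_def[of ys u] using u
      by (intro dls_apply) (auto simp: endoD[OF endo_top_form])
    then show ?thesis by (simp add: top_form_def[of ys "top_form xs u"] dls_diff)
  qed
  also have "(\<lambda>r. D r (top_form xs u) - top_form xs (D r u)) =
      (\<lambda>r. \<Sum>i<length xs. sc (of_int (om r (xs ! i))) (?K i r - ?K i 0))"
  proof
    fix r
    have "top_form (r # ?rm i) u = ?K i r - ?K i 0" for i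
      by (simp add: top_form_def dl_def[of r "?K i"])
    then show "D r (top_form xs u) - top_form xs (D r u) =
        (\<Sum>i<length xs. sc (of_int (om r (xs ! i))) (?K i r - ?K i 0))"
      using top_form_bracket[OF u _ pd[OF u]] len(1) by simp
  qed
  also have "dls ys \<dots> 0 = (\<Sum>i<length xs. dls ys (\<lambda>r. sc (of_int (om r (xs ! i))) (?K i r - ?K i 0)) 0)"
    by (simp only: dls_sum)
  also have "\<dots> = 0"
  proof (intro sum.neutral ballI)
    fix i assume i: "i \<in> {..<length xs}"
    have lrm: "length (?rm i) + 2 = Suc (length xs)" using i by auto
    have "pdeg 2 (?K i)" by (rule pdeg_dls) (simp only: lrm pd[OF u])
    then have "pdeg 2 (\<lambda>r. ?K i r - ?K i 0)"
      by (rule pdeg_diff) (rule pdeg_mono[OF pdeg_const], simp)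
    then have "pdeg (Suc 2) (\<lambda>r. sc (of_int (om r (xs ! i))) (?K i r - ?K i 0))"
      by (rule pdeg_times_additive[rotated]) (simp add: om_linear)
    then have "dls ys (\<lambda>r. sc (of_int (om r (xs ! i))) (?K i r - ?K i 0)) = (\<lambda>s. 0)"
      by (rule pdeg_dls_zero) (use len in simp)
    then show "dls ys (\<lambda>r. sc (of_int (om r (xs ! i))) (?K i r - ?K i 0)) 0 = 0" by metis
  qed
  finally show ?thesis by simp
qed

text \<open>The top form is a nonzero multiple of the commutator of \<open>D\<close> at
  \<open>unit_vec a\<close> with the top form in which one \<open>a\<close> is replaced by its
  partner. As top forms commute, it is not injective. Its generalized null space is stable under all
  \<open>D r\<close>, so irreducibility makes it all of \<open>U\<close>.\<close>

lemma top_form_nilpotent: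
  assumes len: "length bs \<ge> 3" and pd: "\<And>u. u \<in> U \<Longrightarrow> pdeg (Suc (length bs)) (\<lambda>s. D s u)"
    and u: "u \<in> U"
  shows "(top_form (map unit_vec bs) ^^ card B) u = 0"
proof -
  obtain a cs where bs: "bs = a # cs" using len by (cases bs) auto
  let ?x = "unit_vec a :: 'm lattice" and ?y = "unit_vec (swap_index a) :: 'm lattice"
  let ?F = "top_form (map unit_vec bs)"
  let ?zs = "?y # map unit_vec cs"
  let ?Z = "top_form ?zs"
  let ?rm = "\<lambda>xs i. take i xs @ drop (Suc i) xs"
  \<comment> \<open>Each occurrence of the partner in \<open>?zs\<close> contributes the same term
    with the same sign, so nothing cancels, and the head of the list is one occurrence.\<close>
  define n where "n = card {i. i < length ?zs \<and> ?zs ! i = ?y}"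
  have fin: "finite {i. i < length ?zs \<and> ?zs ! i = ?y}" by simp
  have "n \<noteq> 0"
    unfolding n_def card_0_eq[OF fin] by (simp add: set_eq_iff) (metis nth_Cons_0 zero_less_Suc)
  define c where "c = (of_int (index_sign a) * of_nat n :: complex)"
  have c: "c \<noteq> 0" using \<open>n \<noteq> 0\<close> by (simp add: c_def)
  have comm: "D ?x (?Z v) - ?Z (D ?x v) = sc c (?F v)" if v: "v \<in> U" for v
  proof -
    have "D ?x (?Z v) - ?Z (D ?x v) =
        (\<Sum>i<length ?zs. sc (of_int (om ?x (?zs ! i))) (top_form (?x # ?rm ?zs i) v))"
      using len bs pd[OF v] by (intro top_form_bracket[OF v]) auto
    also have "\<dots> = (\<Sum>i<length ?zs. if ?zs ! i = ?y then sc (of_int (index_sign a)) (?F v) else 0)"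
    proof (rule sum.cong[OF refl])
      fix i assume "i \<in> {..<length ?zs}"
      then have i: "i < length ?zs" by simp
      have "\<exists>b. ?zs ! i = unit_vec b" using i by (cases i) auto
      then obtain b where b: "?zs ! i = unit_vec b" by blast
      show "sc (of_int (om ?x (?zs ! i))) (top_form (?x # ?rm ?zs i) v) =
          (if ?zs ! i = ?y then sc (of_int (index_sign a)) (?F v) else 0)"
      proof (cases "?zs ! i = ?y")
        case True
        have "?zs = take i ?zs @ ?zs ! i # drop (Suc i) ?zs" using i by (rule id_take_nth_drop)
        then have "mset ?zs = mset (take i ?zs @ ?zs ! i # drop (Suc i) ?zs)" by (rule arg_cong)
        then have "mset ?zs = add_mset ?y (mset (?rm ?zs i))" using True by simp
        then have "mset (?rm ?zs i) = mset (map unit_vec cs)" by simp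
        then have "top_form (?x # ?rm ?zs i) = ?F" by (intro top_form_mset) (simp add: bs)
        moreover have "om ?x ?y = index_sign a" by (simp add: om_unit_left unit_vec_nth)
        ultimately show ?thesis unfolding True by simp
      next
        case False
        then have "b \<noteq> swap_index a" using b by metis
        then have "om ?x (?zs ! i) = 0" unfolding b by (simp add: om_unit_left unit_vec_nth)
        then show ?thesis using False by simp
      qed
    qed
    also have "\<dots> = (\<Sum>i | i < length ?zs \<and> ?zs ! i = ?y. sc (of_int (index_sign a)) (?F v))"
      by (subst sum.inter_filter[symmetric]) (simp_all add: lessThan_def)
    also have "\<dots> = sc c (?F v)"
      by (simp only: sum_constant_scale c_def n_def mult.commute scale_scale)
    finally show ?thesis .
  qed
  have lenb: "length (map unit_vec bs :: 'm lattice list) \<ge> 3" using len by simp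
  have EF: "endo ?F" and EZ: "endo ?Z" by (rule endo_top_form)+
  obtain w where w: "w \<in> U" "w \<noteq> 0" "sc c (?F w) = 0"
  proof (rule commutator_not_injective[OF endo_D EZ endo_scale[OF EF] U_nonzero])
    show "sc c (?F v) = D ?x (?Z v) - ?Z (D ?x v)" if "v \<in> U" for v using comm[OF that] by simp
    show "sc c (?F (?Z v)) = ?Z (sc c (?F v))" if "v \<in> U" for v
    proof -
      have "?F (?Z v) = ?Z (?F v)"
        using len bs pd that by (intro top_forms_commute) auto
      then show ?thesis using endoD(3)[OF EZ endoD(1)[OF EF that]] by simp
    qed
  qed
  then have Fw: "?F w = 0" using c by simp
  let ?W = "{u \<in> U. (?F ^^ card B) u = 0}"
  have "?W = {0} \<or> ?W = U"
  proof (rule irr)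
    show "subspace ?W" by (rule generalized_null_space_subspace[OF EF])
    show "D r v \<in> ?W" if v: "v \<in> ?W" for r v
    proof -
      let ?G = "\<lambda>u. D r (?F u) - ?F (D r u)"
      have "(?F ^^ card B) (D r v) = 0"
      proof (rule generalized_null_space_stable[OF endo_D EF])
        show "endo ?G" by (rule endo_diff[OF endo_compose[OF endo_D EF] endo_compose[OF EF endo_D]])
        \<comment> \<open>The commutator \<open>?G\<close> is a combination of top forms of the same
          length, and these commute with \<open>?F\<close>.\<close>
        show "?G (?F u) = ?F (?G u)" if u: "u \<in> U" for u
        proof -
          let ?bs = "map unit_vec bs :: 'm lattice list"
          have G: "?G u = (\<Sum>i<length ?bs. sc (of_int (om r (?bs ! i))) (top_form (r # ?rm ?bs i) u))" if "u \<in> U" for u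
            using len pd[OF that] by (intro top_form_bracket[OF that]) auto
          have cm: "top_form (r # ?rm ?bs i) (?F u) = ?F (top_form (r # ?rm ?bs i) u)" if "i < length ?bs" for i
            using that len pd by (intro top_forms_commute[OF u]) auto
          have "?F (?G u) = (\<Sum>i<length ?bs. ?F (sc (of_int (om r (?bs ! i))) (top_form (r # ?rm ?bs i) u)))"
            unfolding G[OF u] by (intro endo_sum[OF EF]) (auto intro: endoD(1)[OF endo_top_form] u)
          also have "\<dots> = ?G (?F u)"
            unfolding G[OF endoD(1)[OF EF u]]
            by (intro sum.cong) (auto simp: cm endoD[OF EF] endoD(1)[OF endo_top_form] u)
          finally show ?thesis ..
        qed
      qed (use v in auto)
      then show ?thesis using v by blast
    qed
  qed auto
  moreover have "w \<in> ?W" using nilpotency_index_bound[OF EF w(1), of 1] Fw w(1) by simp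
  ultimately have "?W = U" using w(2) by blast
  then show ?thesis using u by blast
qed

text \<open>The commuting nilpotent top forms have a common kernel vector, on which the degree
  drops. The vectors of lower degree form a \<open>D\<close>-stable subspace, hence all of
  \<open>U\<close>.\<close>

lemma degree_descent:
  assumes M: "M \<ge> 3" and pd: "\<And>u. u \<in> U \<Longrightarrow> pdeg (Suc M) (\<lambda>s. D s u)" and u: "u \<in> U"
  shows "pdeg M (\<lambda>s. D s u)"
proof -
  let ?L = "{bs :: 'm index list. length bs = M}"
  let ?S = "(\<lambda>bs. top_form (map unit_vec bs)) ` ?L"
  have "finite {bs :: 'm index list. set bs \<subseteq> UNIV \<and> length bs = M}"
    by (rule finite_lists_length_eq) simp
  then have finS: "finite ?S" by simp
  obtain w where w: "w \<in> U" "w \<noteq> 0" "\<And>F. F \<in> ?S \<Longrightarrow> F w = 0"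
  proof (rule commuting_nilpotents_common_kernel[OF finS _ U_nonzero])
    show "endo F" if "F \<in> ?S" for F using that endo_top_form by blast
    show "(F ^^ card B) u = 0" if "F \<in> ?S" "u \<in> U" for F u
      using that top_form_nilpotent M pd by blast
    show "F (G u) = G (F u)" if FG: "F \<in> ?S" "G \<in> ?S" "u \<in> U" for F G u
    proof -
      obtain bs cs where "F = top_form (map unit_vec bs)" "length bs = M"
        "G = top_form (map unit_vec cs)" "length cs = M" using FG by blast
      then show ?thesis using top_forms_commute[OF FG(3), of "map unit_vec cs" "map unit_vec bs"] M pd by simp
    qed
  qed blast
  have "dls (map unit_vec bs) (\<lambda>s. D s w) = (\<lambda>s. 0)" if "length bs = M" for bs
  proof
    fix s
    have "pdeg (Suc 0) (dls (map unit_vec bs) (\<lambda>s. D s w))"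
      by (rule pdeg_dls) (use pd[OF w(1)] that in simp)
    then have "dls (map unit_vec bs) (\<lambda>s. D s w) s = top_form (map unit_vec bs) w"
      unfolding top_form_def by (rule pdeg1_const)
    also have "\<dots> = 0" using w(3) that by blast
    finally show "dls (map unit_vec bs) (\<lambda>s. D s w) s = 0" .
  qed
  then have pw: "pdeg M (\<lambda>s. D s w)" by (rule pdeg_of_unit_lists)
  let ?W = "{u \<in> U. pdeg M (\<lambda>s. D s u)}"
  have "?W = {0} \<or> ?W = U"
  proof (rule irr)
    show "subspace ?W"
    proof (rule subspaceI)
      show "x + y \<in> ?W" if "x \<in> ?W" "y \<in> ?W" for x y
        using that by (simp add: endoD[OF endo_D] pdeg_add)
      show "sc c x \<in> ?W" if "x \<in> ?W" for c x
        using that by (simp add: endoD[OF endo_D] pdeg_scale)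
    qed (simp add: endoD(4)[OF endo_D])
    \<comment> \<open>By the relation \<open>D s (D r v)\<close> is \<open>D r (D s v)\<close> minus
      \<open>om r s\<close> times a function of \<open>s\<close> whose degree is smaller by
      one.\<close>
    show "D r v \<in> ?W" if v: "v \<in> ?W" for r v
    proof -
      obtain K where K: "M = Suc K" using M by (cases M) auto
      have vU: "v \<in> U" and pv: "pdeg M (\<lambda>s. D s v)" using v by auto
      have "pdeg K (dl r (\<lambda>s. D s v))" using pv K by simp
      moreover have "pdeg K (\<lambda>s. D r v)" by (rule pdeg_mono[OF pdeg_const]) (use K M in simp)
      ultimately have "pdeg K (\<lambda>s. dl r (\<lambda>s. D s v) s - D r v)" by (rule pdeg_diff)
      then have "pdeg M (\<lambda>s. sc (of_int (om r s)) (dl r (\<lambda>s. D s v) s - D r v))"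
        unfolding K by (rule pdeg_times_additive[rotated]) (simp add: om_linear)
      moreover have "pdeg M (\<lambda>s. D r (D s v))"
        by (rule pdeg_apply[OF _ _ pv]) (use vU in \<open>auto simp: endoD[OF endo_D]\<close>)
      ultimately have "pdeg M (\<lambda>s. D r (D s v) - sc (of_int (om r s)) (dl r (\<lambda>s. D s v) s - D r v))"
        by (intro pdeg_diff)
      also have "(\<lambda>s. D r (D s v) - sc (of_int (om r s)) (dl r (\<lambda>s. D s v) s - D r v)) = (\<lambda>s. D s (D r v))"
      proof
        fix s
        have "dl r (\<lambda>s. D s v) s - D r v = D (r + s) v - D r v - D s v"
          by (simp add: dl_def add.commute)
        then show "D r (D s v) - sc (of_int (om r s)) (dl r (\<lambda>s. D s v) s - D r v) = D s (D r v)"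
          by (simp only: D_rel'[OF vU, of r s, symmetric]) simp
      qed
      finally show ?thesis using vU by simp
    qed
  qed auto
  moreover have "w \<in> ?W" using w pw by simp
  ultimately have "?W = U" using w(2) by blast
  then show ?thesis using u by blast
qed

lemma quadratic:
  assumes pd: "\<And>u. u \<in> U \<Longrightarrow> pdeg k (\<lambda>s. D s u)" and "u \<in> U"
  shows "pdeg 3 (\<lambda>s. D s u)"
proof (cases "k \<ge> 3")
  case True
  then show ?thesis using assms
    by (induction k rule: dec_induct) (use degree_descent in blast)+
next
  case False
  then show ?thesis using pdeg_mono[OF pd[OF assms(2)], of 3] by simp
qed

text \<open>For quadratic \<open>D\<close> twice the odd part, \<open>A r\<close>, is linear in
  \<open>r\<close>, and its commutator with \<open>D s\<close> is \<open>- 2 * om r s\<close> times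
  \<open>D 0\<close>. Schur's lemma makes \<open>D 0\<close> a scalar, which must be zero; then
  \<open>A r\<close> is central and so a scalar as well.\<close>

lemma odd_part_scalar:
  assumes pd: "\<And>u. u \<in> U \<Longrightarrow> pdeg 3 (\<lambda>s. D s u)"
  obtains l where "\<And>r s. l (r + s) = l r + l s"
    "\<And>r u. u \<in> U \<Longrightarrow> D r u - D (- r) u = sc (2 * l r) u" "\<And>u. u \<in> U \<Longrightarrow> D 0 u = 0"
proof -
  \<comment> \<open>The summand \<open>D 0 u\<close> makes \<open>b\<close> the second difference
    while \<open>D 0\<close> is not yet known to vanish.\<close>
  define b where "b r s u = D (r + s) u - D r u - D s u + D 0 u" for r s u
  have b_dl: "b r s u = dl r (dl s (\<lambda>s. D s u)) 0" for r s u
    by (simp add: b_def dl_def)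
  have b_add: "b (r + r') s u = b r s u + b r' s u" if "u \<in> U" for r r' s u
    unfolding b_dl using pd[OF that] by (intro dl_affine_add) (simp add: numeral_3_eq_3 numeral_2_eq_2)
  have b_sym: "b r s u = b s r u" for r s u by (simp add: b_def add.commute)
  have b_neg: "b (- r) s u = - b r s u" if "u \<in> U" for r s u
  proof -
    have "b (r + - r) s u = 0" by (simp add: b_def)
    then show ?thesis unfolding b_add[OF that] by (simp add: eq_neg_iff_add_eq_0 add.commute)
  qed
  have b_neg': "b r (- s) u = - b r s u" if "u \<in> U" for r s u
    using b_neg[OF that, of s r] by (simp add: b_sym)
  have D_add: "D (r + s) u = D r u + D s u + b r s u - D 0 u" for r s u by (simp add: b_def)
  define A where "A r u = D r u - D (- r) u" for r u
  have EA: "endo (A r)" for r unfolding A_def by (intro endo_diff endo_D)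
  have A_comm: "A r (D s u) - D s (A r u) = sc (- 2 * of_int (om r s)) (D 0 u)" if u: "u \<in> U" for r s u
  proof -
    have "A r (D s u) - D s (A r u) =
        (D r (D s u) - D s (D r u)) - (D (- r) (D s u) - D s (D (- r) u))"
      using u by (simp add: A_def endoD[OF endo_D])
    also have "\<dots> = sc (of_int (om r s)) (b r s u - D 0 u) - sc (of_int (om (- r) s)) (b (- r) s u - D 0 u)"
      unfolding D_rel'[OF u] by (simp add: b_def)
    also have "\<dots> = sc (of_int (om r s)) (b r s u - D 0 u) + sc (of_int (om r s)) (- b r s u - D 0 u)"
      by (simp add: b_neg[OF u] om_linear)
    also have "\<dots> = sc (of_int (om r s)) (- D 0 u - D 0 u)"
      unfolding scale_right_distrib[symmetric] by simp
    also have "- D 0 u - D 0 u = sc (- 2) (D 0 u)"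
      using scale_left_distrib[of "- 1" "- 1" "D 0 u"] by simp
    also have "sc (of_int (om r s)) \<dots> = sc (- 2 * of_int (om r s)) (D 0 u)"
      by (simp only: scale_scale mult.commute)
    finally show ?thesis .
  qed
  have D0_comm: "D 0 (D s u) = D s (D 0 u)" if "u \<in> U" for s u
    using D_rel'[OF that, of 0 s] by (simp add: om_linear)
  obtain \<kappa> where \<kappa>: "\<And>u. u \<in> U \<Longrightarrow> D 0 u = sc \<kappa> u"
    by (rule schur_scalar[OF endo_D U_nonzero, of UNIV D 0]) (use irr endo_D D0_comm in auto)
  \<comment> \<open>Otherwise a nonzero scalar would be a commutator on a nonzero finite-dimensional
    space.\<close>
  have "\<kappa> = 0"
  proof (rule ccontr)
    assume k0: "\<kappa> \<noteq> 0"
    define a :: "'m index" where "a = undefined"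
    let ?r = "unit_vec a :: 'm lattice" and ?s = "unit_vec (swap_index a) :: 'm lattice"
    define c where "c = - 2 * of_int (om ?r ?s) * \<kappa>"
    have "c \<noteq> 0" using k0 by (simp add: c_def om_unit_left unit_vec_nth)
    have Ec: "endo (sc c)" unfolding endo_on_def by (auto simp: scale_right_distrib mult.commute)
    obtain u where "u \<in> U" "u \<noteq> 0" "sc c u = 0"
    proof (rule commutator_not_injective[OF EA endo_D Ec U_nonzero])
      show "sc c u = A ?r (D ?s u) - D ?s (A ?r u)" if "u \<in> U" for u
        unfolding A_comm[OF that] \<kappa>[OF that] by (simp add: c_def)
      show "sc c (D ?s u) = D ?s (sc c u)" if "u \<in> U" for u
        using that by (simp add: endoD[OF endo_D])
    qed
    then show False using \<open>c \<noteq> 0\<close> by simp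
  qed
  then have D0: "D 0 u = 0" if "u \<in> U" for u using \<kappa>[OF that] by simp
  have "\<exists>z. \<forall>u\<in>U. A r u = sc z u" for r
  proof -
    obtain z where "\<And>u. u \<in> U \<Longrightarrow> A r u = sc z u"
    proof (rule schur_scalar[OF EA U_nonzero, of UNIV D r])
      show "A r (D s u) = D s (A r u)" if "u \<in> U" for s u using A_comm[OF that, of r s] D0[OF that] by simp
    qed (use irr endo_D in auto)
    then show ?thesis by blast
  qed
  then obtain z where z: "\<And>r u. u \<in> U \<Longrightarrow> A r u = sc (z r) u" by metis
  have A_add: "A (r + s) u = A r u + A s u" if u: "u \<in> U" for r s u
    using b_neg[OF u, of r "- s"] b_neg'[OF u, of r s] D0[OF u]
    by (simp add: A_def D_add[of r s] D_add[of "- r" "- s", simplified] algebra_simps)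
  obtain w where w: "w \<in> U" "w \<noteq> 0" using U_nonzero U_closed(1) by blast
  have z_add: "z (r + s) = z r + z s" for r s
  proof -
    have "sc (z (r + s)) w = sc (z r + z s) w"
      using A_add[OF w(1)] by (simp add: z[OF w(1)] scale_left_distrib)
    then show ?thesis using w(2) by simp
  qed
  show thesis
  proof (rule that[of "\<lambda>r. z r / 2"])
    show "z (r + s) / 2 = z r / 2 + z s / 2" for r s by (simp add: z_add add_divide_distrib)
    show "D r u - D (- r) u = sc (2 * (z r / 2)) u" if "u \<in> U" for r u
      using z[OF that, of r] by (simp add: A_def)
  qed (rule D0)
qed

end

text \<open>The extension and \<open>D\<close> agree off the origin, and at the origin both turn out
  to vanish, so the conclusions pass to \<open>D\<close> itself.\<close>

theorem (in lattice_rep) irreducible_structure: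
  assumes D0: "\<And>u. u \<in> U \<Longrightarrow> D 0 u = 0" and U: "U \<noteq> {0}"
    and irr: "\<And>W. subspace W \<Longrightarrow> W \<subseteq> U \<Longrightarrow> (\<And>r w. w \<in> W \<Longrightarrow> D r w \<in> W) \<Longrightarrow> W = {0} \<or> W = U"
  obtains l where "\<And>r s. l (r + s) = l r + l s"
    "\<And>r u. u \<in> U \<Longrightarrow> D r u - D (- r) u = sc (2 * l r) u" "\<And>u. u \<in> U \<Longrightarrow> pdeg 3 (\<lambda>s. D s u)"
proof -
  obtain D' k where D': "\<And>r. endo (D' r)" "\<And>r u. r \<noteq> 0 \<Longrightarrow> D' r u = D r u"
    "\<And>u. u \<in> U \<Longrightarrow> pdeg k (\<lambda>s. D' s u)" "\<And>u r s. u \<in> U \<Longrightarrow> skew_rel D' r s u"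
    using polynomial_extension by blast
  interpret D': irreducible_lattice_rep sc U B D'
  proof unfold_locales
    show "W = {0} \<or> W = U" if W: "subspace W" "W \<subseteq> U" "\<And>r w. w \<in> W \<Longrightarrow> D' r w \<in> W" for W
    proof (rule irr[OF W(1,2)])
      show "D r w \<in> W" if "w \<in> W" for r w
        using W(3)[OF that, of r] D'(2)[of r w] D0[of w] subspace_0[OF W(1)] W(2) that
        by (cases "r = 0") auto
    qed
  qed (use D' U in auto)
  have pd: "u \<in> U \<Longrightarrow> pdeg 3 (\<lambda>s. D' s u)" for u using D'.quadratic[OF D'(3)] .
  obtain l where l: "\<And>r s. l (r + s) = l r + l s"
    "\<And>r u. u \<in> U \<Longrightarrow> D' r u - D' (- r) u = sc (2 * l r) u" "\<And>u. u \<in> U \<Longrightarrow> D' 0 u = 0"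
    using D'.odd_part_scalar[OF pd] by metis
  have eq: "D' r u = D r u" if "u \<in> U" for r u
    using D'(2)[of r u] D0[OF that] l(3)[OF that] by (cases "r = 0") auto
  show thesis
  proof (rule that[OF l(1)])
    show "pdeg 3 (\<lambda>s. D s u)" if "u \<in> U" for u using pd[OF that] eq[OF that] by simp
    show "D r u - D (- r) u = sc (2 * l r) u" if "u \<in> U" for r u using l(2)[OF that] eq[OF that] by simp
  qed
qed

section \<open>Rank one elements of the symplectic Lie algebra\<close>

lemma vector_space_mat_scale: "vector_space mat_scale"
  by unfold_locales (simp_all add: mat_scale_def vec_eq_iff algebra_simps)

interpretation mat: vector_space mat_scale
  by (rule vector_space_mat_scale)

lemma mat_scale_nth [simp]: "mat_scale c M $ i $ j = c * M $ i $ j"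
  by (simp add: mat_scale_def)

lemma E_nth: "E a b $ i $ j = (if i = a \<and> j = b then 1 else 0)"
  by (simp add: E_def)

text \<open>\<open>rank1 r\<close> is \<open>r\<close> times the row vector representing \<open>om r\<close>.\<close>

definition rank1 :: "'m::finite lattice \<Rightarrow> complex ^ 'm index ^ 'm index" where
  "rank1 r = (\<chi> a b. of_int (r $ a) * of_int (- index_sign b * r $ swap_index b))"

lemma rank1_nth: "rank1 r $ a $ b = of_int (r $ a) * of_int (- index_sign b * r $ swap_index b)"
  by (simp add: rank1_def)

lemma sum_index: "(\<Sum>a\<in>(UNIV :: 'm::finite index set). f a) = (\<Sum>i\<in>UNIV. f (Inl i)) + (\<Sum>i\<in>UNIV. f (Inr i))"
  by (subst UNIV_sum, subst sum.union_disjoint) (auto simp: sum.reindex)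

lemma om_eq_sum: "om r s = (\<Sum>c\<in>UNIV. - index_sign c * r $ swap_index c * s $ c)"
  by (simp add: om_def sum_index sum_subtractf sum_negf)

lemma rank1_mult: "(rank1 r ** rank1 s) $ a $ b =
    of_int (om r s) * (of_int (r $ a) * of_int (- index_sign b * s $ swap_index b))"
  by (simp add: matrix_matrix_mult_def rank1_nth om_eq_sum sum_distrib_left sum_distrib_right
      mult.assoc mult.commute mult.left_commute)

text \<open>The product of two such matrices is \<open>om r s\<close> times the column
  \<open>r\<close> times the row of \<open>s\<close>, so antisymmetry of \<open>om\<close> turns the
  commutator into a multiple of the polarization of \<open>rank1\<close>. This is the relation of
  \<open>D\<close>, realised by matrices.\<close>

lemma rank1_bracket:
  "rank1 r ** rank1 s - rank1 s ** rank1 r =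
     mat_scale (of_int (om r s)) (rank1 (r + s) - rank1 r - rank1 s)"
  by (simp add: vec_eq_iff rank1_mult om_commute[of s r])
    (simp add: rank1_nth algebra_simps)

lemma rank1_minus: "rank1 (- r) = rank1 r"
  by (simp add: vec_eq_iff rank1_nth)

lemma rank1_0: "rank1 0 = 0"
  by (simp add: vec_eq_iff rank1_nth)

lemma sum_if_pair:
  fixes f :: "'m::{finite,linorder} \<Rightarrow> 'm \<Rightarrow> complex"
  shows "(\<Sum>i\<in>UNIV. \<Sum>j\<in>{j. i < j}. if p = i \<and> q = j then f i j else 0) = (if p < q then f p q else 0)"
    and "(\<Sum>i\<in>UNIV. \<Sum>j\<in>{j. i < j}. if p = j \<and> q = i then f i j else 0) = (if q < p then f q p else 0)"
proof -
  have "(\<Sum>j\<in>{j. i < j}. if p = i \<and> q = j then f i j else 0) =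
      (if p = i then (if p < q then f p q else 0) else 0)" for i
    by (cases "p = i") auto
  then show "(\<Sum>i\<in>UNIV. \<Sum>j\<in>{j. i < j}. if p = i \<and> q = j then f i j else 0) = (if p < q then f p q else 0)"
    by simp
  have "(\<Sum>j\<in>{j. i < j}. if p = j \<and> q = i then f i j else 0) =
      (if q = i then (if q < p then f q p else 0) else 0)" for i
    by (cases "q = i") auto
  then show "(\<Sum>i\<in>UNIV. \<Sum>j\<in>{j. i < j}. if p = j \<and> q = i then f i j else 0) = (if q < p then f q p else 0)"
    by simp
qed

text \<open>The quadratic terms in the formula for h(r) are the image of this single matrix.
  Together with \<open>rank1_bracket\<close> this explains why the formula defines an
  action.\<close>

lemma rank1_expand:
  fixes r :: "'m::{finite,linorder} lattice"
  defines "n \<equiv> \<lambda>a. of_int (r $ a) :: complex"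
  shows "rank1 r =
      (\<Sum>i\<in>UNIV. mat_scale (n (Inr i) ^ 2) (E (Inr i) (Inl i))
        + mat_scale (n (Inl i) * n (Inr i)) (E (Inl i) (Inl i) - E (Inr i) (Inr i))
        - mat_scale (n (Inl i) ^ 2) (E (Inl i) (Inr i)))
    + (\<Sum>i\<in>UNIV. \<Sum>j\<in>{j. i < j}.
          mat_scale (n (Inr i) * n (Inr j)) (E (Inr j) (Inl i) + E (Inr i) (Inl j))
        + mat_scale (n (Inl i) * n (Inr j)) (E (Inl i) (Inl j) - E (Inr j) (Inr i))
        + mat_scale (n (Inl j) * n (Inr i)) (E (Inl j) (Inl i) - E (Inr i) (Inr j))
        - mat_scale (n (Inl i) * n (Inl j)) (E (Inl i) (Inr j) + E (Inl j) (Inr i)))"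
    (is "_ = ?A + ?B")
proof -
  have diag: "(\<Sum>i\<in>UNIV. if p = i \<and> q = i then f i else 0) = (if p = q then f p else 0)"
    for p q :: 'm and f :: "'m \<Rightarrow> complex"
  proof -
    have "(if p = i \<and> q = i then f i else 0) = (if p = i then (if p = q then f p else 0) else 0)" for i
      by auto
    then show ?thesis by simp
  qed
  have times_if: "c * (if P then 1 else 0) = (if P then c else 0)" for c :: complex and P by simp
  note expand = rank1_nth E_nth times_if distrib_left right_diff_distrib sum.distrib sum_subtractf
    sum_negf diag sum_if_pair index_sign.simps swap_index.simps n_def sum_component
  have "rank1 r $ a $ b = (?A + ?B) $ a $ b" for a b
  \<comment> \<open>The double sum runs over i < j, so within each block the order of the two
    indices decides which single term contributes.\<close>
  proof (cases a; cases b)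
    fix p q assume "a = Inl p" "b = Inl q"
    then show ?thesis
      by (cases p q rule: linorder_cases) (simp_all add: expand less_imp_neq less_imp_neq[symmetric] less_not_sym)
  next
    fix p q assume "a = Inl p" "b = Inr q"
    then show ?thesis
      by (cases p q rule: linorder_cases) (simp_all add: expand power2_eq_square less_imp_neq less_imp_neq[symmetric] less_not_sym)
  next
    fix p q assume "a = Inr p" "b = Inl q"
    then show ?thesis
      by (cases p q rule: linorder_cases) (simp_all add: expand power2_eq_square less_imp_neq less_imp_neq[symmetric] less_not_sym)
  next
    fix p q assume "a = Inr p" "b = Inr q"
    then show ?thesis
      by (cases p q rule: linorder_cases) (simp_all add: expand less_imp_neq less_imp_neq[symmetric] less_not_sym)
  qed
  then show ?thesis by (simp add: vec_eq_iff)
qed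

section \<open>Generation of sp_N by rank one matrices\<close>

definition sp_gens :: "(complex ^ 'm::finite index ^ 'm index) set" where
  "sp_gens = {E (Inl i) (Inl j) - E (Inr j) (Inr i) | i j. True} \<union>
             {E (Inl i) (Inr j) + E (Inl j) (Inr i) | i j. True} \<union>
             {E (Inr i) (Inl j) + E (Inr j) (Inl i) | i j. True}"

lemma sp_carrier: "lie_carrier sp = mat.span sp_gens"
  by (simp add: sp_def sp_gens_def)

lemma sp_simps: "lie_scale sp = mat_scale" "lie_bracket sp = (\<lambda>X Y. X ** Y - Y ** X)"
  by (simp_all add: sp_def)

lemma sp_generators_in_sp:
  "E (Inl i) (Inl j) - E (Inr j) (Inr i) \<in> lie_carrier sp"
  "E (Inl i) (Inr j) + E (Inl j) (Inr i) \<in> lie_carrier sp"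
  "E (Inr i) (Inl j) + E (Inr j) (Inl i) \<in> lie_carrier sp"
  "E (Inl i) (Inr i) \<in> lie_carrier sp" "E (Inr i) (Inl i) \<in> lie_carrier sp"
proof -
  show 1: "E (Inl i) (Inl j) - E (Inr j) (Inr i) \<in> lie_carrier sp"
    and 2: "E (Inl i) (Inr j) + E (Inl j) (Inr i) \<in> lie_carrier sp"
    and 3: "E (Inr i) (Inl j) + E (Inr j) (Inl i) \<in> lie_carrier sp" for i j
    unfolding sp_carrier sp_gens_def by (intro mat.span_base; blast)+
  have "mat_scale (1/2) (E (Inl i) (Inr i) + E (Inl i) (Inr i)) \<in> lie_carrier sp"
    using 2[of i i] unfolding sp_carrier by (rule mat.span_scale)
  also have "mat_scale (1/2) (E (Inl i) (Inr i) + E (Inl i) (Inr i)) = E (Inl i) (Inr i)"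
    by (simp add: vec_eq_iff)
  finally show "E (Inl i) (Inr i) \<in> lie_carrier sp" .
  have "mat_scale (1/2) (E (Inr i) (Inl i) + E (Inr i) (Inl i)) \<in> lie_carrier sp"
    using 3[of i i] unfolding sp_carrier by (rule mat.span_scale)
  also have "mat_scale (1/2) (E (Inr i) (Inl i) + E (Inr i) (Inl i)) = E (Inr i) (Inl i)"
    by (simp add: vec_eq_iff)
  finally show "E (Inr i) (Inl i) \<in> lie_carrier sp" .
qed

lemma sp_closed:
  "0 \<in> lie_carrier sp" "M \<in> lie_carrier sp \<Longrightarrow> M' \<in> lie_carrier sp \<Longrightarrow> M + M' \<in> lie_carrier sp"
  "M \<in> lie_carrier sp \<Longrightarrow> M' \<in> lie_carrier sp \<Longrightarrow> M - M' \<in> lie_carrier sp"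
  "M \<in> lie_carrier sp \<Longrightarrow> mat_scale c M \<in> lie_carrier sp"
  "(\<And>i. i \<in> I \<Longrightarrow> f i \<in> lie_carrier sp) \<Longrightarrow> (\<Sum>i\<in>I. f i) \<in> lie_carrier sp"
  unfolding sp_carrier
  by (simp_all add: mat.span_zero mat.span_add mat.span_diff mat.span_scale mat.span_sum)

lemma rank1_in_sp: "rank1 (r :: 'm::{finite,linorder} lattice) \<in> lie_carrier sp"
proof -
  have s: "E (Inr j) (Inl i) + E (Inr i) (Inl j) \<in> lie_carrier sp" for i j :: 'm
    using sp_generators_in_sp(3)[of j i] .
  show ?thesis
    unfolding rank1_expand by (intro sp_closed s sp_generators_in_sp)
qed

text \<open>Polarizing the quadratic map \<open>rank1\<close> at unit vectors gives the defining
  generators, up to sign.\<close>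

lemma sp_carrier_rank1: "lie_carrier sp = mat.span (range (rank1 :: 'm::{finite,linorder} lattice \<Rightarrow> _))"
proof
  show "mat.span (range (rank1 :: 'm lattice \<Rightarrow> _)) \<subseteq> lie_carrier sp"
    using rank1_in_sp unfolding sp_carrier by (intro mat.span_minimal mat.subspace_span) auto
  define P where "P a b = rank1 (unit_vec a + unit_vec b) - rank1 (unit_vec a) - rank1 (unit_vec b)"
    for a b :: "'m index"
  have P: "P a b \<in> mat.span (range rank1)" for a b
    unfolding P_def by (intro mat.span_diff mat.span_base) auto
  have P_nth: "P a b $ c $ e =
      of_int (unit_vec a $ c * (- index_sign e * unit_vec b $ swap_index e) +
       unit_vec b $ c * (- index_sign e * unit_vec a $ swap_index e))" for a b c e
    by (simp add: P_def rank1_nth algebra_simps)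
  have sw: "Inl i = swap_index e \<longleftrightarrow> e = Inr i" "Inr i = swap_index e \<longleftrightarrow> e = Inl i"
    "swap_index e = Inl i \<longleftrightarrow> e = Inr i" "swap_index e = Inr i \<longleftrightarrow> e = Inl i"
    for i and e :: "'m index"
    by (cases e; auto)+
  have 1: "E (Inl i) (Inl j) - E (Inr j) (Inr i) = P (Inl i) (Inr j)" for i j
    by (auto simp: vec_eq_iff P_nth E_nth unit_vec_nth sw)
  have 2: "E (Inl i) (Inr j) + E (Inl j) (Inr i) = mat_scale (- 1) (P (Inl i) (Inl j))" for i j
    by (auto simp: vec_eq_iff P_nth E_nth unit_vec_nth sw)
  have 3: "E (Inr i) (Inl j) + E (Inr j) (Inl i) = P (Inr i) (Inr j)" for i j
    by (auto simp: vec_eq_iff P_nth E_nth unit_vec_nth sw)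
  have "sp_gens \<subseteq> mat.span (range (rank1 :: 'm lattice \<Rightarrow> _))"
    unfolding sp_gens_def 1 2 3 using P mat.span_scale[OF P] by blast
  then show "lie_carrier sp \<subseteq> mat.span (range (rank1 :: 'm lattice \<Rightarrow> _))"
    unfolding sp_carrier by (intro mat.span_minimal mat.subspace_span)
qed

text \<open>The linear form in \<open>r\<close> by which the scalars of a_N enter the formula for
  h(r).\<close>

definition ell :: "complex ^ 'm::finite index \<Rightarrow> 'm lattice \<Rightarrow> complex" where
  "ell \<mu> r = (\<Sum>i\<in>UNIV. of_int (r $ Inr i) * \<mu> $ Inr i - of_int (r $ Inl i) * \<mu> $ Inl i)"

lemma ell_add: "ell \<mu> (r + s) = ell \<mu> r + ell \<mu> s"
  by (simp add: ell_def algebra_simps sum.distrib sum_subtractf)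

lemma ell_minus: "ell \<mu> (- r) = - ell \<mu> r"
  by (simp add: ell_def sum_negf[symmetric])

lemma ell_eq_sum: "ell \<mu> r = (\<Sum>a\<in>UNIV. of_int (index_sign a * r $ a) * \<mu> $ a)"
  by (simp add: ell_def sum_index sum_subtractf sum_negf)

lemma ell_unit: "ell \<mu> (unit_vec a) = of_int (index_sign a) * \<mu> $ a"
  by (simp add: ell_eq_sum unit_vec_nth if_distrib[of "\<lambda>x. _ * x"] if_distrib[of "\<lambda>x. x * _"]
      if_distrib[of of_int] cong: if_cong)

lemma ell_inject: "(\<And>r. ell \<mu> r = ell \<nu> r) \<Longrightarrow> \<mu> = \<nu>"
proof -
  assume "\<And>r. ell \<mu> r = ell \<nu> r"
  then have "of_int (index_sign a) * \<mu> $ a = of_int (index_sign a) * \<nu> $ a" for a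
    by (metis ell_unit)
  then show ?thesis by (simp add: vec_eq_iff)
qed

lemma additive_eq_ell:
  assumes add: "\<And>r s :: 'm::finite lattice. l (r + s) = l r + (l s :: complex)"
  obtains \<mu> where "\<And>r. l r = ell \<mu> r"
proof -
  define \<mu> where "\<mu> = (\<chi> a. of_int (index_sign a) * l (unit_vec a))"
  have z: "l 0 = 0" using add[of 0 0] by simp
  have "l r = ell \<mu> r" for r
  proof (induction r rule: lattice_induct)
    case 1 show ?case using z by (simp add: ell_eq_sum)
  next
    case (2 x y) then show ?case by (simp add: add ell_add)
  next
    case (3 x)
    have "l x + l (- x) = 0" using add[of x "- x"] z by simp
    then show ?case using 3 by (simp add: ell_minus eq_neg_iff_add_eq_0 add.commute)
  next
    case (4 a)
    have "of_int (index_sign a) * (of_int (index_sign a) * c) = (c :: complex)" for c by (cases a) auto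
    then show ?case by (simp add: ell_unit \<mu>_def)
  qed
  then show thesis by (rule that)
qed


section \<open>Modules over \<open>sp\<^sub>N \<oplus> a\<^sub>N\<close>\<close>

lemma lie_moduleD:
  assumes "lie_module L V"
  shows "vector_space (mscale V)" "module.subspace (mscale V) (mcarrier V)"
    "x \<in> lie_carrier L \<Longrightarrow> endo_on (mscale V) (mcarrier V) (mact V x)"
    "x \<in> lie_carrier L \<Longrightarrow> y \<in> lie_carrier L \<Longrightarrow> v \<in> mcarrier V \<Longrightarrow> mact V (x + y) v = mact V x v + mact V y v"
    "x \<in> lie_carrier L \<Longrightarrow> v \<in> mcarrier V \<Longrightarrow> mact V (lie_scale L c x) v = mscale V c (mact V x v)"
    "x \<in> lie_carrier L \<Longrightarrow> y \<in> lie_carrier L \<Longrightarrow> v \<in> mcarrier V \<Longrightarrow>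
       mact V (lie_bracket L x y) v = mact V x (mact V y v) - mact V y (mact V x v)"
  using assms unfolding lie_module_def endo_on_def by auto

lemma lie_moduleI:
  assumes "vector_space (mscale V)" "module.subspace (mscale V) (mcarrier V)"
    "\<And>x. x \<in> lie_carrier L \<Longrightarrow> endo_on (mscale V) (mcarrier V) (mact V x)"
    "\<And>x y v. x \<in> lie_carrier L \<Longrightarrow> y \<in> lie_carrier L \<Longrightarrow> v \<in> mcarrier V \<Longrightarrow> mact V (x + y) v = mact V x v + mact V y v"
    "\<And>c x v. x \<in> lie_carrier L \<Longrightarrow> v \<in> mcarrier V \<Longrightarrow> mact V (lie_scale L c x) v = mscale V c (mact V x v)"
    "\<And>x y v. x \<in> lie_carrier L \<Longrightarrow> y \<in> lie_carrier L \<Longrightarrow> v \<in> mcarrier V \<Longrightarrow>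
       mact V (lie_bracket L x y) v = mact V x (mact V y v) - mact V y (mact V x v)"
  shows "lie_module L V"
  using assms unfolding lie_module_def endo_on_def by auto

lemma sp_a_simps:
  "lie_carrier sp_a = lie_carrier sp \<times> UNIV"
  "lie_scale sp_a c (M, x) = (mat_scale c M, c *s x)"
  "lie_bracket sp_a (M, x) (M', x') = (M ** M' - M' ** M, 0)"
  by (simp_all add: lie_sum_def abelian_def sp_simps)

locale sp_a_module =
  fixes V :: "('m::{finite,linorder} spa, 'v::ab_group_add) lie_mod" and B :: "'v set"
  assumes V: "lie_module sp_a V" and finite_B: "finite B" and span_B: "module.span (mscale V) B = mcarrier V"

sublocale sp_a_module \<subseteq> fd_space "mscale V" "mcarrier V" B
  using lie_moduleD(1,2)[OF V] finite_B span_B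
  unfolding fd_space_def fd_space_axioms_def complex_space_def by auto

context sp_a_module
begin

abbreviation "\<phi> M \<equiv> mact V (M, 0)"

lemma endo_act: "M \<in> lie_carrier sp \<Longrightarrow> endo (mact V (M, x))"
  using lie_moduleD(3)[OF V, of "(M, x)"] by (simp add: sp_a_simps)

lemma phi_add: "M \<in> lie_carrier sp \<Longrightarrow> M' \<in> lie_carrier sp \<Longrightarrow> v \<in> mcarrier V \<Longrightarrow> \<phi> (M + M') v = \<phi> M v + \<phi> M' v"
  using lie_moduleD(4)[OF V, of "(M, 0)" "(M', 0)" v] by (simp add: sp_a_simps)

lemma phi_scale: "M \<in> lie_carrier sp \<Longrightarrow> v \<in> mcarrier V \<Longrightarrow> \<phi> (mat_scale c M) v = mscale V c (\<phi> M v)"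
  using lie_moduleD(5)[OF V, of "(M, 0)" v c] by (simp add: sp_a_simps)

lemma phi_0: "v \<in> mcarrier V \<Longrightarrow> \<phi> 0 v = 0"
  using phi_scale[of 0 v 0] sp_closed(1) by (simp add: vec_eq_iff)

lemma phi_diff: "M \<in> lie_carrier sp \<Longrightarrow> M' \<in> lie_carrier sp \<Longrightarrow> v \<in> mcarrier V \<Longrightarrow> \<phi> (M - M') v = \<phi> M v - \<phi> M' v"
  using phi_add[of "M - M'" M' v] sp_closed(3)[of M M'] by (simp add: algebra_simps)

lemma phi_sum: "(\<And>i. i \<in> I \<Longrightarrow> f i \<in> lie_carrier sp) \<Longrightarrow> v \<in> mcarrier V \<Longrightarrow> \<phi> (\<Sum>i\<in>I. f i) v = (\<Sum>i\<in>I. \<phi> (f i) v)"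
  by (induction I rule: infinite_finite_induct) (simp_all add: phi_0 phi_add sp_closed)

lemma phi_bracket: "M \<in> lie_carrier sp \<Longrightarrow> M' \<in> lie_carrier sp \<Longrightarrow> v \<in> mcarrier V \<Longrightarrow>
    \<phi> (M ** M' - M' ** M) v = \<phi> M (\<phi> M' v) - \<phi> M' (\<phi> M v)"
  using lie_moduleD(6)[OF V, of "(M, 0)" "(M', 0)" v] by (simp add: sp_a_simps)

lemma act_split: "M \<in> lie_carrier sp \<Longrightarrow> v \<in> mcarrier V \<Longrightarrow> mact V (M, x) v = \<phi> M v + mact V (0, x) v"
  using lie_moduleD(4)[OF V, of "(M, 0)" "(0, x)" v] by (simp add: sp_a_simps sp_closed)

lemma act_sum_abelian: "finite A \<Longrightarrow> v \<in> mcarrier V \<Longrightarrow> mact V (0, \<Sum>a\<in>A. f a) v = (\<Sum>a\<in>A. mact V (0, f a) v)"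
proof (induction A rule: finite_induct)
  case empty then show ?case using phi_0 by simp
next
  case (insert a A)
  then show ?case using lie_moduleD(4)[OF V, of "(0, f a)" "(0, \<Sum>a\<in>A. f a)" v]
    by (simp add: sp_a_simps sp_closed)
qed

lemma phi_rank1_expand:
  fixes r :: "'m lattice"
  defines "n \<equiv> \<lambda>a. of_int (r $ a) :: complex" and "sc \<equiv> mscale V"
  assumes v: "v \<in> mcarrier V"
  shows "\<phi> (rank1 r) v =
      (\<Sum>i\<in>UNIV. sc (n (Inr i) ^ 2) (\<phi> (E (Inr i) (Inl i)) v)
        + sc (n (Inl i) * n (Inr i)) (\<phi> (E (Inl i) (Inl i) - E (Inr i) (Inr i)) v)
        - sc (n (Inl i) ^ 2) (\<phi> (E (Inl i) (Inr i)) v))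
    + (\<Sum>i\<in>UNIV. \<Sum>j\<in>{j. i < j}.
          sc (n (Inr i) * n (Inr j)) (\<phi> (E (Inr j) (Inl i) + E (Inr i) (Inl j)) v)
        + sc (n (Inl i) * n (Inr j)) (\<phi> (E (Inl i) (Inl j) - E (Inr j) (Inr i)) v)
        + sc (n (Inl j) * n (Inr i)) (\<phi> (E (Inl j) (Inl i) - E (Inr i) (Inr j)) v)
        - sc (n (Inl i) * n (Inl j)) (\<phi> (E (Inl i) (Inr j) + E (Inl j) (Inr i)) v))"
proof -
  have s: "E (Inr j) (Inl i) + E (Inr i) (Inl j) \<in> lie_carrier sp" for i j :: 'm
    using sp_generators_in_sp(3)[of j i] .
  note g = s sp_generators_in_sp
  show ?thesis
    unfolding rank1_expand n_def sc_def
    by (simp only: phi_add phi_diff phi_sum phi_scale sp_closed g v)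
qed

text \<open>The operator t^(-r) h(r) on the copy of \<open>V\<close> at exponent 0 in A_N (x)
  V.\<close>

definition Dop :: "complex ^ 'm index \<Rightarrow> 'm lattice \<Rightarrow> 'v \<Rightarrow> 'v" where
  "Dop \<mu> r v = mscale V (ell \<mu> r) v + \<phi> (rank1 r) v"

lemma endo_Dop: "endo (Dop \<mu> r)"
proof -
  have "endo (mscale V (ell \<mu> r))" unfolding endo_on_def by (auto simp: scale_right_distrib mult.commute)
  then show ?thesis unfolding Dop_def using endo_act[OF rank1_in_sp] by (rule endo_add)
qed

lemma Dop_0: "v \<in> mcarrier V \<Longrightarrow> Dop \<mu> 0 v = 0"
  using ell_add[of \<mu> 0 0] by (simp add: Dop_def rank1_0 phi_0)

lemma Dop_rel:
  assumes v: "v \<in> mcarrier V"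
  shows "skew_rel (Dop \<mu>) r s v"
proof -
  note e = endoD[OF endo_act[OF rank1_in_sp]]
  have "\<phi> (rank1 r) (\<phi> (rank1 s) v) - \<phi> (rank1 s) (\<phi> (rank1 r) v) =
      mscale V (of_int (om r s)) (\<phi> (rank1 (r + s)) v - \<phi> (rank1 r) v - \<phi> (rank1 s) v)"
    unfolding phi_bracket[OF rank1_in_sp rank1_in_sp v, symmetric] rank1_bracket
    by (simp add: phi_scale phi_diff rank1_in_sp sp_closed v)
  then show ?thesis
    using v by (simp add: skew_rel_def Dop_def e ell_add algebra_simps)
qed

text \<open>As \<open>rank1\<close> is even and \<open>ell\<close> is odd in \<open>r\<close>, both
  can be recovered from \<open>Dop\<close>.\<close>

lemma Dop_even: "v \<in> mcarrier V \<Longrightarrow> Dop \<mu> r v + Dop \<mu> (- r) v = mscale V 2 (\<phi> (rank1 r) v)"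
  using scale_left_distrib[of 1 1 "\<phi> (rank1 r) v"] by (simp add: Dop_def ell_minus rank1_minus)

lemma Dop_odd: "v \<in> mcarrier V \<Longrightarrow> Dop \<mu> r v - Dop \<mu> (- r) v = mscale V (2 * ell \<mu> r) v"
  unfolding Dop_def ell_minus rank1_minus mult_2 scale_left_distrib by simp

text \<open>Removing the scalar \<open>ell \<mu> r\<close> leaves the action of
  \<open>rank1 r\<close>, and these matrices span sp_N.\<close>

lemma Dop_stable_imp_sp_stable:
  assumes W: "subspace W" "W \<subseteq> mcarrier V" and st: "\<And>r w. w \<in> W \<Longrightarrow> Dop \<mu> r w \<in> W"
    and M: "M \<in> lie_carrier sp" and w: "w \<in> W"
  shows "\<phi> M w \<in> W"
proof -
  have wV: "w \<in> mcarrier V" using W w by blast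
  have gen: "\<phi> (rank1 r) w \<in> W" for r
  proof -
    have "Dop \<mu> r w - mscale V (ell \<mu> r) w \<in> W" using st w W(1) by (intro subspace_diff subspace_scale)
    then show ?thesis by (simp add: Dop_def)
  qed
  have "M \<in> mat.span (range rank1)" using M by (simp add: sp_carrier_rank1)
  then have "M \<in> lie_carrier sp \<and> \<phi> M w \<in> W"
  proof (induction rule: mat.span_induct_alt)
    case base then show ?case using W(1) wV by (simp add: phi_0 sp_closed subspace_0)
  next
    case (step c x y)
    then obtain r where x: "x = rank1 r" by blast
    show ?case unfolding x using step(2) wV gen W(1)
      by (simp add: phi_add phi_scale rank1_in_sp sp_closed subspace_add subspace_scale)
  qed
  then show ?thesis ..
qed

lemma act_abelian:
  assumes "acts_by_scalars V \<mu>" "v \<in> mcarrier V"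
  shows "mact V (0, x) v = mscale V (\<Sum>a\<in>UNIV. x $ a * \<mu> $ a) v"
proof -
  have x: "(\<Sum>a\<in>UNIV. x $ a *s C a) = x"
    by (simp add: vec_eq_iff C_def axis_def if_distrib[of "\<lambda>x. _ * x"] cong: if_cong)
  have "mact V (0, \<Sum>a\<in>UNIV. x $ a *s C a) v = (\<Sum>a\<in>UNIV. mact V (0, x $ a *s C a) v)"
    by (rule act_sum_abelian[OF finite assms(2)])
  also have "\<dots> = (\<Sum>a\<in>UNIV. mscale V (x $ a * \<mu> $ a) v)"
  proof (rule sum.cong[OF refl])
    fix a
    have "mact V (0, x $ a *s C a) v = mact V (lie_scale sp_a (x $ a) (0, C a)) v"
      by (simp add: sp_a_simps) 
    also have "\<dots> = mscale V (x $ a) (mact V (0, C a) v)"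
      using assms(2) by (intro lie_moduleD(5)[OF V]) (simp_all add: sp_a_simps sp_closed)
    also have "\<dots> = mscale V (x $ a * \<mu> $ a) v" using assms by (simp add: acts_by_scalars_def)
    finally show "mact V (0, x $ a *s C a) v = mscale V (x $ a * \<mu> $ a) v" .
  qed
  finally show ?thesis unfolding x by (simp add: scale_sum_left)
qed

end

locale irreducible_sp_a_module = sp_a_module V B
  for V :: "('m::{finite,linorder} spa, 'v::ab_group_add) lie_mod" and B +
  assumes irr: "irreducible_lie_module sp_a V"
begin

lemma nonzero: "mcarrier V \<noteq> {0}"
  using irr by (simp add: irreducible_lie_module_def)

lemma irr_subspace:
  "subspace W \<Longrightarrow> W \<subseteq> mcarrier V \<Longrightarrow> (\<And>x w. x \<in> lie_carrier sp_a \<Longrightarrow> w \<in> W \<Longrightarrow> mact V x w \<in> W) \<Longrightarrow>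
    W = {0} \<or> W = mcarrier V"
  using irr unfolding irreducible_lie_module_def by blast

text \<open>Each (0, C a) is central, so Schur's lemma applies to its action.\<close>

lemma scalars_exist: "\<exists>\<mu>. acts_by_scalars V \<mu>"
proof -
  have "\<exists>z. \<forall>v\<in>mcarrier V. mact V (0, C a) v = mscale V z v" for a
  proof -
    obtain z where "\<And>v. v \<in> mcarrier V \<Longrightarrow> mact V (0, C a) v = mscale V z v"
    proof (rule schur_scalar[OF endo_act[OF sp_closed(1)] nonzero, of "lie_carrier sp_a" "mact V"])
      show "W = {0} \<or> W = mcarrier V" if "subspace W" "W \<subseteq> mcarrier V"
        "\<And>x w. x \<in> lie_carrier sp_a \<Longrightarrow> w \<in> W \<Longrightarrow> mact V x w \<in> W" for W
        using that irr_subspace by blast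
      show "endo (mact V x)" if "x \<in> lie_carrier sp_a" for x :: "'m spa" using lie_moduleD(3)[OF V that] .
      show "mact V (0, C a) (mact V x u) = mact V x (mact V (0, C a) u)"
        if x: "x \<in> lie_carrier sp_a" and u: "u \<in> mcarrier V" for x :: "'m spa" and u
      proof -
        obtain M y where xy: "x = (M, y)" by (cases x)
        have "mact V (lie_bracket sp_a (0, C a) x) u = 0"
          by (simp add: xy sp_a_simps matrix_matrix_mult_def phi_0[OF u] flip: zero_vec_def)
        then show ?thesis
          using lie_moduleD(6)[OF V, of "(0, C a)" x u] x u by (simp add: sp_a_simps sp_closed)
      qed
    qed blast
    then show ?thesis by blast
  qed
  then obtain z where "\<And>a v. v \<in> mcarrier V \<Longrightarrow> mact V (0, C a) v = mscale V (z a) v" by metis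
  then have "acts_by_scalars V (\<chi> a. z a)" by (simp add: acts_by_scalars_def)
  then show ?thesis by blast
qed

lemma scalars_unique:
  assumes "acts_by_scalars V \<mu>" "acts_by_scalars V \<nu>"
  shows "\<mu> = \<nu>"
proof -
  obtain v where v: "v \<in> mcarrier V" "v \<noteq> 0" using nonzero U_closed(1) by blast
  have "mscale V (\<mu> $ a) v = mscale V (\<nu> $ a) v" for a
    using assms v(1) unfolding acts_by_scalars_def by metis
  then show ?thesis using v(2) by (simp add: vec_eq_iff)
qed

text \<open>As a_N acts by scalars, a subspace stable under sp_N is stable under the whole
  algebra.\<close>

lemma irr_phi:
  assumes W: "subspace W" "W \<subseteq> mcarrier V" "\<And>M w. M \<in> lie_carrier sp \<Longrightarrow> w \<in> W \<Longrightarrow> \<phi> M w \<in> W"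
  shows "W = {0} \<or> W = mcarrier V"
proof (rule irr_subspace[OF W(1,2)])
  obtain \<mu> where \<mu>: "acts_by_scalars V \<mu>" using scalars_exist by blast
  fix x :: "'m spa" and w assume x: "x \<in> lie_carrier sp_a" and w: "w \<in> W"
  obtain M y where xy: "x = (M, y)" by (cases x)
  have wV: "w \<in> mcarrier V" using W w by blast
  have M: "M \<in> lie_carrier sp" using x xy by (simp add: sp_a_simps)
  have "mact V x w = \<phi> M w + mscale V (\<Sum>a\<in>UNIV. y $ a * \<mu> $ a) w"
    unfolding xy by (subst act_split[OF M wV]) (simp add: act_abelian[OF \<mu> wV])
  then show "mact V x w \<in> W"
    using W(3)[OF M w] w subspace_add[OF W(1)] subspace_scale[OF W(1)] by simp
qed

lemma irr_Dop:
  "subspace W \<Longrightarrow> W \<subseteq> mcarrier V \<Longrightarrow> (\<And>r w. w \<in> W \<Longrightarrow> Dop \<mu> r w \<in> W) \<Longrightarrow> W = {0} \<or> W = mcarrier V"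
  using irr_phi[of W] Dop_stable_imp_sp_stable by blast

lemma irreducible_restrict: "irreducible_lie_module sp (restrict_sp V)"
  unfolding irreducible_lie_module_def
proof (intro conjI allI impI)
  have [simp]: "mcarrier (restrict_sp V) = mcarrier V" "mscale (restrict_sp V) = mscale V"
    "mact (restrict_sp V) M = \<phi> M" for M by (simp_all add: restrict_sp_def)
  show "lie_module sp (restrict_sp V)"
    by (rule lie_moduleI)
      (simp_all add: sp_simps endo_act phi_add phi_scale phi_bracket subspace_U vector_space_axioms)
  show "mcarrier (restrict_sp V) \<noteq> {0}" using nonzero by simp
  show "W = {0} \<or> W = mcarrier (restrict_sp V)"
    if "W \<subseteq> mcarrier (restrict_sp V) \<and> module.subspace (mscale (restrict_sp V)) W \<and>
      (\<forall>M\<in>lie_carrier sp. \<forall>w\<in>W. mact (restrict_sp V) M w \<in> W)" for W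
    using that irr_phi[of W] by simp
qed

end

section \<open>The Hamiltonian vector fields on Laurent polynomials\<close>

abbreviation "lookup \<equiv> Poly_Mapping.lookup"
abbreviation "single \<equiv> Poly_Mapping.single"

lemma poly_mapping_additive_induct:
  fixes f :: "'a \<Rightarrow>\<^sub>0 'b::comm_monoid_add"
  assumes "\<And>s v. P (single s v)" "\<And>f g. P f \<Longrightarrow> P g \<Longrightarrow> P (f + g)"
  shows "P f"
proof -
  have "P (\<Sum>s\<in>S. single s (lookup f s))" if "finite S" for S
    using that
  proof (induction S rule: finite_induct)
    case empty
    show ?case using assms(1)[of _ 0] by simp
  qed (simp add: assms)
  from this[OF finite_keys[of f]] show ?thesis by (simp add: sum_single_lookup)
qed

lemma lookup_single_mult: "lookup (single r c * f) s = c * lookup f (s - r)"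
  for f :: "'m::finite laurent"
proof (induction f rule: poly_mapping_additive_induct)
  case (1 u v)
  have "r + u = s \<longleftrightarrow> u = s - r" by (auto simp: algebra_simps)
  then show ?case by (simp add: mult_single lookup_single when_def)
qed (simp add: distrib_left lookup_add)

lemma lookup_const_mult: "lookup (const c * f) s = c * lookup f s"
  by (simp add: const_def lookup_single_mult)

lemma lookup_mult_const: "lookup (f * const c) s = c * lookup f s" for f :: "'m::finite laurent"
  by (simp add: mult.commute[of f] lookup_const_mult)

lemmas lookup_ops = lookup_const_mult lookup_mult_const lookup_add lookup_minus

lemma lookup_d: "lookup (d a f) s = of_int (s $ a) * lookup f s"
  by (simp add: d_def lookup_mapp when_def in_keys_iff)

lemma lookup_h: "lookup (h r f) s = of_int (om r s) * lookup f (s - r)"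
proof -
  have "lookup (h r f) s = (\<Sum>i\<in>UNIV.
      (of_int (r $ Inr i) * of_int ((s - r) $ Inl i) - of_int (r $ Inl i) * of_int ((s - r) $ Inr i)) * lookup f (s - r))"
    unfolding h_def lookup_sum
    by (intro sum.cong refl)
      (simp add: lookup_minus mult.assoc lookup_const_mult tpow_def lookup_single_mult lookup_d left_diff_distrib)
  also have "\<dots> = of_int (om r (s - r)) * lookup f (s - r)"
    by (simp add: om_def sum_distrib_right)
  finally show ?thesis by (simp add: om_linear)
qed

definition hscale :: "complex \<Rightarrow> ('m::finite laurent \<Rightarrow> 'm laurent) \<Rightarrow> 'm laurent \<Rightarrow> 'm laurent" where
  "hscale c X f = const c * X f"

lemma vector_space_hscale: "vector_space hscale"
  by unfold_locales (auto simp: hscale_def fun_eq_iff lookup_ops distrib_left distrib_right mult.assoc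
      intro!: poly_mapping_eqI)

interpretation ham: vector_space hscale
  by (rule vector_space_hscale)

lemma ham_simps:
  "lie_carrier ham = ham.span (range d \<union> range h)" "lie_scale ham = hscale"
  "lie_bracket ham X Y = (\<lambda>f. X (Y f) - Y (X f))"
  by (simp_all add: ham_def hscale_def[abs_def])

lemma ham_closed:
  "d a \<in> lie_carrier ham" "h r \<in> lie_carrier ham" "0 \<in> lie_carrier ham"
  "X \<in> lie_carrier ham \<Longrightarrow> Y \<in> lie_carrier ham \<Longrightarrow> X + Y \<in> lie_carrier ham"
  "X \<in> lie_carrier ham \<Longrightarrow> hscale c X \<in> lie_carrier ham"
  unfolding ham_simps by (auto intro: ham.span_base ham.span_zero ham.span_add ham.span_scale)

lemma ham_induct [consumes 1, case_names d h add scale]: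
  assumes "X \<in> lie_carrier ham" "\<And>a. Q (d a)" "\<And>r. Q (h r)"
    "\<And>X Y. X \<in> lie_carrier ham \<Longrightarrow> Y \<in> lie_carrier ham \<Longrightarrow> Q X \<Longrightarrow> Q Y \<Longrightarrow> Q (X + Y)"
    "\<And>c X. X \<in> lie_carrier ham \<Longrightarrow> Q X \<Longrightarrow> Q (hscale c X)"
  shows "Q X"
proof -
  have "X \<in> ham.span (range d \<union> range h)" using assms(1) by (simp add: ham_simps)
  then have "X \<in> lie_carrier ham \<and> Q X"
  proof (induction rule: ham.span_induct_alt)
    case base
    have "Q (hscale 0 (d undefined))" using assms(2,5) ham_closed(1) by blast
    then have "Q 0" by (simp only: ham.scale_zero_left)
    then show ?case using ham_closed(3) by blast
  next
    case (step c x y)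
    have x: "x \<in> lie_carrier ham" "Q x" using step(1) assms(2,3) ham_closed(1,2) by blast+
    have y: "y \<in> lie_carrier ham" "Q y" using step(2) by blast+
    have cx: "hscale c x \<in> lie_carrier ham" by (rule ham_closed(5)[OF x(1)])
    show ?case
      by (rule conjI[OF ham_closed(4)[OF cx y(1)] assms(4)[OF cx y(1) assms(5)[OF x] y(2)]])
  qed
  then show ?thesis ..
qed

lemma ham_linear:
  assumes "X \<in> lie_carrier ham"
  shows "X (f + g) = X f + X g" "X (const c * f) = const c * X f" "X (f - g) = X f - X g"
proof -
  have *: "(\<forall>f g. X (f + g) = X f + X g) \<and> (\<forall>c f. X (const c * f) = const c * X f)"
    using assms
  proof (induction rule: ham_induct)
    case (d a)
    then show ?case by (auto intro!: poly_mapping_eqI simp: lookup_d lookup_ops distrib_left mult.left_commute)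
  next
    case (h r)
    then show ?case by (auto intro!: poly_mapping_eqI simp: lookup_h lookup_ops distrib_left mult.left_commute)
  next
    case (add X Y)
    then show ?case by (simp add: algebra_simps)
  next
    case (scale c X)
    then show ?case by (simp add: hscale_def algebra_simps)
  qed
  then show add: "X (f + g) = X f + X g" and "X (const c * f) = const c * X f" for f g by auto
  show "X (f - g) = X f - X g" using add[of "f - g" g] by (simp add: algebra_simps)
qed

lemma ham_brackets:
  "lie_bracket ham (d a) (d b) = hscale 0 (d a)"
  "lie_bracket ham (d a) (h r) = hscale (of_int (r $ a)) (h r)"
  "lie_bracket ham (h r) (d a) = hscale (- of_int (r $ a)) (h r)"
  "lie_bracket ham (h r) (h s) = hscale (of_int (om r s)) (h (r + s))"
proof -
  show "lie_bracket ham (d a) (d b) = hscale 0 (d a)"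
    "lie_bracket ham (d a) (h r) = hscale (of_int (r $ a)) (h r)"
    "lie_bracket ham (h r) (d a) = hscale (- of_int (r $ a)) (h r)"
    unfolding ham_simps hscale_def fun_eq_iff
    by (auto intro!: poly_mapping_eqI simp: lookup_ops lookup_d lookup_h)
      (simp_all add: algebra_simps)
  have "of_int (om r q) * of_int (om s (q - r)) - of_int (om s q) * of_int (om r (q - s)) =
      (of_int (om r s) * of_int (om (r + s) q) :: complex)" for q
    using om_commute[of s r] by (simp add: om_linear algebra_simps)
  then show "lie_bracket ham (h r) (h s) = hscale (of_int (om r s)) (h (r + s))"
    unfolding ham_simps hscale_def fun_eq_iff
    by (auto intro!: poly_mapping_eqI simp: lookup_minus lookup_h lookup_const_mult diff_diff_eq
        add.commute[of s r] mult.assoc[symmetric] simp flip: left_diff_distrib)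
qed

text \<open>The coordinates of a Hamiltonian vector field with respect to the basis \<open>d a\<close>, \<open>h r\<close> (\<open>r \<noteq> 0\<close>).\<close>

definition rot :: "'m::finite lattice \<Rightarrow> 'm lattice" where
  "rot r = (\<chi> b. - index_sign b * r $ swap_index b)"

definition d_coeff :: "'m::finite index \<Rightarrow> ('m laurent \<Rightarrow> 'm laurent) \<Rightarrow> complex" where
  "d_coeff a X = lookup (X (tpow (unit_vec a))) (unit_vec a)"

definition h_coeff :: "'m::finite lattice \<Rightarrow> ('m laurent \<Rightarrow> 'm laurent) \<Rightarrow> complex" where
  "h_coeff r X = lookup (X (tpow (rot r))) (r + rot r) / of_int (om r (rot r))"

text \<open>The value is the sum of the squares of the entries of \<open>r\<close>. So
  \<open>tpow (rot r)\<close> is a monomial that \<open>h r\<close> does not annihilate when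
  \<open>r\<close> is nonzero.\<close>

lemma om_rot: "om r (rot r) = 0 \<longleftrightarrow> r = 0"
proof -
  have "om r (rot r) = (\<Sum>c\<in>UNIV. (r $ swap_index c)\<^sup>2)"
    unfolding om_eq_sum rot_def
    by (rule sum.cong[OF refl], rename_tac c, case_tac c) (simp_all add: power2_eq_square)
  moreover have "(\<Sum>c\<in>UNIV. (r $ swap_index c)\<^sup>2) = 0 \<longleftrightarrow> (\<forall>c. r $ swap_index c = 0)"
    by (simp add: sum_nonneg_eq_0_iff)
  moreover have "(\<forall>c. r $ swap_index c = 0) \<longleftrightarrow> r = 0"
    by (auto simp: vec_eq_iff) (metis swap_swap_index)
  ultimately show ?thesis by simp
qed

lemma coeff_linear:
  "d_coeff a (X + Y) = d_coeff a X + d_coeff a Y" "d_coeff a (hscale c X) = c * d_coeff a X"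
  "h_coeff r (X + Y) = h_coeff r X + h_coeff r Y" "h_coeff r (hscale c X) = c * h_coeff r X"
  by (simp_all add: d_coeff_def h_coeff_def hscale_def lookup_add lookup_const_mult add_divide_distrib)

lemma lookup_tpow: "lookup (tpow r) s = (if r = s then 1 else 0)"
  by (simp add: tpow_def lookup_single when_def)

text \<open>\<open>d b\<close> preserves exponents while \<open>h r\<close> shifts them by
  \<open>r\<close>, so a single coefficient tells them apart. For q = 0 the division by zero in
  \<open>h_coeff\<close> returns 0, in accordance with h(0) = 0.\<close>

lemma coeff_basis:
  "d_coeff a (d b) = (if a = b then 1 else 0)" "d_coeff a (h r) = 0"
  "h_coeff q (d b) = 0" "h_coeff q (h r) = (if q = r \<and> r \<noteq> 0 then 1 else 0)"
proof -
  show "d_coeff a (d b) = (if a = b then 1 else 0)"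
    by (simp add: d_coeff_def lookup_d lookup_tpow unit_vec_nth)
  show "d_coeff a (h r) = 0"
    by (auto simp: d_coeff_def lookup_h lookup_tpow algebra_simps om_linear)
  show "h_coeff q (d b) = 0"
    using om_rot[of q] by (auto simp: h_coeff_def lookup_d lookup_tpow)
  show "h_coeff q (h r) = (if q = r \<and> r \<noteq> 0 then 1 else 0)"
    using om_rot[of q] by (auto simp: h_coeff_def lookup_h lookup_tpow om_linear algebra_simps)
qed

lemma finite_h_coeff: "X \<in> lie_carrier ham \<Longrightarrow> finite {r. h_coeff r X \<noteq> 0}"
proof (induction rule: ham_induct)
  case (h r)
  show ?case by (rule finite_subset[of _ "{r}"]) (auto simp: coeff_basis)
next
  case (add X Y)
  have "{r. h_coeff r (X + Y) \<noteq> 0} \<subseteq> {r. h_coeff r X \<noteq> 0} \<union> {r. h_coeff r Y \<noteq> 0}"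
    unfolding coeff_linear by auto
  then show ?case using add(3,4) finite_subset by blast
next
  case (scale c X)
  have "{r. h_coeff r (hscale c X) \<noteq> 0} \<subseteq> {r. h_coeff r X \<noteq> 0}" unfolding coeff_linear by auto
  then show ?case using scale(2) finite_subset by blast
qed (simp add: coeff_basis)


section \<open>Tensor modules\<close>

lemma tensor_carrier_single: "0 \<in> U \<Longrightarrow> v \<in> U \<Longrightarrow> single s v \<in> tensor_carrier U"
  by (simp add: tensor_carrier_def lookup_single when_def)

lemma tensor_carrierD: "g \<in> tensor_carrier U \<Longrightarrow> lookup g s \<in> U"
  by (simp add: tensor_carrier_def)

text \<open>The shape common to the modules of the theorem, where \<open>D\<close> is
  \<open>Dop\<close>, and to the modules in the category, where \<open>D\<close> acts on a weight
  space. The action is described coefficientwise for all elements, not only for pure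
  tensors.\<close>

definition tensor_like ::
  "complex ^ 'm::finite index \<Rightarrow> (complex \<Rightarrow> 'v::ab_group_add \<Rightarrow> 'v) \<Rightarrow> 'v set \<Rightarrow>
    ('m lattice \<Rightarrow> 'v \<Rightarrow> 'v) \<Rightarrow> ('m, 'm lattice \<Rightarrow>\<^sub>0 'v) ah_mod \<Rightarrow> bool" where
  "tensor_like lam sc U D J \<longleftrightarrow>
     lie_module ham J \<and> mcarrier J = tensor_carrier U \<and> ascale J = tensor_ascale sc \<and>
     mscale J = (\<lambda>c. tensor_ascale sc (const c)) \<and>
     (\<forall>a s. \<forall>g\<in>tensor_carrier U. lookup (mact J (d a) g) s = sc (of_int (s $ a) + lam $ a) (lookup g s)) \<and>
     (\<forall>r s. \<forall>g\<in>tensor_carrier U. lookup (mact J (h r) g) s =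
        sc (of_int (om r s)) (lookup g (s - r)) + D r (lookup g (s - r)))"

context complex_space
begin

lemma lookup_tensor_tpow: "tensor sc (tpow s) v = single s v"
  by (rule poly_mapping_eqI)
    (simp add: lookup_tensor[OF vector_space_axioms] lookup_tpow lookup_single when_def)

lemma lookup_tensor_ascale:
  assumes "finite K" "Poly_Mapping.keys g \<subseteq> K"
  shows "lookup (tensor_ascale sc f g) s = (\<Sum>u\<in>K. sc (lookup f (s - u)) (lookup g u))"
proof -
  have "lookup (tensor_ascale sc f g) s = (\<Sum>u\<in>Poly_Mapping.keys g. sc (lookup f (s - u)) (lookup g u))"
    unfolding tensor_ascale_def lookup_sum lookup_tensor[OF vector_space_axioms]
    by (simp add: mult.commute[of f] tpow_def lookup_single_mult)
  also have "\<dots> = (\<Sum>u\<in>K. sc (lookup f (s - u)) (lookup g u))"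
    using assms by (intro sum.mono_neutral_left) (auto simp: in_keys_iff)
  finally show ?thesis .
qed

lemma lookup_tensor_ascale_single:
  "lookup (tensor_ascale sc f (single u v)) s = sc (lookup f (s - u)) v"
  by (subst lookup_tensor_ascale[of "{u}"]) (auto simp: lookup_single)

lemma lookup_mscale: "lookup (tensor_ascale sc (const c) g) s = sc c (lookup g s)"
  by (rule tensor_ascale_const[OF vector_space_axioms])

lemma tensor_ascale_add_left: "tensor_ascale sc (f + f') g = tensor_ascale sc f g + tensor_ascale sc f' g"
  by (rule poly_mapping_eqI)
    (simp add: lookup_tensor_ascale[OF finite_keys order_refl] lookup_add scale_left_distrib sum.distrib)

lemma tensor_ascale_add_right: "tensor_ascale sc f (g + g') = tensor_ascale sc f g + tensor_ascale sc f g'"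
proof (rule poly_mapping_eqI)
  fix s
  let ?K = "Poly_Mapping.keys g \<union> Poly_Mapping.keys g'"
  have K: "finite ?K" "Poly_Mapping.keys g \<subseteq> ?K" "Poly_Mapping.keys g' \<subseteq> ?K"
    "Poly_Mapping.keys (g + g') \<subseteq> ?K"
    using Poly_Mapping.keys_add[of g g'] by auto
  show "lookup (tensor_ascale sc f (g + g')) s = lookup (tensor_ascale sc f g + tensor_ascale sc f g') s"
    by (simp add: lookup_add lookup_tensor_ascale[OF K(1,2)] lookup_tensor_ascale[OF K(1,3)]
        lookup_tensor_ascale[OF K(1,4)] scale_right_distrib sum.distrib)
qed

lemma tensor_ascale_single_single: "tensor_ascale sc (single p c) (single u v) = single (p + u) (sc c v)"
  by (rule poly_mapping_eqI)
    (auto simp: lookup_tensor_ascale_single lookup_single when_def algebra_simps)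

lemma tensor_ascale_mult: "tensor_ascale sc (f * f') g = tensor_ascale sc f (tensor_ascale sc f' g)"
proof (induction g rule: poly_mapping_additive_induct)
  case (1 u v)
  show ?case
  proof (induction f' rule: poly_mapping_additive_induct)
    case (1 p c)
    have "lookup (f * single p c) (s - u) = lookup f (s - (p + u)) * c" for s
    proof -
      have "s - u - p = s - (p + u)" by (simp add: algebra_simps)
      then show ?thesis by (simp only: mult.commute[of f] lookup_single_mult mult.commute[of c])
    qed
    then show ?case
      by (intro poly_mapping_eqI)
        (simp only: tensor_ascale_single_single lookup_tensor_ascale_single scale_scale)
  qed (simp add: distrib_left tensor_ascale_add_left tensor_ascale_add_right)
qed (simp add: tensor_ascale_add_right)

lemma tensor_ascale_one: "tensor_ascale sc 1 g = g"
proof -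
  have "const 1 = 1" by (simp add: const_def)
  then show ?thesis using lookup_mscale[of 1] by (metis poly_mapping_eqI scale_one)
qed

lemma module_tensor_ascale: "module (tensor_ascale sc :: 'm::finite laurent \<Rightarrow> _)"
  by unfold_locales
    (simp_all add: tensor_ascale_add_left tensor_ascale_add_right tensor_ascale_mult tensor_ascale_one)

lemma vector_space_tensor: "vector_space (\<lambda>c. tensor_ascale sc (const c :: 'm::finite laurent))"
  by unfold_locales (auto intro!: poly_mapping_eqI simp: lookup_mscale lookup_add algebra_simps)

end

context fd_space
begin

lemma tensor_carrier_add: "f \<in> tensor_carrier U \<Longrightarrow> g \<in> tensor_carrier U \<Longrightarrow> f + g \<in> tensor_carrier U"
  by (simp add: tensor_carrier_def lookup_add)

lemma tensor_carrier_induct [consumes 1, case_names single add]: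
  assumes g: "g \<in> tensor_carrier U" and "\<And>s v. v \<in> U \<Longrightarrow> P (single s v)"
    "\<And>f g. f \<in> tensor_carrier U \<Longrightarrow> g \<in> tensor_carrier U \<Longrightarrow> P f \<Longrightarrow> P g \<Longrightarrow> P (f + g)"
  shows "P g"
proof -
  have "(\<Sum>s\<in>S. single s (lookup g s)) \<in> tensor_carrier U \<and> P (\<Sum>s\<in>S. single s (lookup g s))"
    if "finite S" for S
    using that
  proof (induction S rule: finite_induct)
    case empty
    have "P (single 0 0)" using assms(2) U_closed(1) by blast
    then show ?case by (simp add: tensor_carrier_def)
  next
    case (insert x S)
    have x: "single x (lookup g x) \<in> tensor_carrier U" using g by (simp add: tensor_carrier_single tensor_carrierD)
    have Px: "P (single x (lookup g x))" using assms(2) g by (simp add: tensor_carrierD)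
    have IH: "(\<Sum>s\<in>S. single s (lookup g s)) \<in> tensor_carrier U" "P (\<Sum>s\<in>S. single s (lookup g s))"
      using insert.IH by blast+
    show ?case
      unfolding sum.insert[OF insert.hyps]
      by (rule conjI[OF tensor_carrier_add[OF x IH(1)] assms(3)[OF x IH(1) Px IH(2)]])
  qed
  from this[OF finite_keys[of g]] show ?thesis by (simp add: sum_single_lookup)
qed

lemma tensor_carrier_subspace:
  "module.subspace (\<lambda>c. tensor_ascale sc (const c :: 'm::finite laurent)) (tensor_carrier U)"
proof -
  interpret T: vector_space "\<lambda>c. tensor_ascale sc (const c :: 'm laurent)" by (rule vector_space_tensor)
  show ?thesis unfolding T.subspace_def by (auto simp: tensor_carrier_def lookup_mscale lookup_add)
qed

lemma tensor_ascale_in_carrier: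
  "g \<in> tensor_carrier U \<Longrightarrow> tensor_ascale sc f g \<in> tensor_carrier U" for f :: "'m::finite laurent"
  unfolding tensor_carrier_def mem_Collect_eq lookup_tensor_ascale[OF finite_keys order_refl]
  by (auto intro!: U_sum)

lemma tensor_ascale_subspace:
  "module.subspace (tensor_ascale sc) (tensor_carrier U :: ('m::finite lattice \<Rightarrow>\<^sub>0 'v) set)"
  unfolding module.subspace_def[OF module_tensor_ascale]
  using tensor_ascale_in_carrier by (auto simp: tensor_carrier_def lookup_add)

end

section \<open>Existence of the module for given operators \<open>D\<close>\<close>

context lattice_rep
begin

text \<open>The action is prescribed through the coordinates of \<open>X\<close>, which makes
  linearity in \<open>X\<close> automatic. Here \<open>u\<close> is the exponent acted upon and s -
  u the exponent of the field; \<open>om s u\<close> is the same as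
  \<open>om (s - u) s\<close>.\<close>

definition tensor_act ::
  "complex ^ 'm index \<Rightarrow> ('m laurent \<Rightarrow> 'm laurent) \<Rightarrow> ('m lattice \<Rightarrow>\<^sub>0 'v) \<Rightarrow> 'm lattice \<Rightarrow> 'v" where
  "tensor_act lam X g s =
     (\<Sum>a\<in>UNIV. sc (d_coeff a X * (of_int (s $ a) + lam $ a)) (lookup g s)) +
     (\<Sum>u\<in>Poly_Mapping.keys g. sc (h_coeff (s - u) X) (sc (of_int (om s u)) (lookup g u) + D (s - u) (lookup g u)))"

lemma tensor_act_superset:
  assumes "finite K" "Poly_Mapping.keys g \<subseteq> K"
  shows "tensor_act lam X g s =
     (\<Sum>a\<in>UNIV. sc (d_coeff a X * (of_int (s $ a) + lam $ a)) (lookup g s)) +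
     (\<Sum>u\<in>K. sc (h_coeff (s - u) X) (sc (of_int (om s u)) (lookup g u) + D (s - u) (lookup g u)))"
proof -
  have "(\<Sum>u\<in>Poly_Mapping.keys g. sc (h_coeff (s - u) X) (sc (of_int (om s u)) (lookup g u) + D (s - u) (lookup g u))) =
    (\<Sum>u\<in>K. sc (h_coeff (s - u) X) (sc (of_int (om s u)) (lookup g u) + D (s - u) (lookup g u)))"
    using assms by (intro sum.mono_neutral_left) (auto simp: in_keys_iff endoD(4)[OF endo_D])
  then show ?thesis by (simp add: tensor_act_def)
qed

lemma tensor_act_add: "tensor_act lam (X + Y) g s = tensor_act lam X g s + tensor_act lam Y g s"
  by (simp add: tensor_act_def coeff_linear distrib_right scale_left_distrib sum.distrib algebra_simps)

lemma tensor_act_scale: "tensor_act lam (hscale c X) g s = sc c (tensor_act lam X g s)"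
  by (simp add: tensor_act_def coeff_linear scale_right_distrib scale_sum_right mult.assoc)

lemma tensor_act_d: "tensor_act lam (d a) g s = sc (of_int (s $ a) + lam $ a) (lookup g s)"
proof -
  have "(\<Sum>b\<in>UNIV. sc (d_coeff b (d a) * (of_int (s $ b) + lam $ b)) (lookup g s)) =
      (\<Sum>b\<in>UNIV. if b = a then sc (of_int (s $ b) + lam $ b) (lookup g s) else 0)"
    by (intro sum.cong) (auto simp: coeff_basis)
  then show ?thesis by (simp add: tensor_act_def coeff_basis)
qed

lemma tensor_act_h:
  assumes D0: "\<And>u. u \<in> U \<Longrightarrow> D 0 u = 0" and g: "g \<in> tensor_carrier U"
  shows "tensor_act lam (h r) g s = sc (of_int (om r s)) (lookup g (s - r)) + D r (lookup g (s - r))"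
proof -
  let ?K = "insert (s - r) (Poly_Mapping.keys g)"
  have "tensor_act lam (h r) g s =
     (\<Sum>u\<in>?K. sc (h_coeff (s - u) (h r)) (sc (of_int (om s u)) (lookup g u) + D (s - u) (lookup g u)))"
    by (subst tensor_act_superset[of ?K]) (auto simp: coeff_basis)
  also have "\<dots> = (\<Sum>u\<in>?K. if u = s - r then sc (of_int (om r s)) (lookup g (s - r)) + D r (lookup g (s - r)) else 0)"
  proof (rule sum.cong[OF refl])
    fix u
    have "om s (s - r) = om r s" using om_commute[of s r] by (simp add: om_linear)
    then show "sc (h_coeff (s - u) (h r)) (sc (of_int (om s u)) (lookup g u) + D (s - u) (lookup g u)) =
        (if u = s - r then sc (of_int (om r s)) (lookup g (s - r)) + D r (lookup g (s - r)) else 0)"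
      using D0[OF tensor_carrierD[OF g]] by (auto simp: coeff_basis om_linear)
  qed
  also have "\<dots> = sc (of_int (om r s)) (lookup g (s - r)) + D r (lookup g (s - r))"
    by simp
  finally show ?thesis .
qed

lemma tensor_act_U: "g \<in> tensor_carrier U \<Longrightarrow> tensor_act lam X g s \<in> U"
  unfolding tensor_act_def using endoD(1)[OF endo_D] by (auto intro!: U_sum simp: tensor_carrierD)

lemma tensor_act_finite:
  assumes "X \<in> lie_carrier ham"
  shows "finite {s. tensor_act lam X g s \<noteq> 0}"
proof (rule finite_subset)
  let ?S = "Poly_Mapping.keys g \<union> (\<lambda>(u, r). u + r) ` (Poly_Mapping.keys g \<times> {r. h_coeff r X \<noteq> 0})"
  show "finite ?S" using finite_h_coeff[OF assms] by simp
  show "{s. tensor_act lam X g s \<noteq> 0} \<subseteq> ?S"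
  proof (rule subsetI, rule ccontr)
    fix s assume s: "s \<in> {s. tensor_act lam X g s \<noteq> 0}" "s \<notin> ?S"
    have "lookup g s = 0" using s by (simp add: in_keys_iff)
    moreover have "h_coeff (s - u) X = 0" if "u \<in> Poly_Mapping.keys g" for u
    proof (rule ccontr)
      assume "h_coeff (s - u) X \<noteq> 0"
      then have "(u, s - u) \<in> Poly_Mapping.keys g \<times> {r. h_coeff r X \<noteq> 0}" using that by simp
      then have "s \<in> ?S" by (intro UnI2 image_eqI[of _ _ "(u, s - u)"]) auto
      then show False using s by blast
    qed
    ultimately have "tensor_act lam X g s = 0" by (simp add: tensor_act_def)
    then show False using s by simp
  qed
qed

text \<open>The bracket relation is checked on the generators, where it reduces to the relation for
  \<open>D\<close>, and then extended bilinearly.\<close>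

lemma tensor_like_exists:
  assumes D0: "\<And>u. u \<in> U \<Longrightarrow> D 0 u = 0"
  shows "\<exists>J. tensor_like lam sc U D J"
proof -
  define A where "A X g = Abs_poly_mapping (tensor_act lam X g)" for X g
  have lk: "lookup (A X g) s = tensor_act lam X g s" if "X \<in> lie_carrier ham" for X g s
    using tensor_act_finite[OF that] by (simp add: A_def)
  let ?T = "tensor_carrier U :: ('m lattice \<Rightarrow>\<^sub>0 'v) set"
  let ?ms = "\<lambda>c. tensor_ascale sc (const c :: 'm laurent) :: ('m lattice \<Rightarrow>\<^sub>0 'v) \<Rightarrow> _"
  define J :: "('m, 'm lattice \<Rightarrow>\<^sub>0 'v) ah_mod" where
    "J = \<lparr> mcarrier = ?T, mscale = ?ms, mact = A, ascale = tensor_ascale sc \<rparr>"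
  have AT: "A X g \<in> ?T" if "X \<in> lie_carrier ham" "g \<in> ?T" for X g
    using that by (simp add: tensor_carrier_def lk) (simp add: tensor_act_U tensor_carrier_def)
  have A_add: "A (X + Y) g = A X g + A Y g" if "X \<in> lie_carrier ham" "Y \<in> lie_carrier ham" for X Y g
    using that by (intro poly_mapping_eqI) (simp add: lk ham_closed lookup_add tensor_act_add)
  have A_scale: "A (hscale c X) g = ?ms c (A X g)" if "X \<in> lie_carrier ham" for c X g
    using that by (intro poly_mapping_eqI) (simp add: lk ham_closed lookup_mscale tensor_act_scale)
  have A_d: "lookup (A (d a) g) s = sc (of_int (s $ a) + lam $ a) (lookup g s)" for a g s
    by (simp add: lk ham_closed tensor_act_d)
  have A_h: "lookup (A (h r) g) s = sc (of_int (om r s)) (lookup g (s - r)) + D r (lookup g (s - r))"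
    if "g \<in> ?T" for r g s
    using tensor_act_h[OF D0 that] by (simp add: lk ham_closed)
  have endoA: "endo_on ?ms ?T (A X)" if X: "X \<in> lie_carrier ham" for X
    unfolding endo_on_def
  proof (intro conjI ballI allI)
    fix g g' assume g: "g \<in> ?T" "g' \<in> ?T"
    let ?K = "Poly_Mapping.keys g \<union> Poly_Mapping.keys g'"
    have K: "finite ?K" "Poly_Mapping.keys g \<subseteq> ?K" "Poly_Mapping.keys g' \<subseteq> ?K"
      "Poly_Mapping.keys (g + g') \<subseteq> ?K"
      using Poly_Mapping.keys_add[of g g'] by auto
    show "A X (g + g') = A X g + A X g'"
    proof (rule poly_mapping_eqI)
      fix s
      show "lookup (A X (g + g')) s = lookup (A X g + A X g') s"
        unfolding lookup_add lk[OF X] tensor_act_superset[OF K(1,2)] tensor_act_superset[OF K(1,3)]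
          tensor_act_superset[OF K(1,4)]
        by (simp add: endoD[OF endo_D] tensor_carrierD[OF g(1)] tensor_carrierD[OF g(2)]
          scale_right_distrib sum.distrib add.assoc add.left_commute)
    qed
  next
    fix c g assume g: "g \<in> ?T"
    have K: "Poly_Mapping.keys (?ms c g) \<subseteq> Poly_Mapping.keys g"
      by (auto simp: in_keys_iff lookup_mscale)
    show "A X (?ms c g) = ?ms c (A X g)"
    proof (rule poly_mapping_eqI)
      fix s
      show "lookup (A X (?ms c g)) s = lookup (?ms c (A X g)) s"
        unfolding lookup_mscale lk[OF X] tensor_act_superset[OF finite_keys K]
        by (simp add: tensor_act_def lookup_mscale endoD[OF endo_D] tensor_carrierD[OF g]
          scale_right_distrib scale_sum_right mult.commute mult.left_commute)
    qed
  qed (use AT[OF X] in blast)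
  interpret T: vector_space ?ms by (rule vector_space_tensor)
  have T_diff: "f - g \<in> ?T" if "f \<in> ?T" "g \<in> ?T" for f g
    using that by (simp add: tensor_carrier_def lookup_minus)
  have A_diff: "A X (f - g) = A X f - A X g" if X: "X \<in> lie_carrier ham" and fg: "f \<in> ?T" "g \<in> ?T" for X f g
  proof -
    have "A X (f - g + g) = A X (f - g) + A X g"
      using endoA[OF X] T_diff[OF fg] fg(2) unfolding endo_on_def by blast
    then show ?thesis by simp
  qed
  have bracket_gen: "lie_bracket ham X Y \<in> lie_carrier ham \<and>
      (\<forall>g\<in>?T. A (lie_bracket ham X Y) g = A X (A Y g) - A Y (A X g))"
    if XY: "X \<in> range d \<union> range h" "Y \<in> range d \<union> range h" for X Y
  proof -
    have hm: "A (d a) g \<in> ?T" "A (h r) g \<in> ?T" if "g \<in> ?T" for a r g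
      using AT that ham_closed(1,2) by blast+
    note e = endoD[OF endo_D]
    have D_r: "D r (D s u) = D s (D r u) + sc (of_int (om r s)) (D (r + s) u - D r u - D s u)"
      if "u \<in> U" for r s u
      using D_rel[OF that, of r s] by (simp add: skew_rel_def algebra_simps)
    have d_h_bracket: "lookup (A (d a) (A (h r) g)) q - lookup (A (h r) (A (d a) g)) q =
        sc (of_int (r $ a)) (lookup (A (h r) g) q)" if g: "g \<in> ?T" for a r g q
    proof -
      define x where "x = lookup g (q - r)"
      define y where "y = sc (of_int (om r q)) x + D r x"
      have x: "x \<in> U" using g by (simp add: x_def tensor_carrierD)
      have "sc (of_int (om r q)) (sc c x) + D r (sc c x) = sc c y" for c
        using x by (simp add: y_def e scale_right_distrib mult.commute)
      then have "lookup (A (d a) (A (h r) g)) q - lookup (A (h r) (A (d a) g)) q =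
          sc (of_int (q $ a) + lam $ a) y - sc (of_int ((q - r) $ a) + lam $ a) y"
        using g by (simp add: A_d A_h hm x_def[symmetric] y_def[symmetric])
      also have "\<dots> = sc (of_int (r $ a)) y" unfolding scale_left_diff_distrib[symmetric] by simp
      finally show ?thesis using g by (simp add: A_h y_def x_def)
    qed
    \<comment> \<open>For two fields h(r) and h(s): \<open>x\<close> is a coefficient of
      \<open>g\<close>; \<open>y\<close>, \<open>z\<close>, \<open>w\<close> are its images under
      \<open>D r\<close>, \<open>D s\<close>, \<open>D (r + s)\<close>; and \<open>p\<close> is
      \<open>D s (D r x)\<close>.\<close>
    have ident: "sc \<alpha> (sc (\<beta> + c) x + z) + (sc (\<beta> + c) y + (p + sc c (w - y - z))) -
        (sc \<beta> (sc (\<alpha> - c) x + y) + (sc (\<alpha> - c) z + p)) = sc c (sc (\<alpha> + \<beta>) x + w)"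
      for \<alpha> \<beta> c and x y z w p :: 'v
      by (simp add: algebra_simps)
    consider a b where "X = d a" "Y = d b" | a r where "X = d a" "Y = h r"
      | a r where "X = h r" "Y = d a" | r s where "X = h r" "Y = h s"
      using XY by blast
    then show ?thesis
    proof cases
      case 1
      have "A (lie_bracket ham X Y) g = A X (A Y g) - A Y (A X g)" for g
        unfolding 1 ham_brackets A_scale[OF ham_closed(1)]
        by (intro poly_mapping_eqI) (simp add: lookup_mscale lookup_minus A_d mult.commute)
      moreover have "lie_bracket ham X Y \<in> lie_carrier ham"
        unfolding 1 ham_brackets by (intro ham_closed)
      ultimately show ?thesis by blast
    next
      case 2
      have "A (lie_bracket ham X Y) g = A X (A Y g) - A Y (A X g)" if g: "g \<in> ?T" for g
        using d_h_bracket[OF g, of a r] by (intro poly_mapping_eqI)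
          (simp add: 2 ham_brackets ham_closed A_scale lookup_mscale lookup_minus)
      then show ?thesis by (simp add: 2 ham_brackets ham_closed)
    next
      case 3
      have "A (lie_bracket ham X Y) g = A X (A Y g) - A Y (A X g)" if g: "g \<in> ?T" for g
        unfolding 3 ham_brackets A_scale[OF ham_closed(2)]
        by (intro poly_mapping_eqI) (simp add: lookup_mscale lookup_minus flip: d_h_bracket[OF g])
      moreover have "lie_bracket ham X Y \<in> lie_carrier ham"
        unfolding 3 ham_brackets by (intro ham_closed)
      ultimately show ?thesis by blast
    next
      case 4
      have "A (lie_bracket ham X Y) g = A X (A Y g) - A Y (A X g)" if g: "g \<in> ?T" for g
      proof (rule poly_mapping_eqI)
        fix q
        define x where "x = lookup g (q - r - s)"
        have x: "x \<in> U" using g by (simp add: x_def tensor_carrierD)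
        have sw: "q - s - r = q - r - s" "q - (r + s) = q - r - s" by (simp_all add: algebra_simps)
        have L: "lookup (A (lie_bracket ham X Y) g) q =
            sc (of_int (om r s)) (sc (of_int (om (r + s) q)) x + D (r + s) x)"
          using g by (simp add: 4 ham_brackets A_scale ham_closed lookup_mscale A_h x_def sw)
        have R: "lookup (A X (A Y g) - A Y (A X g)) q =
            (sc (of_int (om r q)) (sc (of_int (om s (q - r))) x + D s x) + D r (sc (of_int (om s (q - r))) x + D s x)) -
            (sc (of_int (om s q)) (sc (of_int (om r (q - s))) x + D r x) + D s (sc (of_int (om r (q - s))) x + D r x))"
          using g by (simp add: 4 lookup_minus A_h hm x_def sw)
        show "lookup (A (lie_bracket ham X Y) g) q = lookup (A X (A Y g) - A Y (A X g)) q"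
        proof -
          have o: "om s (q - r) = om s q + om r s" "om r (q - s) = om r q - om r s"
            using om_commute[of s r] by (simp_all add: om_linear)
          have c: "(of_int (om s q + om r s) :: complex) = of_int (om s q) + of_int (om r s)"
            "(of_int (om r q - om r s) :: complex) = of_int (om r q) - of_int (om r s)"
            "(of_int (om (r + s) q) :: complex) = of_int (om r q) + of_int (om s q)"
            by (simp_all add: om_add_left)
          have DU: "D r x \<in> U" "D s x \<in> U" using e(1) x by blast+
          have l: "D r (sc \<gamma> x + D s x) = sc \<gamma> (D r x) + D r (D s x)"
            "D s (sc \<gamma> x + D r x) = sc \<gamma> (D s x) + D s (D r x)" for \<gamma>
            using x DU by (simp_all add: e)
          show ?thesis
            unfolding L R o c l D_r[OF x, of r s] by (rule ident[symmetric])
        qed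
      qed
      then show ?thesis using 4 by (simp add: ham_brackets ham_closed)
    qed
  qed
  have br_add_left: "lie_bracket ham (X + X') Y = lie_bracket ham X Y + lie_bracket ham X' Y"
    if "Y \<in> lie_carrier ham" for X X' Y
    using ham_linear[OF that] by (simp add: ham_simps fun_eq_iff algebra_simps)
  have br_scale_left: "lie_bracket ham (hscale c X) Y = hscale c (lie_bracket ham X Y)"
    if "Y \<in> lie_carrier ham" for c X Y
    by (simp add: ham_simps hscale_def fun_eq_iff ham_linear(2)[OF that] right_diff_distrib)
  have br_swap: "lie_bracket ham X Y = hscale (- 1) (lie_bracket ham Y X)" for X Y
    by (auto simp: ham_simps hscale_def fun_eq_iff lookup_const_mult lookup_minus intro!: poly_mapping_eqI)
  \<comment> \<open>\<open>Q\<close> also records that the bracket stays in the algebra, since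
    \<open>A\<close> is known to be linear only there. It is extended to the span in the second
    argument, by antisymmetry, and then in the first.\<close>
  define Q where "Q X Y \<longleftrightarrow> lie_bracket ham X Y \<in> lie_carrier ham \<and>
      (\<forall>g\<in>?T. A (lie_bracket ham X Y) g = A X (A Y g) - A Y (A X g))" for X Y
  have Q_swap: "Q X Y" if "Q Y X" for X Y
  proof -
    have YX: "lie_bracket ham Y X \<in> lie_carrier ham"
      "\<And>g. g \<in> ?T \<Longrightarrow> A (lie_bracket ham Y X) g = A Y (A X g) - A X (A Y g)"
      using that by (auto simp: Q_def)
    have "A (hscale (- 1) (lie_bracket ham Y X)) g = A X (A Y g) - A Y (A X g)" if "g \<in> ?T" for g
      unfolding A_scale[OF YX(1)] YX(2)[OF that] by (simp add: T.scale_minus_left)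
    then show ?thesis unfolding Q_def br_swap[of X Y] using ham_closed(5)[OF YX(1)] by blast
  qed
  have Q_add: "Q (X + X') Y" if X: "X \<in> lie_carrier ham" "X' \<in> lie_carrier ham" and Y: "Y \<in> lie_carrier ham"
    and Q: "Q X Y" "Q X' Y" for X X' Y
  proof -
    have "A Y (A X g + A X' g) = A Y (A X g) + A Y (A X' g)" if "g \<in> ?T" for g
      using endoA[OF Y] AT that X unfolding endo_on_def by blast
    then show ?thesis
      using Q X AT[OF Y] by (auto simp: Q_def br_add_left[OF Y] ham_closed A_add algebra_simps)
  qed
  have Q_scale: "Q (hscale c X) Y" if X: "X \<in> lie_carrier ham" and Y: "Y \<in> lie_carrier ham" and Q: "Q X Y" for c X Y
  proof -
    have "A Y (?ms c (A X g)) = ?ms c (A Y (A X g))" if "g \<in> ?T" for g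
      using endoA[OF Y] AT that X unfolding endo_on_def by blast
    then show ?thesis
      using Q X AT[OF Y] by (auto simp: Q_def br_scale_left[OF Y] ham_closed A_scale T.scale_right_diff_distrib)
  qed
  have Q_gen: "Q X Y" if X: "X \<in> range d \<union> range h" and Y: "Y \<in> lie_carrier ham" for X Y
  proof -
    have Xh: "X \<in> lie_carrier ham" using X ham_closed by blast
    from Y show ?thesis
    proof (induction rule: ham_induct)
      case (d a) then show ?case using bracket_gen X unfolding Q_def by blast
    next
      case (h r) then show ?case using bracket_gen X unfolding Q_def by blast
    next
      case (add Y Y') then show ?case using Q_add[OF _ _ Xh] Q_swap by blast
    next
      case (scale c Y) then show ?case using Q_scale[OF _ Xh] Q_swap by blast
    qed
  qed
  have Q_all: "Q X Y" if X: "X \<in> lie_carrier ham" and Y: "Y \<in> lie_carrier ham" for X Y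
    using X
  proof (induction rule: ham_induct)
    case (d a) then show ?case using Q_gen Y by blast
  next
    case (h r) then show ?case using Q_gen Y by blast
  next
    case (add X X') then show ?case using Q_add Y by blast
  next
    case (scale c X) then show ?case using Q_scale Y by blast
  qed
  have "lie_module ham J"
  proof (rule lie_moduleI)
    show "vector_space (mscale J)" unfolding J_def by (simp add: vector_space_tensor)
    show "module.subspace (mscale J) (mcarrier J)" unfolding J_def by (simp add: tensor_carrier_subspace)
    fix X Y :: "'m laurent \<Rightarrow> 'm laurent" and v c
    assume X: "X \<in> lie_carrier ham"
    show "endo_on (mscale J) (mcarrier J) (mact J X)" using endoA[OF X] by (simp add: J_def)
    show "mact J (lie_scale ham c X) v = mscale J c (mact J X v)" using A_scale[OF X] by (simp add: J_def ham_simps)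
    assume Y: "Y \<in> lie_carrier ham" and v: "v \<in> mcarrier J"
    show "mact J (X + Y) v = mact J X v + mact J Y v" using A_add[OF X Y] by (simp add: J_def)
    show "mact J (lie_bracket ham X Y) v = mact J X (mact J Y v) - mact J Y (mact J X v)"
      using Q_all[OF X Y] v by (simp add: Q_def J_def)
  qed
  then have "tensor_like lam sc U D J"
    unfolding tensor_like_def using A_d A_h by (simp add: J_def)
  then show ?thesis ..
qed

end

context complex_space
begin

lemma mscale_single: "tensor_ascale sc (const c) (single s v) = single s (sc c v)"
  by (simp add: const_def tensor_ascale_single_single)

lemma tpow_single: "tensor_ascale sc (tpow r) (single s v) = single (r + s) v"
  by (simp add: tpow_def tensor_ascale_single_single)

end

context fd_space
begin

lemma basis_exists':
  obtains E where "E \<subseteq> U" "independent E" "span E = U" "finite E"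
proof -
  obtain E where E: "E \<subseteq> U" "independent E" "U \<subseteq> span E"
    using maximal_independent_subset by blast
  have "finite E" using independent_span_bound[OF finite_B E(2)] E(1) U_span by blast
  moreover have "span E = U" using E span_minimal[OF E(1) subspace_U] by blast
  ultimately show thesis using that E by blast
qed

end

text \<open>The terms of the formula add up to the scalar \<open>om r s\<close> plus
  \<open>Dop\<close>, and additivity of the action carries the description from pure tensors to all
  elements.\<close>

lemma (in sp_a_module) tensor_module_iff:
  "tensor_module lam \<mu> V J \<longleftrightarrow> tensor_like lam (mscale V) (mcarrier V) (Dop \<mu>) J"
proof -
  let ?sc = "mscale V" and ?U = "mcarrier V"
  let ?n = "\<lambda>k :: int. of_int k :: complex"
  let ?T = "tensor_carrier ?U :: ('m lattice \<Rightarrow>\<^sub>0 'v) set"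
  define rhs where "rhs r s v =
      mscale J
             (\<Sum>i\<in>UNIV. ?n (r $ Inr i) * (?n (s $ Inl i) + \<mu> $ Inr i)
                      - ?n (r $ Inl i) * (?n (s $ Inr i) + \<mu> $ Inl i))
             (tensor ?sc (tpow (r + s)) v)
         + tensor ?sc (tpow (r + s))
             (\<Sum>i\<in>UNIV.
                ?sc (?n (r $ Inr i) ^ 2) (\<phi> (E (Inr i) (Inl i)) v)
              + ?sc (?n (r $ Inl i) * ?n (r $ Inr i)) (\<phi> (E (Inl i) (Inl i) - E (Inr i) (Inr i)) v)
              - ?sc (?n (r $ Inl i) ^ 2) (\<phi> (E (Inl i) (Inr i)) v))
         + tensor ?sc (tpow (r + s))
             (\<Sum>i\<in>UNIV. \<Sum>j\<in>{j. i < j}.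
                ?sc (?n (r $ Inr i) * ?n (r $ Inr j)) (\<phi> (E (Inr j) (Inl i) + E (Inr i) (Inl j)) v)
              + ?sc (?n (r $ Inl i) * ?n (r $ Inr j)) (\<phi> (E (Inl i) (Inl j) - E (Inr j) (Inr i)) v)
              + ?sc (?n (r $ Inl j) * ?n (r $ Inr i)) (\<phi> (E (Inl j) (Inl i) - E (Inr i) (Inr j)) v)
              - ?sc (?n (r $ Inl i) * ?n (r $ Inl j)) (\<phi> (E (Inl i) (Inr j) + E (Inl j) (Inr i)) v))" for r s v
  have coef: "(\<Sum>i\<in>UNIV. ?n (r $ Inr i) * (?n (s $ Inl i) + \<mu> $ Inr i)
                      - ?n (r $ Inl i) * (?n (s $ Inr i) + \<mu> $ Inl i)) = ?n (om r s) + ell \<mu> r" for r s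
    by (simp add: om_def ell_def sum.distrib[symmetric] algebra_simps)
  have rhs: "rhs r s v = single (r + s) (?sc (?n (om r s)) v + Dop \<mu> r v)"
    if v: "v \<in> ?U" and J: "mscale J = (\<lambda>c. tensor_ascale ?sc (const c))" for r s v
    unfolding rhs_def coef J lookup_tensor_tpow mscale_single
    by (simp only: single_add[symmetric] Dop_def phi_rank1_expand[OF v] scale_left_distrib add.assoc)
  have unf: "tensor_module lam \<mu> V J \<longleftrightarrow>
      lie_module ham J \<and> mcarrier J = ?T \<and> ascale J = tensor_ascale ?sc \<and>
      mscale J = (\<lambda>c. tensor_ascale ?sc (const c)) \<and>
      (\<forall>a s. \<forall>v\<in>?U. mact J (d a) (tensor ?sc (tpow s) v) = mscale J (?n (s $ a) + lam $ a) (tensor ?sc (tpow s) v)) \<and>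
      (\<forall>r s. \<forall>v\<in>?U. mact J (h r) (tensor ?sc (tpow s) v) = rhs r s v)"
    unfolding tensor_module_def Let_def rhs_def ..
  show ?thesis
  proof
    assume "tensor_module lam \<mu> V J"
    then have L: "lie_module ham J" and c: "mcarrier J = ?T" "ascale J = tensor_ascale ?sc"
      and ms: "mscale J = (\<lambda>c. tensor_ascale ?sc (const c))"
      and d: "\<And>a s v. v \<in> ?U \<Longrightarrow> mact J (d a) (single s v) = single s (?sc (?n (s $ a) + lam $ a) v)"
      and h: "\<And>r s v. v \<in> ?U \<Longrightarrow> mact J (h r) (single s v) = rhs r s v"
      unfolding unf lookup_tensor_tpow by (auto simp: mscale_single)
    have add: "mact J X (f + g) = mact J X f + mact J X g" if "X \<in> lie_carrier ham" "f \<in> ?T" "g \<in> ?T" for X f g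
      using lie_moduleD(3)[OF L that(1)] that(2,3) unfolding endo_on_def c by blast
    note e = endoD[OF endo_Dop]
    have "lookup (mact J (d a) g) s = ?sc (?n (s $ a) + lam $ a) (lookup g s)" if "g \<in> ?T" for a s g
      using that
    proof (induction rule: tensor_carrier_induct)
      case (single u v)
      then show ?case by (auto simp: d lookup_single when_def)
    next
      case (add f g)
      then show ?case using \<open>\<And>X f g. X \<in> lie_carrier ham \<Longrightarrow> f \<in> ?T \<Longrightarrow> g \<in> ?T \<Longrightarrow> mact J X (f + g) = mact J X f + mact J X g\<close>[OF ham_closed(1)]
        by (simp add: lookup_add scale_right_distrib)
    qed
    moreover have "lookup (mact J (h r) g) s = ?sc (?n (om r s)) (lookup g (s - r)) + Dop \<mu> r (lookup g (s - r))"
      if "g \<in> ?T" for r s g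
      using that
    proof (induction rule: tensor_carrier_induct)
      case (single u v)
      have eq: "r + u = s \<longleftrightarrow> u = s - r" by (auto simp: algebra_simps)
      have "om r u = om r s" if "u = s - r" using that by (simp add: om_linear)
      then show ?case using single e(4) by (auto simp: h rhs[OF single ms] lookup_single when_def eq)
    next
      case (add f g)
      then show ?case using \<open>\<And>X f g. X \<in> lie_carrier ham \<Longrightarrow> f \<in> ?T \<Longrightarrow> g \<in> ?T \<Longrightarrow> mact J X (f + g) = mact J X f + mact J X g\<close>[OF ham_closed(2)]
        by (simp add: lookup_add e(2) tensor_carrierD scale_right_distrib algebra_simps)
    qed
    ultimately show "tensor_like lam ?sc ?U (Dop \<mu>) J"
      unfolding tensor_like_def using L c ms by blast
  next
    assume tl: "tensor_like lam ?sc ?U (Dop \<mu>) J"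
    then have L: "lie_module ham J" and c: "mcarrier J = ?T" "ascale J = tensor_ascale ?sc"
      and ms: "mscale J = (\<lambda>c. tensor_ascale ?sc (const c))"
      and d: "\<And>a s g. g \<in> ?T \<Longrightarrow> lookup (mact J (d a) g) s = ?sc (?n (s $ a) + lam $ a) (lookup g s)"
      and h: "\<And>r s g. g \<in> ?T \<Longrightarrow> lookup (mact J (h r) g) s =
         ?sc (?n (om r s)) (lookup g (s - r)) + Dop \<mu> r (lookup g (s - r))"
      unfolding tensor_like_def by auto
    have T: "single s v \<in> ?T" if "v \<in> ?U" for s v using that by (simp add: tensor_carrier_single)
    have "mact J (d a) (single s v) = single s (?sc (?n (s $ a) + lam $ a) v)" if "v \<in> ?U" for a s v
      by (rule poly_mapping_eqI) (auto simp: d[OF T[OF that]] lookup_single when_def)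
    moreover have "mact J (h r) (single s v) = rhs r s v" if "v \<in> ?U" for r s v
    proof (rule poly_mapping_eqI)
      fix q
      have eq: "r + s = q \<longleftrightarrow> s = q - r" by (auto simp: algebra_simps)
      have "om r s = om r q" if "s = q - r" using that by (simp add: om_linear)
      then show "lookup (mact J (h r) (single s v)) q = lookup (rhs r s v) q"
        using endoD(4)[OF endo_Dop] by (auto simp: h[OF T[OF that]] rhs[OF that ms] lookup_single when_def eq)
    qed
    ultimately show "tensor_module lam \<mu> V J"
      unfolding unf lookup_tensor_tpow using L c ms by (simp add: mscale_single)
  qed
qed

section \<open>Modules A_N (x) U as objects of the category\<close>

locale tensor_like_module = lattice_rep sc U B D
  for sc :: "complex \<Rightarrow> 'v::ab_group_add \<Rightarrow> 'v" and U B and D :: "'m::finite lattice \<Rightarrow> 'v \<Rightarrow> 'v" +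
  fixes lam :: "complex ^ 'm index" and J :: "('m, 'm lattice \<Rightarrow>\<^sub>0 'v) ah_mod"
  assumes tensor_like: "tensor_like lam sc U D J"
begin

abbreviation "T \<equiv> tensor_carrier U :: ('m lattice \<Rightarrow>\<^sub>0 'v) set"
abbreviation "ms c \<equiv> tensor_ascale sc (const c :: 'm laurent)"

lemma J_simps: "mcarrier J = T" "ascale J = tensor_ascale sc" "mscale J = ms"
  and lie_module_J: "lie_module ham J"
  using tensor_like by (auto simp: tensor_like_def)

lemma act_d: "g \<in> T \<Longrightarrow> lookup (mact J (d a) g) s = sc (of_int (s $ a) + lam $ a) (lookup g s)"
  and act_h: "g \<in> T \<Longrightarrow> lookup (mact J (h r) g) s = sc (of_int (om r s)) (lookup g (s - r)) + D r (lookup g (s - r))"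
  using tensor_like by (auto simp: tensor_like_def)

lemma single_T: "v \<in> U \<Longrightarrow> single s v \<in> T"
  by (simp add: tensor_carrier_single)

lemma act_d_single: "v \<in> U \<Longrightarrow> mact J (d a) (single s v) = single s (sc (of_int (s $ a) + lam $ a) v)"
  by (rule poly_mapping_eqI) (auto simp: act_d single_T lookup_single when_def)

lemma act_h_single: "v \<in> U \<Longrightarrow> mact J (h r) (single s v) = single (r + s) (sc (of_int (om r s)) v + D r v)"
proof (rule poly_mapping_eqI)
  fix q assume v: "v \<in> U"
  have eq: "r + s = q \<longleftrightarrow> s = q - r" by (auto simp: algebra_simps)
  have "om r s = om r q" if "s = q - r" using that by (simp add: om_linear)
  then show "lookup (mact J (h r) (single s v)) q = lookup (single (r + s) (sc (of_int (om r s)) v + D r v)) q"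
    using endoD(4)[OF endo_D] by (auto simp: act_h single_T v lookup_single when_def eq)
qed

lemma act_endo: "X \<in> lie_carrier ham \<Longrightarrow> endo_on ms T (mact J X)"
  using lie_moduleD(3)[OF lie_module_J] by (simp add: J_simps)

lemma act_in_T: "X \<in> lie_carrier ham \<Longrightarrow> g \<in> T \<Longrightarrow> mact J X g \<in> T"
  using act_endo unfolding endo_on_def by blast

lemma act_add: "X \<in> lie_carrier ham \<Longrightarrow> f \<in> T \<Longrightarrow> g \<in> T \<Longrightarrow> mact J X (f + g) = mact J X f + mact J X g"
  using act_endo unfolding endo_on_def by blast

lemma vector_space_ms: "vector_space ms"
  by (rule vector_space_tensor)

text \<open>The elements t^s (x) b with \<open>b\<close> in a basis of \<open>U\<close> are
  eigenvectors and form a basis over the complex numbers.\<close>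

lemma diagonal: "diagonalizable_on (mscale J) (mcarrier J) (mact J (d i))"
proof -
  interpret W: vector_space ms by (rule vector_space_ms)
  obtain E where E: "E \<subseteq> U" "independent E" "span E = U" "finite E" by (rule basis_exists')
  define S where "S = {single (s :: 'm lattice) b | s b. b \<in> E}"
  have S: "single s b \<in> S" if "b \<in> E" for s b using that by (auto simp: S_def)
  have "W.independent S"
  proof (rule ccontr)
    assume "\<not> W.independent S"
    then obtain x where x: "x \<in> S" "x \<in> W.span (S - {x})" unfolding W.dependent_def by blast
    obtain s b where sb: "x = single s b" "b \<in> E" using x(1) by (auto simp: S_def)
    \<comment> \<open>Every element of \<open>S\<close> other than \<open>x\<close> has its
      coefficient at \<open>s\<close> in this span, whereas the coefficient of \<open>x\<close> is
      \<open>b\<close>.\<close>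
    let ?W = "{g. lookup g s \<in> span (E - {b})}"
    have "W.subspace ?W"
      unfolding W.subspace_def by (auto simp: lookup_add lookup_mscale span_zero span_add span_scale)
    moreover have "S - {x} \<subseteq> ?W"
    proof
      fix y assume "y \<in> S - {x}"
      then obtain s' b' where y: "y = single s' b'" "b' \<in> E" "y \<noteq> x" by (auto simp: S_def)
      show "y \<in> ?W"
        using y sb by (cases "s' = s") (auto simp: lookup_single when_def span_zero intro: span_base)
    qed
    ultimately have "x \<in> ?W" using x(2) W.span_minimal by blast
    then have "b \<in> span (E - {b})" by (simp add: sb)
    then show False using E(2) sb(2) unfolding dependent_def by blast
  qed
  moreover have "W.span S = T"
  proof
    show "W.span S \<subseteq> T"
      using E(1) single_T by (intro W.span_minimal tensor_carrier_subspace) (auto simp: S_def)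
    have sing: "single s v \<in> W.span S" if "v \<in> U" for s v
    proof -
      have "v \<in> span E" using that E by simp
      then show ?thesis
      proof (induction rule: span_induct_alt)
        case base then show ?case by (simp add: W.span_zero)
      next
        case (step c x y)
        have "single s (sc c x + y) = ms c (single s x) + single s y"
          by (simp add: mscale_single single_add)
        then show ?case using step W.span_add W.span_scale W.span_base S by metis
      qed
    qed
    show "T \<subseteq> W.span S"
    proof
      fix g assume "g \<in> T"
      then show "g \<in> W.span S"
        by (induction rule: tensor_carrier_induct) (auto intro: sing W.span_add)
    qed
  qed
  moreover have "\<forall>x\<in>S. \<exists>c. mact J (d i) x = ms c x"
  proof
    fix x assume "x \<in> S"
    then obtain s b where "x = single s b" "b \<in> E" by (auto simp: S_def)
    then show "\<exists>c. mact J (d i) x = ms c x" using E(1) act_d_single[of b i s] mscale_single by (metis subsetD)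
  qed
  ultimately show ?thesis unfolding diagonalizable_on_def J_simps by blast
qed

text \<open>The elements 1 (x) b with \<open>b\<close> in a basis of \<open>U\<close> form a basis
  over A_N; independence is read off exponent by exponent.\<close>

lemma free_finite_rank:
  "\<exists>S. finite S \<and> \<not> module.dependent (ascale J) S \<and> module.span (ascale J) S = mcarrier J"
proof -
  interpret W: module "tensor_ascale sc :: 'm laurent \<Rightarrow> _" by (rule module_tensor_ascale)
  obtain E where E: "E \<subseteq> U" "independent E" "span E = U" "finite E" by (rule basis_exists')
  let ?S = "single (0 :: 'm lattice) ` E"
  have "\<not> W.dependent ?S"
  proof
    assume "W.dependent ?S"
    then obtain t u where t: "finite t" "t \<subseteq> ?S" "(\<Sum>v\<in>t. tensor_ascale sc (u v) v) = 0" "\<exists>v\<in>t. u v \<noteq> 0"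
      unfolding W.dependent_explicit by blast
    obtain F where F: "F \<subseteq> E" "t = single 0 ` F" using t(2) by (auto simp: subset_image_iff)
    have finF: "finite F" using F(1) E(4) finite_subset by blast
    have "(\<Sum>b\<in>F. tensor_ascale sc (u (single 0 b)) (single 0 b)) = 0"
      using t(3) unfolding F(2) by (subst (asm) sum.reindex) (auto intro: inj_on_subset[OF inj_single])
    then have "lookup (\<Sum>b\<in>F. tensor_ascale sc (u (single 0 b)) (single 0 b)) s = 0" for s by simp
    then have "(\<Sum>b\<in>F. sc (lookup (u (single 0 b)) s) b) = 0" for s
      by (simp add: lookup_sum lookup_tensor_ascale_single)
    then have "lookup (u (single 0 b)) s = 0" if "b \<in> F" for s b
      using independentD[OF E(2) finF F(1), of "\<lambda>b. lookup (u (single 0 b)) s" b] that by simp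
    then have "u (single 0 b) = 0" if "b \<in> F" for b using that by (simp add: poly_mapping_eqI)
    then show False using t(4) F(2) by blast
  qed
  moreover have "W.span ?S = T"
  proof
    show "W.span ?S \<subseteq> T"
      using E(1) single_T by (intro W.span_minimal tensor_ascale_subspace) auto
    have sing: "single 0 v \<in> W.span ?S" if "v \<in> U" for v
    proof -
      have "v \<in> span E" using that E by simp
      then show ?thesis
      proof (induction rule: span_induct_alt)
        case base then show ?case by (simp add: W.span_zero)
      next
        case (step c x y)
        have "single 0 (sc c x + y) = ms c (single 0 x) + single 0 y"
          by (simp add: mscale_single single_add)
        then show ?case using step W.span_add W.span_scale W.span_base by (metis imageI)
      qed
    qed
    have "single s v \<in> W.span ?S" if "v \<in> U" for s v
      using W.span_scale[OF sing[OF that], of "tpow s"] by (simp add: tpow_single)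
    then show "T \<subseteq> W.span ?S"
      using tensor_carrier_induct[where P = "\<lambda>g. g \<in> W.span ?S"] W.span_add by blast
  qed
  ultimately show ?thesis using E(4) unfolding J_simps by blast
qed

lemma leibniz:
  assumes X: "X \<in> lie_carrier ham" and g: "g \<in> T"
  shows "mact J X (tensor_ascale sc f g) = tensor_ascale sc (X f) g + tensor_ascale sc f (mact J X g)"
proof -
  have gen: "mact J X (tensor_ascale sc f g) = tensor_ascale sc (X f) g + tensor_ascale sc f (mact J X g)"
    if X: "X \<in> lie_carrier ham" and s: "\<And>u v. v \<in> U \<Longrightarrow>
      mact J X (tensor_ascale sc f (single u v)) = tensor_ascale sc (X f) (single u v) + tensor_ascale sc f (mact J X (single u v))"
    for X using g
  proof (induction rule: tensor_carrier_induct)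
    case (single u v) then show ?case using s by blast
  next
    case (add g g')
    then show ?case
      by (simp add: tensor_ascale_add_right act_add[OF X] tensor_ascale_in_carrier algebra_simps)
  qed
  from X show ?thesis
  proof (induction rule: ham_induct)
    case (d a)
    show ?case
    proof (rule gen[OF ham_closed(1)])
      fix u v assume v: "v \<in> U"
      show "mact J (d a) (tensor_ascale sc f (single u v)) =
          tensor_ascale sc (d a f) (single u v) + tensor_ascale sc f (mact J (d a) (single u v))"
      proof (rule poly_mapping_eqI)
        fix s
        show "lookup (mact J (d a) (tensor_ascale sc f (single u v))) s =
          lookup (tensor_ascale sc (d a f) (single u v) + tensor_ascale sc f (mact J (d a) (single u v))) s"
          unfolding act_d[OF tensor_ascale_in_carrier[OF single_T[OF v]]] act_d_single[OF v] lookup_add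
            lookup_tensor_ascale_single lookup_d scale_scale scale_left_distrib[symmetric]
          by (simp add: algebra_simps)
      qed
    qed
  next
    case (h r)
    show ?case
    proof (rule gen[OF ham_closed(2)])
      fix u v assume v: "v \<in> U"
      show "mact J (h r) (tensor_ascale sc f (single u v)) =
          tensor_ascale sc (h r f) (single u v) + tensor_ascale sc f (mact J (h r) (single u v))"
      proof (rule poly_mapping_eqI)
        fix s
        define c where "c = lookup f (s - r - u)"
        have e: "s - (r + u) = s - r - u" "s - u - r = s - r - u" by (simp_all add: algebra_simps)
        have o: "(of_int (om r s) :: complex) = of_int (om r (s - u)) + of_int (om r u)" by (simp add: om_linear)
        show "lookup (mact J (h r) (tensor_ascale sc f (single u v))) s =
          lookup (tensor_ascale sc (h r f) (single u v) + tensor_ascale sc f (mact J (h r) (single u v))) s"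
          unfolding act_h[OF tensor_ascale_in_carrier[OF single_T[OF v]]] act_h_single[OF v] lookup_add
            lookup_tensor_ascale_single lookup_h e c_def[symmetric] endoD(3)[OF endo_D v] o
          by (simp add: scale_right_distrib scale_left_distrib distrib_right distrib_left add.assoc mult.commute)
      qed
    qed
  next
    case (add X Y)
    have *: "mact J (X + Y) v = mact J X v + mact J Y v" if "v \<in> T" for v
      using lie_moduleD(4)[OF lie_module_J add(1,2)] that by (simp only: J_simps)
    have XY: "(X + Y) f = X f + Y f" by simp
    show ?case
      unfolding *[OF g] *[OF tensor_ascale_in_carrier[OF g]] add(3,4) XY
        tensor_ascale_add_left tensor_ascale_add_right
      by (simp add: algebra_simps)
  next
    case (scale c X)
    have sc: "mact J (hscale c X) v = ms c (mact J X v)" if "v \<in> T" for v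
      using lie_moduleD(5)[OF lie_module_J scale(1)] that by (simp add: J_simps ham_simps)
    have com: "tensor_ascale sc f (ms c v) = ms c (tensor_ascale sc f v)" for v
      by (simp only: tensor_ascale_mult[symmetric] mult.commute)
    have cX: "hscale c X f = const c * X f" by (simp add: hscale_def)
    show ?case
      unfolding sc[OF g] sc[OF tensor_ascale_in_carrier[OF g]] scale(2) cX com tensor_ascale_mult
        tensor_ascale_add_right ..
  qed
qed

lemma category_J: "category_J J"
proof -
  have "module.subspace (ascale J) (mcarrier J)" unfolding J_simps by (rule tensor_ascale_subspace)
  moreover have "module (ascale J)" unfolding J_simps by (rule module_tensor_ascale)
  moreover have "\<forall>c v. mscale J c v = ascale J (const c) v" by (simp add: J_simps)
  moreover have "\<forall>X\<in>lie_carrier ham. \<forall>f. \<forall>v\<in>mcarrier J.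
        mact J X (ascale J f v) = ascale J (X f) v + ascale J f (mact J X v)"
    unfolding J_simps using leibniz by blast
  ultimately show ?thesis
    unfolding category_J_def using lie_module_J diagonal free_finite_rank by blast
qed

lemma category_J_at: "category_J_at lam J"
  unfolding category_J_at_def
proof (intro conjI allI impI category_J)
  fix \<mu> assume ne: "weight_space J \<mu> \<noteq> {0}"
  have "mact J (d i) 0 = ms (\<mu> $ i) 0" for i
    using act_d_single[of 0 i 0] by (simp add: poly_mapping_eqI lookup_mscale)
  moreover have "(0 :: 'm lattice \<Rightarrow>\<^sub>0 'v) \<in> T" by (simp add: tensor_carrier_def)
  ultimately have "0 \<in> weight_space J \<mu>" by (simp add: weight_space_def J_simps)
  then obtain g where g: "g \<in> weight_space J \<mu>" "g \<noteq> 0" using ne by blast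
  obtain s where s: "lookup g s \<noteq> 0" using g(2) by (metis poly_mapping_eqI lookup_zero)
  have gT: "g \<in> T" using g by (simp add: weight_space_def J_simps)
  have "\<mu> $ i = lam $ i + of_int (s $ i)" for i
  proof -
    have "mact J (d i) g = ms (\<mu> $ i) g" using g by (simp add: weight_space_def J_simps)
    then have "sc (of_int (s $ i) + lam $ i) (lookup g s) = sc (\<mu> $ i) (lookup g s)"
      using act_d[OF gT, of i s] by (auto simp: lookup_mscale)
    then show ?thesis using s by (simp add: add.commute)
  qed
  then show "\<exists>r :: 'm lattice. \<forall>i. \<mu> $ i = lam $ i + of_int (r $ i)" by blast
qed

text \<open>A submodule contains the weight components of its elements, and monomials move a
  component to any exponent. So it is A_N (x) U0 for a subspace U0 of \<open>U\<close> that is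
  stable under all \<open>D r\<close>.\<close>

lemma irreducible:
  assumes U: "U \<noteq> {0}"
    and irr: "\<And>W. subspace W \<Longrightarrow> W \<subseteq> U \<Longrightarrow> (\<And>r w. w \<in> W \<Longrightarrow> D r w \<in> W) \<Longrightarrow> W = {0} \<or> W = U"
  shows "irreducible_ah_module J"
  unfolding irreducible_ah_module_def
proof (intro conjI allI impI)
  obtain u where u: "u \<in> U" "u \<noteq> 0" using U U_closed(1) by blast
  have "single 0 u \<in> T" "single (0 :: 'm lattice) u \<noteq> 0"
    using single_T[OF u(1)] u(2) by (auto dest: arg_cong[of _ _ "\<lambda>g. lookup g 0"])
  then show "mcarrier J \<noteq> {0}" unfolding J_simps by blast
  fix W assume asm: "W \<subseteq> mcarrier J \<and> module.subspace (ascale J) W \<and>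
          (\<forall>X\<in>lie_carrier ham. \<forall>w\<in>W. mact J X w \<in> W)"
  interpret A: module "tensor_ascale sc :: 'm laurent \<Rightarrow> _" by (rule module_tensor_ascale)
  interpret M: vector_space ms by (rule vector_space_ms)
  have W: "W \<subseteq> T" "A.subspace W" "\<And>X w. X \<in> lie_carrier ham \<Longrightarrow> w \<in> W \<Longrightarrow> mact J X w \<in> W"
    using asm by (auto simp: J_simps)
  have MW: "M.subspace W" using W(2) unfolding A.subspace_def M.subspace_def by blast
  have comp: "single s (lookup g s) \<in> W" if g: "g \<in> W" for g s
  proof (cases "s \<in> Poly_Mapping.keys g")
    case True
    have gT: "g \<in> T" using g W(1) by blast
    show ?thesis
    proof (rule weight_components_in_stable_subspace[OF vector_space_ms MW tensor_carrier_subspace, where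
          T = "\<lambda>i. mact J (d i)" and wt = "\<lambda>s i. of_int (s $ i) + lam $ i" and R = "Poly_Mapping.keys g"
          and w = "\<lambda>s. single s (lookup g s)"])
      show "mact J (d i) v \<in> W" if "v \<in> W" for i v using W(3) that ham_closed(1) by blast
      show "endo_on ms T (mact J (d i))" for i by (rule act_endo[OF ham_closed(1)])
      show "\<exists>i. of_int (r $ i) + lam $ i \<noteq> of_int (s $ i) + lam $ i" if "r \<noteq> s" for r s
        using that by (auto simp: vec_eq_iff)
      show "finite (Poly_Mapping.keys g)" by simp
      show "single r (lookup g r) \<in> T" for r using gT by (simp add: single_T tensor_carrierD)
      show "mact J (d i) (single r (lookup g r)) = ms (of_int (r $ i) + lam $ i) (single r (lookup g r))" for r i
        using gT by (simp add: act_d_single tensor_carrierD mscale_single)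
      show "(\<Sum>r\<in>Poly_Mapping.keys g. single r (lookup g r)) \<in> W" using g by (simp add: sum_single_lookup)
    qed (rule True)
  next
    case False
    then show ?thesis using MW by (simp add: in_keys_iff M.subspace_0)
  qed
  have shift: "single s v \<in> W \<Longrightarrow> single t v \<in> W" for s t v
    using A.subspace_scale[OF W(2), of "single s v" "tpow (t - s)"] by (simp add: tpow_single)
  let ?U0 = "{v \<in> U. single (0 :: 'm lattice) v \<in> W}"
  have "?U0 = {0} \<or> ?U0 = U"
  proof (rule irr)
    show "subspace ?U0"
    proof (rule subspaceI)
      show "0 \<in> ?U0" using M.subspace_0[OF MW] by simp
      show "x + y \<in> ?U0" if "x \<in> ?U0" "y \<in> ?U0" for x y
        using that M.subspace_add[OF MW, of "single 0 x" "single 0 y"] by (simp add: single_add)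
      show "sc c x \<in> ?U0" if "x \<in> ?U0" for c x
        using that M.subspace_scale[OF MW, of "single 0 x" c] by (simp add: mscale_single)
    qed
    show "D r v \<in> ?U0" if v: "v \<in> ?U0" for r v
    proof -
      have "mact J (h r) (single 0 v) \<in> W" using W(3) v ham_closed(2) by blast
      then have "single r (D r v) \<in> W" using v by (simp add: act_h_single om_linear)
      then show ?thesis using shift v endoD(1)[OF endo_D] by blast
    qed
  qed auto
  then show "W = {0} \<or> W = mcarrier J"
  proof
    assume U0: "?U0 = {0}"
    have "g = 0" if g: "g \<in> W" for g
    proof (rule poly_mapping_eqI)
      fix s
      have "lookup g s \<in> ?U0" using shift[OF comp[OF g]] g W(1) tensor_carrierD by blast
      then show "lookup g s = lookup 0 s" using U0 by simp
    qed
    then show ?thesis using M.subspace_0[OF MW] by blast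
  next
    assume U0: "?U0 = U"
    have "g \<in> W" if "g \<in> T" for g
      using that
    proof (induction rule: tensor_carrier_induct)
      case (single s v)
      then show ?case using U0 shift by blast
    next
      case (add f g)
      then show ?case using M.subspace_add[OF MW] by blast
    qed
    then show ?thesis using W(1) unfolding J_simps by blast
  qed
qed

end

section \<open>Isomorphisms of tensor modules\<close>

lemma ham_intertwine:
  assumes J: "lie_module ham J" and K: "lie_module ham K"
    and f: "\<And>v. v \<in> mcarrier J \<Longrightarrow> f v \<in> mcarrier K"
    and add: "\<And>u v. u \<in> mcarrier J \<Longrightarrow> v \<in> mcarrier J \<Longrightarrow> f (u + v) = f u + f v"
    and scale: "\<And>c v. v \<in> mcarrier J \<Longrightarrow> f (mscale J c v) = mscale K c (f v)"
    and d: "\<And>a v. v \<in> mcarrier J \<Longrightarrow> f (mact J (d a) v) = mact K (d a) (f v)"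
    and h: "\<And>r v. v \<in> mcarrier J \<Longrightarrow> f (mact J (h r) v) = mact K (h r) (f v)"
    and X: "X \<in> lie_carrier ham" and v: "v \<in> mcarrier J"
  shows "f (mact J X v) = mact K X (f v)"
  using X
proof (induction rule: ham_induct)
  case (d a) show ?case by (rule assms(6)[OF v])
next
  case (h r) show ?case by (rule assms(7)[OF v])
next
  case (add X Y)
  have "mact J X v \<in> mcarrier J" "mact J Y v \<in> mcarrier J"
    using lie_moduleD(3)[OF J] add(1,2) v unfolding endo_on_def by blast+
  then show ?case
    using add(3,4) unfolding lie_moduleD(4)[OF J add(1,2) v] lie_moduleD(4)[OF K add(1,2) f[OF v]]
    by (simp add: assms(4))
next
  case (scale c X)
  have "mact J X v \<in> mcarrier J"
    using lie_moduleD(3)[OF J scale(1)] v unfolding endo_on_def by blast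
  then show ?case
    using scale(2) lie_moduleD(5)[OF J scale(1) v, of c] lie_moduleD(5)[OF K scale(1) f[OF v], of c]
    by (simp add: assms(5) ham_simps)
qed

definition intertwines ::
  "(complex \<Rightarrow> 'v::ab_group_add \<Rightarrow> 'v) \<Rightarrow> 'v set \<Rightarrow> ('x \<Rightarrow> 'v \<Rightarrow> 'v) \<Rightarrow>
   (complex \<Rightarrow> 'w::ab_group_add \<Rightarrow> 'w) \<Rightarrow> 'w set \<Rightarrow> ('x \<Rightarrow> 'w \<Rightarrow> 'w) \<Rightarrow> ('v \<Rightarrow> 'w) \<Rightarrow> bool" where
  "intertwines sc U D sc' U' D' f \<longleftrightarrow>
     bij_betw f U U' \<and> (\<forall>u\<in>U. \<forall>v\<in>U. f (u + v) = f u + f v) \<and> (\<forall>c. \<forall>v\<in>U. f (sc c v) = sc' c (f v)) \<and>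
     (\<forall>r. \<forall>v\<in>U. f (D r v) = D' r (f v))"

locale tensor_like_pair =
  L: tensor_like_module sc U B D lam J + R: tensor_like_module sc' U' B' D' lam K
  for sc :: "complex \<Rightarrow> 'v::ab_group_add \<Rightarrow> 'v" and U B and D :: "'m::finite lattice \<Rightarrow> 'v \<Rightarrow> 'v"
    and lam :: "complex ^ 'm index" and J
    and sc' :: "complex \<Rightarrow> 'w::ab_group_add \<Rightarrow> 'w" and U' B' and D' :: "'m lattice \<Rightarrow> 'w \<Rightarrow> 'w" and K
begin

lemma isomorphic_of_intertwines:
  assumes "intertwines sc U D sc' U' D' f"
  shows "isomorphic_ah_modules J K"
proof -
  have bij: "bij_betw f U U'" and add: "\<And>u v. u \<in> U \<Longrightarrow> v \<in> U \<Longrightarrow> f (u + v) = f u + f v"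
    and scale: "\<And>c v. v \<in> U \<Longrightarrow> f (sc c v) = sc' c (f v)" and D: "\<And>r v. v \<in> U \<Longrightarrow> f (D r v) = D' r (f v)"
    using assms by (auto simp: intertwines_def)
  have f0: "f 0 = 0" using scale[of 0 0] by simp
  have fU: "f u \<in> U'" if "u \<in> U" for u using bij that by (auto simp: bij_betw_def)
  let ?g = "inv_into U f"
  have g: "?g w \<in> U" "f (?g w) = w" if "w \<in> U'" for w
    using bij that by (auto simp: bij_betw_def inv_into_into f_inv_into_f)
  have gf: "?g (f u) = u" if "u \<in> U" for u using bij that by (simp add: bij_betw_inv_into_left)
  have g0: "?g 0 = 0" using gf[of 0] f0 by simp
  define F :: "('m lattice \<Rightarrow>\<^sub>0 'v) \<Rightarrow> 'm lattice \<Rightarrow>\<^sub>0 'w" where "F = Poly_Mapping.map f"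
  define G :: "('m lattice \<Rightarrow>\<^sub>0 'w) \<Rightarrow> 'm lattice \<Rightarrow>\<^sub>0 'v" where "G = Poly_Mapping.map ?g"
  have F: "lookup (F x) s = f (lookup x s)" for x s using f0 by (simp add: F_def map.rep_eq when_def)
  have G: "lookup (G x) s = ?g (lookup x s)" for x s using g0 by (simp add: G_def map.rep_eq when_def)
  have FT: "F x \<in> R.T" if "x \<in> L.T" for x using that fU by (simp add: tensor_carrier_def F)
  have F_add: "F (x + y) = F x + F y" if "x \<in> L.T" "y \<in> L.T" for x y
    using that by (intro poly_mapping_eqI) (simp add: F lookup_add add tensor_carrierD)
  have F_ascale: "F (tensor_ascale sc p x) = tensor_ascale sc' p (F x)" if x: "x \<in> L.T" for p x
  proof (rule poly_mapping_eqI)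
    fix s
    have sum: "f (\<Sum>u\<in>A. e u) = (\<Sum>u\<in>A. f (e u))" if "\<And>u. u \<in> A \<Longrightarrow> e u \<in> U" for A :: "'m lattice set" and e
      using that by (induction A rule: infinite_finite_induct) (simp_all add: f0 add L.U_sum)
    have keys: "Poly_Mapping.keys (F x) \<subseteq> Poly_Mapping.keys x" by (auto simp: in_keys_iff F f0)
    show "lookup (F (tensor_ascale sc p x)) s = lookup (tensor_ascale sc' p (F x)) s"
      using tensor_carrierD[OF x]
      by (simp add: F L.lookup_tensor_ascale[OF finite_keys order_refl] R.lookup_tensor_ascale[OF finite_keys keys]
          sum scale)
  qed
  have "bij_betw F L.T R.T"
  proof (rule bij_betw_byWitness[where f' = G])
    show "\<forall>x\<in>L.T. G (F x) = x" using gf by (auto intro!: poly_mapping_eqI simp: F G tensor_carrierD)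
    show "\<forall>x\<in>R.T. F (G x) = x" using g by (auto intro!: poly_mapping_eqI simp: F G tensor_carrierD)
    show "F ` L.T \<subseteq> R.T" using FT by blast
    show "G ` R.T \<subseteq> L.T" using g(1) by (auto simp: tensor_carrier_def G)
  qed
  moreover have "F (mact J X x) = mact K X (F x)" if X: "X \<in> lie_carrier ham" and x: "x \<in> L.T" for X x
  proof (rule ham_intertwine[OF L.lie_module_J R.lie_module_J _ _ _ _ _ X])
    show "F x \<in> mcarrier K" if "x \<in> mcarrier J" for x using that FT by (simp add: L.J_simps R.J_simps)
    show "F (x + y) = F x + F y" if "x \<in> mcarrier J" "y \<in> mcarrier J" for x y
      using that F_add by (simp add: L.J_simps)
    show "F (mscale J c x) = mscale K c (F x)" if "x \<in> mcarrier J" for c x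
      using that F_ascale by (simp add: L.J_simps R.J_simps)
    show "F (mact J (d a) x) = mact K (d a) (F x)" if "x \<in> mcarrier J" for a x
    proof (rule poly_mapping_eqI)
      fix s
      have x: "x \<in> L.T" using that by (simp add: L.J_simps)
      show "lookup (F (mact J (d a) x)) s = lookup (mact K (d a) (F x)) s"
        unfolding F L.act_d[OF x] R.act_d[OF FT[OF x]] by (simp add: scale tensor_carrierD[OF x])
    qed
    show "F (mact J (h r) x) = mact K (h r) (F x)" if "x \<in> mcarrier J" for r x
    proof (rule poly_mapping_eqI)
      fix s
      have x: "x \<in> L.T" using that by (simp add: L.J_simps)
      show "lookup (F (mact J (h r) x)) s = lookup (mact K (h r) (F x)) s"
        unfolding F L.act_h[OF x] R.act_h[OF FT[OF x]]
        by (simp add: add scale D L.endoD(1)[OF L.endo_D] tensor_carrierD[OF x])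
    qed
    show "x \<in> mcarrier J" using x by (simp add: L.J_simps)
  qed
  ultimately show ?thesis
    unfolding isomorphic_ah_modules_def L.J_simps R.J_simps using F_add F_ascale by blast
qed

text \<open>An isomorphism preserves weights, so it maps 1 (x) U onto 1 (x) U'. There the operators
  t^(-r) h(r) are \<open>D r\<close> and \<open>D' r\<close>.\<close>

lemma intertwines_of_isomorphic:
  assumes "isomorphic_ah_modules J K"
  shows "\<exists>f. intertwines sc U D sc' U' D' f"
proof -
  obtain F where bij: "bij_betw F L.T R.T" and add: "\<And>u v. u \<in> L.T \<Longrightarrow> v \<in> L.T \<Longrightarrow> F (u + v) = F u + F v"
    and asc: "\<And>p v. v \<in> L.T \<Longrightarrow> F (tensor_ascale sc p v) = tensor_ascale sc' p (F v)"
    and act: "\<And>X v. X \<in> lie_carrier ham \<Longrightarrow> v \<in> L.T \<Longrightarrow> F (mact J X v) = mact K X (F v)"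
    using assms unfolding isomorphic_ah_modules_def L.J_simps R.J_simps by blast
  have FT: "F x \<in> R.T" if "x \<in> L.T" for x using bij that by (auto simp: bij_betw_def)
  define f where "f v = lookup (F (single 0 v)) 0" for v
  have F_single: "F (single 0 v) = single 0 (f v)" if v: "v \<in> U" for v
  proof (rule poly_mapping_eqI)
    fix s
    let ?k = "F (single 0 v)"
    have sT: "single 0 v \<in> L.T" using v by (rule L.single_T)
    show "lookup ?k s = lookup (single 0 (f v)) s"
    proof (cases "s = 0")
      case False
      then obtain a where a: "s $ a \<noteq> 0" by (auto simp: vec_eq_iff)
      \<comment> \<open>The image has weight \<open>lam\<close> like 1 (x) v, so it has no
        coefficient at an exponent with a nonzero entry.\<close>
      have "mact K (d a) ?k = tensor_ascale sc' (const (lam $ a)) ?k"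
        using act[OF ham_closed(1) sT, of a] asc[OF sT, of "const (lam $ a)"] v
        by (simp add: L.act_d_single L.mscale_single)
      then have "sc' (of_int (s $ a) + lam $ a) (lookup ?k s) = sc' (lam $ a) (lookup ?k s)"
        using R.act_d[OF FT[OF sT], of a s] by (simp add: R.lookup_mscale)
      then show ?thesis using a False by (simp add: lookup_single)
    qed (simp add: f_def)
  qed
  have fU: "f v \<in> U'" if "v \<in> U" for v
    using FT[OF L.single_T[OF that]] by (simp add: f_def tensor_carrierD)
  have "inj_on f U"
  proof (rule inj_onI)
    fix u v assume uv: "u \<in> U" "v \<in> U" "f u = f v"
    then have "F (single 0 u) = F (single 0 v)" by (simp add: F_single)
    then have "single 0 u = (single 0 v :: 'm lattice \<Rightarrow>\<^sub>0 'v)"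
      using bij L.single_T uv(1,2) by (meson bij_betw_def inj_onD)
    then show "u = v" by (metis lookup_single_eq)
  qed
  moreover have "f ` U = U'"
  proof
    show "f ` U \<subseteq> U'" using fU by blast
    show "U' \<subseteq> f ` U"
    proof
      fix w assume w: "w \<in> U'"
      have "single 0 w \<in> F ` L.T" using R.single_T[OF w] bij by (simp add: bij_betw_def)
      then obtain g where g: "g \<in> L.T" "F g = single 0 w" by auto
      have "g = single 0 (lookup g 0)"
      proof (rule poly_mapping_eqI)
        fix s
        show "lookup g s = lookup (single 0 (lookup g 0)) s"
        proof (cases "s = 0")
          case False
          then obtain a where a: "s $ a \<noteq> 0" by (auto simp: vec_eq_iff)
          have "F (mact J (d a) g) = F (tensor_ascale sc (const (lam $ a)) g)"
            using w by (simp add: act[OF ham_closed(1) g(1)] asc[OF g(1)] g(2) R.act_d_single R.mscale_single)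
          then have "mact J (d a) g = tensor_ascale sc (const (lam $ a)) g"
            using bij L.act_in_T[OF ham_closed(1) g(1)] L.tensor_ascale_in_carrier[OF g(1)]
            by (meson bij_betw_def inj_onD)
          then have "sc (of_int (s $ a) + lam $ a) (lookup g s) = sc (lam $ a) (lookup g s)"
            using L.act_d[OF g(1), of a s] by (simp add: L.lookup_mscale)
          then show ?thesis using a False by (simp add: lookup_single)
        qed simp
      qed
      then have "f (lookup g 0) = w" using g(2) by (metis f_def lookup_single_eq)
      then show "w \<in> f ` U" using tensor_carrierD[OF g(1)] by blast
    qed
  qed
  moreover have "f (u + v) = f u + f v" if "u \<in> U" "v \<in> U" for u v
    using add[OF L.single_T[OF that(1)] L.single_T[OF that(2)], of 0 0]
    by (simp add: f_def single_add lookup_add)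
  moreover have "f (sc c v) = sc' c (f v)" if "v \<in> U" for c v
    using asc[OF L.single_T[OF that], of "const c" 0] by (simp add: f_def L.mscale_single R.lookup_mscale)
  moreover have "f (D r v) = D' r (f v)" if v: "v \<in> U" for r v
  proof -
    have Dv: "D r v \<in> U" using L.endoD(1)[OF L.endo_D v] .
    have "F (mact J (h r) (single 0 v)) = mact K (h r) (single 0 (f v))"
      using act[OF ham_closed(2) L.single_T[OF v]] F_single[OF v] by simp
    then have "F (tensor_ascale sc (tpow r) (single 0 (D r v))) = single r (D' r (f v))"
      using v fU[OF v] by (simp add: L.act_h_single R.act_h_single L.tpow_single om_linear)
    then have "single r (f (D r v)) = single r (D' r (f v))"
      by (simp add: asc[OF L.single_T[OF Dv]] F_single[OF Dv] R.tpow_single)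
    then show ?thesis by (metis lookup_single_eq)
  qed
  ultimately show ?thesis unfolding intertwines_def bij_betw_def by blast
qed

end

lemma isomorphic_ah_modules_sym:
  assumes iso: "isomorphic_ah_modules J K"
    and J: "lie_module ham J" "\<And>f v. v \<in> mcarrier J \<Longrightarrow> ascale J f v \<in> mcarrier J"
  shows "isomorphic_ah_modules K J"
proof -
  obtain F where bij: "bij_betw F (mcarrier J) (mcarrier K)"
    and add: "\<And>u v. u \<in> mcarrier J \<Longrightarrow> v \<in> mcarrier J \<Longrightarrow> F (u + v) = F u + F v"
    and asc: "\<And>p v. v \<in> mcarrier J \<Longrightarrow> F (ascale J p v) = ascale K p (F v)"
    and act: "\<And>X v. X \<in> lie_carrier ham \<Longrightarrow> v \<in> mcarrier J \<Longrightarrow> F (mact J X v) = mact K X (F v)"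
    using iso unfolding isomorphic_ah_modules_def by blast
  let ?G = "inv_into (mcarrier J) F"
  have G: "?G w \<in> mcarrier J" "F (?G w) = w" if "w \<in> mcarrier K" for w
    using bij that by (auto simp: bij_betw_def inv_into_into f_inv_into_f)
  have GF: "?G (F u) = u" if "u \<in> mcarrier J" for u using bij that by (simp add: bij_betw_inv_into_left)
  have J_add: "u + v \<in> mcarrier J" if "u \<in> mcarrier J" "v \<in> mcarrier J" for u v
  proof -
    interpret J: vector_space "mscale J" by (rule lie_moduleD(1)[OF J(1)])
    show ?thesis by (rule J.subspace_add[OF lie_moduleD(2)[OF J(1)] that])
  qed
  have J_act: "mact J X u \<in> mcarrier J" if "X \<in> lie_carrier ham" "u \<in> mcarrier J" for X u
    using lie_moduleD(3)[OF J(1) that(1)] that(2) unfolding endo_on_def by blast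
  have "?G (u + v) = ?G u + ?G v" if "u \<in> mcarrier K" "v \<in> mcarrier K" for u v
    using GF[OF J_add[OF G(1)[OF that(1)] G(1)[OF that(2)]]] by (simp add: add G that)
  moreover have "?G (ascale K p v) = ascale J p (?G v)" if "v \<in> mcarrier K" for p v
    using GF[OF J(2)[OF G(1)[OF that]]] by (simp add: asc G that)
  moreover have "?G (mact K X v) = mact J X (?G v)" if "X \<in> lie_carrier ham" "v \<in> mcarrier K" for X v
    using GF[OF J_act[OF that(1) G(1)[OF that(2)]]] by (simp add: act G that)
  ultimately show ?thesis
    unfolding isomorphic_ah_modules_def using bij_betw_inv_into[OF bij] by blast
qed

text \<open>A map intertwining the operators \<open>Dop\<close> respects their odd parts, which
  gives \<mu> = \<nu>, and their even parts, hence the action of the rank one matrices and of their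
  span sp_N.\<close>

lemma isomorphic_sp_a_iff:
  assumes V: "irreducible_sp_a_module V B" and W: "irreducible_sp_a_module W B'"
    and \<mu>: "acts_by_scalars V \<mu>" and \<nu>: "acts_by_scalars W \<nu>"
  shows "isomorphic_lie_modules sp_a V W \<longleftrightarrow>
    (\<exists>f. intertwines (mscale V) (mcarrier V) (sp_a_module.Dop V \<mu>) (mscale W) (mcarrier W) (sp_a_module.Dop W \<nu>) f)"
proof -
  interpret V: irreducible_sp_a_module V B by fact
  interpret W: irreducible_sp_a_module W B' by fact
  obtain v0 where v0: "v0 \<in> mcarrier V" "v0 \<noteq> 0" using V.nonzero V.U_closed(1) by blast
  show ?thesis
  proof
    assume "isomorphic_lie_modules sp_a V W"
    then obtain f where bij: "bij_betw f (mcarrier V) (mcarrier W)"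
      and add: "\<And>u v. u \<in> mcarrier V \<Longrightarrow> v \<in> mcarrier V \<Longrightarrow> f (u + v) = f u + f v"
      and scale: "\<And>c v. v \<in> mcarrier V \<Longrightarrow> f (mscale V c v) = mscale W c (f v)"
      and act: "\<And>x v. x \<in> lie_carrier sp_a \<Longrightarrow> v \<in> mcarrier V \<Longrightarrow> f (mact V x v) = mact W x (f v)"
      unfolding isomorphic_lie_modules_def by blast
    have fW: "f v \<in> mcarrier W" if "v \<in> mcarrier V" for v using bij that by (auto simp: bij_betw_def)
    have f0: "f 0 = 0" using scale[of 0 0] by simp
    have "f v0 \<noteq> 0"
    proof
      assume "f v0 = 0"
      then have "f v0 = f 0" by (simp add: f0)
      then show False using bij v0 V.U_closed(1) by (metis bij_betw_def inj_onD)
    qed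
    have "\<mu> = \<nu>"
    proof -
      have "mscale W (\<mu> $ a) (f v0) = mscale W (\<nu> $ a) (f v0)" for a
      proof -
        have "f (mact V (0, C a) v0) = mact W (0, C a) (f v0)"
          using act[of "(0, C a)" v0] v0 by (simp add: sp_a_simps sp_closed)
        then show ?thesis using \<mu> \<nu> v0 fW by (simp add: acts_by_scalars_def scale)
      qed
      then show ?thesis using \<open>f v0 \<noteq> 0\<close> by (simp add: vec_eq_iff)
    qed
    have "f (V.Dop \<mu> r v) = W.Dop \<nu> r (f v)" if v: "v \<in> mcarrier V" for r v
    proof -
      have R: "(rank1 r, 0) \<in> lie_carrier sp_a" using rank1_in_sp by (simp add: sp_a_simps)
      have "mact V (rank1 r, 0) v \<in> mcarrier V" using V.endoD(1)[OF V.endo_act[OF rank1_in_sp] v] .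
      then show ?thesis using act[OF R v] v by (simp add: V.Dop_def W.Dop_def add scale \<open>\<mu> = \<nu>\<close>)
    qed
    then show "\<exists>f. intertwines (mscale V) (mcarrier V) (V.Dop \<mu>) (mscale W) (mcarrier W) (W.Dop \<nu>) f"
      unfolding intertwines_def using bij add scale by blast
  next
    assume "\<exists>f. intertwines (mscale V) (mcarrier V) (V.Dop \<mu>) (mscale W) (mcarrier W) (W.Dop \<nu>) f"
    then obtain f where bij: "bij_betw f (mcarrier V) (mcarrier W)"
      and add: "\<And>u v. u \<in> mcarrier V \<Longrightarrow> v \<in> mcarrier V \<Longrightarrow> f (u + v) = f u + f v"
      and scale: "\<And>c v. v \<in> mcarrier V \<Longrightarrow> f (mscale V c v) = mscale W c (f v)"
      and D: "\<And>r v. v \<in> mcarrier V \<Longrightarrow> f (V.Dop \<mu> r v) = W.Dop \<nu> r (f v)"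
      unfolding intertwines_def by blast
    have fW: "f v \<in> mcarrier W" if "v \<in> mcarrier V" for v using bij that by (auto simp: bij_betw_def)
    have f0: "f 0 = 0" using scale[of 0 0] by simp
    have fv0: "f v0 \<noteq> 0"
    proof
      assume "f v0 = 0"
      then have "f v0 = f 0" by (simp add: f0)
      then show False using bij v0 V.U_closed(1) by (metis bij_betw_def inj_onD)
    qed
    note DV = V.endoD(1)[OF V.endo_Dop]
    have f_diff: "f (u - v) = f u - f v" if "u \<in> mcarrier V" "v \<in> mcarrier V" for u v
      using add[of "u - v" v] that by (simp add: algebra_simps)
    have "\<mu> = \<nu>"
    proof (rule ell_inject)
      fix r :: "'a lattice"
      have "f (V.Dop \<mu> r v0 - V.Dop \<mu> (- r) v0) = W.Dop \<nu> r (f v0) - W.Dop \<nu> (- r) (f v0)"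
        using v0 by (simp add: f_diff DV D)
      then have "mscale W (2 * ell \<mu> r) (f v0) = mscale W (2 * ell \<nu> r) (f v0)"
        using v0 fW by (simp add: V.Dop_odd W.Dop_odd scale)
      then show "ell \<mu> r = ell \<nu> r" using fv0 by simp
    qed
    have phi_gen: "f (mact V (rank1 r, 0) v) = mact W (rank1 r, 0) (f v)" if v: "v \<in> mcarrier V" for r v
    proof -
      have p: "mact V (rank1 r, 0) v \<in> mcarrier V" using V.endoD(1)[OF V.endo_act[OF rank1_in_sp] v] .
      have "f (V.Dop \<mu> r v + V.Dop \<mu> (- r) v) = W.Dop \<nu> r (f v) + W.Dop \<nu> (- r) (f v)"
        using v by (simp add: add DV D)
      then have "mscale W 2 (f (mact V (rank1 r, 0) v)) = mscale W 2 (mact W (rank1 r, 0) (f v))"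
        using v fW p by (simp add: V.Dop_even W.Dop_even scale)
      then show ?thesis by simp
    qed
    have phi: "f (mact V (M, 0) v) = mact W (M, 0) (f v)" if M: "M \<in> lie_carrier sp" and v: "v \<in> mcarrier V" for M v
    proof -
      have "M \<in> mat.span (range rank1)" using M by (simp add: sp_carrier_rank1)
      then have "M \<in> lie_carrier sp \<and> f (mact V (M, 0) v) = mact W (M, 0) (f v)"
      proof (induction rule: mat.span_induct_alt)
        case base
        then show ?case using v fW by (simp add: sp_closed V.phi_0 W.phi_0 f0)
      next
        case (step c x y)
        then obtain r where x: "x = rank1 r" by blast
        have y: "y \<in> lie_carrier sp" "f (mact V (y, 0) v) = mact W (y, 0) (f v)" using step(2) by auto
        have m: "mact V (rank1 r, 0) v \<in> mcarrier V" "mact V (y, 0) v \<in> mcarrier V"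
          using V.endoD(1)[OF V.endo_act[OF rank1_in_sp] v] V.endoD(1)[OF V.endo_act[OF y(1)] v] by auto
        show ?case
          using y v fW m
          by (simp add: x V.phi_add W.phi_add V.phi_scale W.phi_scale rank1_in_sp sp_closed add scale phi_gen)
      qed
      then show ?thesis ..
    qed
    have "f (mact V x v) = mact W x (f v)" if x: "x \<in> lie_carrier sp_a" and v: "v \<in> mcarrier V" for x v
    proof -
      obtain M y where xy: "x = (M, y)" by (cases x)
      have M: "M \<in> lie_carrier sp" using x xy by (simp add: sp_a_simps)
      have m: "mact V (M, 0) v \<in> mcarrier V" using V.endoD(1)[OF V.endo_act[OF M] v] .
      have "f (mact V (M, 0) v + mact V (0, y) v) = mact W (M, 0) (f v) + mact W (0, y) (f v)"
        using v m fW by (simp add: V.act_abelian[OF \<mu>] W.act_abelian[OF \<nu>] add scale phi[OF M] \<open>\<mu> = \<nu>\<close>)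
      then show ?thesis
        unfolding xy by (metis V.act_split[OF M v] W.act_split[OF M fW[OF v]])
    qed
    then show "isomorphic_lie_modules sp_a V W"
      unfolding isomorphic_lie_modules_def using bij add scale by blast
  qed
qed

section \<open>From weight spaces to modules over \<open>sp\<^sub>N \<oplus> a\<^sub>N\<close>\<close>

lemma additive_expand:
  assumes "vector_space sc" and add: "\<And>x y. f (x + y) = f x + f (y :: int ^ 'n::finite)"
  shows "f r = (\<Sum>a\<in>UNIV. sc (of_int (r $ a) :: complex) (f (unit_vec a)))"
proof -
  interpret vector_space sc by fact
  have f0: "f 0 = 0" using add[of 0 0] by simp
  show ?thesis
  proof (induction r rule: lattice_induct)
    case 1 then show ?case by (simp add: f0)
  next
    case (2 x y) then show ?case by (simp add: add scale_left_distrib sum.distrib)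
  next
    case (3 x)
    have "f (- x) = - f x" using add[of x "- x"] f0 by (simp add: eq_neg_iff_add_eq_0 add.commute)
    then show ?case using 3 by (simp add: sum_negf)
  next
    case (4 a)
    have "(\<Sum>b\<in>UNIV. sc (of_int (unit_vec a $ b)) (f (unit_vec b))) =
        (\<Sum>b\<in>UNIV. if b = a then f (unit_vec b) else 0)"
      by (intro sum.cong) (auto simp: unit_vec_nth)
    then show ?case by simp
  qed
qed

text \<open>
  Conversely to \<open>Dop\<close>: the even part of \<open>D\<close> is a quadratic form in \<open>r\<close> whose polarization defines the
  action of \<open>sp\<^sub>N\<close>, and the odd part is a linear form giving the scalars of \<open>a\<^sub>N\<close>.
\<close>

locale quadratic_lattice_rep = lattice_rep sc U B D
  for sc :: "complex \<Rightarrow> 'v::ab_group_add \<Rightarrow> 'v" and U B and D :: "'m::{finite,linorder} lattice \<Rightarrow> 'v \<Rightarrow> 'v" +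
  fixes \<mu> :: "complex ^ 'm index"
  assumes D_0: "u \<in> U \<Longrightarrow> D 0 u = 0" and U_nonzero: "U \<noteq> {0}"
    and odd_part: "u \<in> U \<Longrightarrow> D r u - D (- r) u = sc (2 * ell \<mu> r) u"
    and degree: "u \<in> U \<Longrightarrow> pdeg 3 (\<lambda>s. D s u)"
    and irr: "subspace W \<Longrightarrow> W \<subseteq> U \<Longrightarrow> (\<And>r w. w \<in> W \<Longrightarrow> D r w \<in> W) \<Longrightarrow> W = {0} \<or> W = U"
begin

definition polar :: "'m lattice \<Rightarrow> 'm lattice \<Rightarrow> 'v \<Rightarrow> 'v" where
  "polar r s u = D (r + s) u - D r u - D s u"

lemma polar_sym: "polar r s u = polar s r u"
  by (simp add: polar_def add.commute)

text \<open>The second difference of a function of degree at most two is biadditive.\<close>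

lemma polar_add: "u \<in> U \<Longrightarrow> polar (r + r') s u = polar r s u + polar r' s u"
proof -
  assume u: "u \<in> U"
  have eq: "polar r s u = dl r (dl s (\<lambda>s. D s u)) 0" for r s
    using D_0[OF u] by (simp add: polar_def dl_def)
  show ?thesis unfolding eq using degree[OF u]
    by (intro dl_affine_add) (simp add: numeral_3_eq_3 numeral_2_eq_2)
qed

lemma endo_polar: "endo (polar r s)"
  unfolding polar_def by (intro endo_diff endo_D)

lemma polar_diag: "u \<in> U \<Longrightarrow> polar r r u = D r u + D (- r) u"
proof -
  assume u: "u \<in> U"
  have "polar (r + - r) r u = 0" using D_0[OF u] by (simp add: polar_def)
  then have "polar r r u + polar (- r) r u = 0" unfolding polar_add[OF u] .
  then have "polar r r u - D (- r) u - D r u = 0"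
    using D_0[OF u] by (simp add: polar_def algebra_simps)
  then show ?thesis by (simp add: algebra_simps)
qed

lemma polar_expand:
  assumes u: "u \<in> U"
  shows "polar r s u = (\<Sum>a\<in>UNIV. \<Sum>b\<in>UNIV. sc (of_int (r $ a) * of_int (s $ b)) (polar (unit_vec a) (unit_vec b) u))"
proof -
  have "polar r s u = (\<Sum>a\<in>UNIV. sc (of_int (r $ a)) (polar (unit_vec a) s u))" for s
    by (rule additive_expand[OF vector_space_axioms]) (rule polar_add[OF u])
  moreover have "polar (unit_vec a) s u = (\<Sum>b\<in>UNIV. sc (of_int (s $ b)) (polar (unit_vec a) (unit_vec b) u))" for a
    by (rule additive_expand[OF vector_space_axioms]) (simp add: polar_sym[of "unit_vec a"] polar_add[OF u])
  ultimately show ?thesis by (simp add: scale_sum_right)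
qed

text \<open>Defined on every matrix through its entries, so that linearity is immediate; prescribing
  values on the linearly dependent matrices \<open>rank1 r\<close> would raise a question of
  consistency. The sign and the factor 1/2 make \<open>phi (rank1 r)\<close> the even part of
  \<open>D r\<close>.\<close>

definition phi :: "complex ^ 'm index ^ 'm index \<Rightarrow> 'v \<Rightarrow> 'v" where
  "phi M u = (\<Sum>a\<in>UNIV. \<Sum>b\<in>UNIV.
     sc (of_int (index_sign b) * M $ a $ swap_index b / 2) (polar (unit_vec a) (unit_vec b) u))"

lemma phi_add: "phi (M + M') u = phi M u + phi M' u"
  by (simp add: phi_def distrib_left add_divide_distrib scale_left_distrib sum.distrib)

lemma phi_scale: "phi (mat_scale c M) u = sc c (phi M u)"
  by (simp add: phi_def scale_sum_right mult.left_commute)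

lemma phi_0: "phi 0 u = 0"
  by (simp add: phi_def)

lemma endo_phi: "endo (phi M)"
proof -
  note e = endoD[OF endo_polar]
  show ?thesis
    unfolding endo_on_def phi_def
    by (auto intro!: U_sum simp: e scale_right_distrib sum.distrib scale_sum_right mult.commute)
qed

lemma phi_rank1: "u \<in> U \<Longrightarrow> phi (rank1 r) u = sc (1 / 2) (D r u + D (- r) u)"
proof -
  assume u: "u \<in> U"
  have s: "(of_int (index_sign b) :: complex) * (x * of_int (- index_sign (swap_index b) * y)) = x * of_int y"
    for b :: "'m index" and x :: complex and y by (cases b) auto
  have "phi (rank1 r) u = (\<Sum>a\<in>UNIV. \<Sum>b\<in>UNIV. sc (of_int (r $ a) * of_int (r $ b) / 2) (polar (unit_vec a) (unit_vec b) u))"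
    unfolding phi_def rank1_nth swap_swap_index s ..
  also have "\<dots> = sc (1 / 2) (polar r r u)"
    unfolding polar_expand[OF u, of r r] by (simp add: scale_sum_right)
  finally show ?thesis using polar_diag[OF u] by simp
qed

lemma D_decompose: "u \<in> U \<Longrightarrow> D r u = sc (ell \<mu> r) u + phi (rank1 r) u"
proof -
  assume u: "u \<in> U"
  have "sc (ell \<mu> r) u = sc (1 / 2) (D r u - D (- r) u)" using odd_part[OF u, of r] by simp
  then have "sc (ell \<mu> r) u + phi (rank1 r) u = sc (1 / 2) (D r u + D r u)"
    unfolding phi_rank1[OF u] by (simp only: scale_right_distrib[symmetric]) simp
  also have "\<dots> = D r u" unfolding scale_right_distrib scale_left_distrib[symmetric] by simp
  finally show ?thesis ..
qed

lemma phi_rank1_eq: "u \<in> U \<Longrightarrow> phi (rank1 r) u = D r u - sc (ell \<mu> r) u"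
  using D_decompose by simp

lemma phi_diff: "phi (M - M') u = phi M u - phi M' u"
  using phi_add[of "M - M'" M' u] by simp

lemma phi_bracket_rank1:
  assumes u: "u \<in> U"
  shows "phi (rank1 r ** rank1 s - rank1 s ** rank1 r) u =
    phi (rank1 r) (phi (rank1 s) u) - phi (rank1 s) (phi (rank1 r) u)"
proof -
  note e = endoD[OF endo_D]
  have "phi (rank1 r) (phi (rank1 s) u) - phi (rank1 s) (phi (rank1 r) u) = D r (D s u) - D s (D r u)"
    using u by (simp add: phi_rank1_eq e scale_right_diff_distrib mult.commute algebra_simps)
  also have "\<dots> = sc (of_int (om r s)) (D (r + s) u - D r u - D s u)"
    using D_rel[OF u] by (simp add: skew_rel_def)
  also have "D (r + s) u - D r u - D s u = phi (rank1 (r + s)) u - phi (rank1 r) u - phi (rank1 s) u"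
    using u by (simp add: phi_rank1_eq ell_add scale_left_distrib)
  also have "sc (of_int (om r s)) \<dots> = phi (rank1 r ** rank1 s - rank1 s ** rank1 r) u"
    by (simp add: rank1_bracket phi_scale phi_diff)
  finally show ?thesis ..
qed

text \<open>Both sides are bilinear in the matrices, so the identity for rank one matrices extends
  to their span.\<close>

lemma phi_bracket:
  assumes M: "M \<in> lie_carrier sp" and M': "M' \<in> lie_carrier sp" and u: "u \<in> U"
  shows "phi (M ** M' - M' ** M) u = phi M (phi M' u) - phi M' (phi M u)"
proof -
  note e = endoD[OF endo_phi]
  have mm: "mat_scale c X ** Y = mat_scale c (X ** Y)" "Y ** mat_scale c X = mat_scale c (Y ** X)"
    for c and X Y :: "complex ^ 'm index ^ 'm index"
    by (simp_all add: vec_eq_iff matrix_matrix_mult_def sum_distrib_left mult.assoc mult.left_commute)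
  have ma: "(X + Y) ** Z = X ** Z + Y ** Z" "Z ** (X + Y) = Z ** X + Z ** Y"
    for X Y Z :: "complex ^ 'm index ^ 'm index"
    by (simp_all add: vec_eq_iff matrix_matrix_mult_def distrib_left distrib_right sum.distrib)
  have br_step: "phi ((mat_scale c X + Y) ** Z - Z ** (mat_scale c X + Y)) u =
      phi (mat_scale c X + Y) (phi Z u) - phi Z (phi (mat_scale c X + Y) u)"
    if "phi (X ** Z - Z ** X) u = phi X (phi Z u) - phi Z (phi X u)"
      "phi (Y ** Z - Z ** Y) u = phi Y (phi Z u) - phi Z (phi Y u)" for c X Y Z
  proof -
    have "(mat_scale c X + Y) ** Z - Z ** (mat_scale c X + Y) =
        mat_scale c (X ** Z - Z ** X) + (Y ** Z - Z ** Y)"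
      by (simp add: ma mm mat.scale_right_diff_distrib)
    then show ?thesis using that u by (simp add: phi_add phi_scale e scale_right_diff_distrib)
  qed
  have swap: "phi (X ** Z - Z ** X) u = phi X (phi Z u) - phi Z (phi X u)"
    if "phi (Z ** X - X ** Z) u = phi Z (phi X u) - phi X (phi Z u)" for X Z
  proof -
    have "phi (X ** Z - Z ** X) u = - phi (Z ** X - X ** Z) u" by (simp add: phi_diff)
    then show ?thesis using that by simp
  qed
  have br_base: "phi (0 ** Z - Z ** 0) u = phi 0 (phi Z u) - phi Z (phi 0 u)" for Z
    by (simp add: phi_0 e(4) matrix_matrix_mult_def flip: zero_vec_def)
  have gen: "phi (rank1 r ** M' - M' ** rank1 r) u = phi (rank1 r) (phi M' u) - phi M' (phi (rank1 r) u)" for r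
  proof -
    have "M' \<in> mat.span (range rank1)" using M' by (simp add: sp_carrier_rank1)
    then have "phi (M' ** rank1 r - rank1 r ** M') u = phi M' (phi (rank1 r) u) - phi (rank1 r) (phi M' u)"
    proof (induction rule: mat.span_induct_alt)
      case base show ?case by (rule br_base)
    next
      case (step c x y)
      then show ?case using phi_bracket_rank1[OF u]
        by (intro br_step) auto
    qed
    then show ?thesis by (rule swap)
  qed
  have "M \<in> mat.span (range rank1)" using M by (simp add: sp_carrier_rank1)
  then show ?thesis
  proof (induction rule: mat.span_induct_alt)
    case base show ?case by (rule br_base)
  next
    case (step c x y)
    then show ?case using gen
      by (intro br_step) auto
  qed
qed

definition V :: "('m spa, 'v) lie_mod" where
  "V = \<lparr> mcarrier = U, mscale = sc, mact = (\<lambda>(M, x) u. phi M u + sc (\<Sum>a\<in>UNIV. x $ a * \<mu> $ a) u) \<rparr>"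

lemma V_simps: "mcarrier V = U" "mscale V = sc"
  "mact V (M, x) u = phi M u + sc (\<Sum>a\<in>UNIV. x $ a * \<mu> $ a) u" "mact V (M, 0) u = phi M u"
  by (simp_all add: V_def)

lemma lie_module_V: "lie_module sp_a V"
proof (rule lie_moduleI)
  note e = endoD[OF endo_phi]
  show "vector_space (mscale V)" "module.subspace (mscale V) (mcarrier V)"
    unfolding V_simps by (rule vector_space_axioms, rule subspace_U)
  fix x y :: "'m spa" and v c
  obtain M p M' p' where xy: "x = (M, p)" "y = (M', p')" by (cases x; cases y)
  assume "x \<in> lie_carrier sp_a"
  then have M: "M \<in> lie_carrier sp" by (simp add: xy sp_a_simps)
  have "endo (sc k)" for k unfolding endo_on_def by (auto simp: scale_right_distrib mult.commute)
  then have "endo (\<lambda>u. phi M u + sc k u)" for k using endo_phi by (rule endo_add[rotated])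
  then show "endo_on (mscale V) (mcarrier V) (mact V x)" by (simp add: V_def xy)
  show "mact V (lie_scale sp_a c x) v = mscale V c (mact V x v)"
    by (simp add: xy sp_a_simps V_simps phi_scale scale_right_distrib sum_distrib_left mult.assoc)
  assume "y \<in> lie_carrier sp_a" and "v \<in> mcarrier V"
  then have M': "M' \<in> lie_carrier sp" and v: "v \<in> U" by (simp_all add: xy sp_a_simps V_simps)
  show "mact V (x + y) v = mact V x v + mact V y v"
    by (simp add: xy V_simps phi_add distrib_right sum.distrib scale_left_distrib algebra_simps)
  show "mact V (lie_bracket sp_a x y) v = mact V x (mact V y v) - mact V y (mact V x v)"
    using v by (simp add: xy sp_a_simps V_simps phi_bracket[OF M M' v] e scale_right_distrib mult.commute algebra_simps)
qed

lemma irreducible_V: "irreducible_lie_module sp_a V"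
  unfolding irreducible_lie_module_def
proof (intro conjI allI impI lie_module_V)
  show "mcarrier V \<noteq> {0}" using U_nonzero by (simp add: V_simps)
  fix W assume W: "W \<subseteq> mcarrier V \<and> module.subspace (mscale V) W \<and>
    (\<forall>x\<in>lie_carrier sp_a. \<forall>w\<in>W. mact V x w \<in> W)"
  have "W = {0} \<or> W = U"
  proof (rule irr)
    show sub: "subspace W" and WU: "W \<subseteq> U" using W by (auto simp: V_simps)
    show "D r w \<in> W" if w: "w \<in> W" for r w
    proof -
      have "(rank1 r, 0) \<in> lie_carrier sp_a" using rank1_in_sp by (simp add: sp_a_simps)
      then have "mact V (rank1 r, 0) w \<in> W" using W w by blast
      then show ?thesis
        using D_decompose[of w r] w WU sub by (simp add: V_simps subset_iff subspace_add subspace_scale)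
    qed
  qed
  then show "W = {0} \<or> W = mcarrier V" by (simp add: V_simps)
qed

lemma finite_dimensional_V: "finite_dimensional V"
  using basis_exists' unfolding finite_dimensional_def V_simps by metis

lemma acts_by_scalars_V: "acts_by_scalars V \<mu>"
  unfolding acts_by_scalars_def
  by (auto simp: V_simps phi_0 C_def axis_def if_distrib[of "\<lambda>x. x * _"] cong: if_cong)

lemma tensor_module_V:
  assumes "tensor_like lam sc U D K"
  shows "tensor_module lam \<mu> V K"
proof -
  obtain E where E: "finite E" "span E = U" using basis_exists' by metis
  interpret V: sp_a_module V E
    by unfold_locales (use lie_module_V E in \<open>auto simp: V_simps\<close>)
  have "V.Dop \<mu> r u = D r u" if "u \<in> U" for r u
    using D_decompose[OF that] by (simp add: V.Dop_def V_simps)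
  then have "tensor_like lam sc U (V.Dop \<mu>) K"
    using assms unfolding tensor_like_def by (simp add: tensor_carrierD)
  then show ?thesis unfolding V.tensor_module_iff by (simp add: V_simps)
qed

end

section \<open>Modules in category \<open>J\<close>\<close>

text \<open>Group the expansion in an eigenbasis by eigenvalue.\<close>

lemma eigenvector_decomposition:
  assumes diag: "diagonalizable_on sc V T" and "vector_space sc" and T: "endo_on sc V T" and v: "v \<in> V"
  shows "\<exists>F w. finite F \<and> (\<forall>c\<in>F. w c \<in> V \<and> T (w c) = sc c (w c)) \<and> v = (\<Sum>c\<in>F. w c)"
proof -
  interpret vector_space sc by fact
  obtain B where B: "span B = V" "\<forall>b\<in>B. \<exists>c. T b = sc c b"
    using diag unfolding diagonalizable_on_def by blast
  obtain ev where ev: "\<And>b. b \<in> B \<Longrightarrow> T b = sc (ev b) b" using B(2) by metis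
  obtain t r where t: "finite t" "t \<subseteq> B" "v = (\<Sum>b\<in>t. sc (r b) b)"
    using v unfolding B(1)[symmetric] span_explicit by blast
  let ?w = "\<lambda>c. \<Sum>b\<in>{b \<in> t. ev b = c}. sc (r b) b"
  have BV: "b \<in> V" if "b \<in> B" for b using span_base[OF that] B(1) by simp
  have sV: "subspace V" using B(1) subspace_span by blast
  have wV: "(\<Sum>b\<in>A. sc (r b) b) \<in> V" if "A \<subseteq> t" for A
    using that t(2) BV by (intro subspace_sum[OF sV] subspace_scale[OF sV]) blast
  have Tsum: "T (\<Sum>b\<in>A. sc (r b) b) = sc c (\<Sum>b\<in>A. sc (r b) b)" if "finite A" "A \<subseteq> t" "\<forall>b\<in>A. ev b = c" for A c
    using that
  proof (induction A rule: finite_induct)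
    case empty
    have "T (sc 0 0) = sc 0 (T 0)" using T subspace_0[OF sV] unfolding endo_on_def by blast
    then show ?case by simp
  next
    case (insert b A)
    have b: "b \<in> B" "b \<in> V" using insert.prems t(2) BV by auto
    then have "T (sc (r b) b) = sc c (sc (r b) b)"
      using T ev[OF b(1)] insert.prems unfolding endo_on_def by (simp add: mult.commute)
    moreover have "T (sc (r b) b + (\<Sum>b\<in>A. sc (r b) b)) = T (sc (r b) b) + T (\<Sum>b\<in>A. sc (r b) b)"
      using T b wV[of A] insert.prems subspace_scale[OF sV] unfolding endo_on_def by blast
    ultimately show ?case using insert by (simp add: scale_right_distrib)
  qed
  have sum: "v = (\<Sum>c\<in>ev ` t. ?w c)" unfolding t(3) by (rule sum.image_gen[OF t(1)])
  have w: "?w c \<in> V \<and> T (?w c) = sc c (?w c)" for c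
    by (rule conjI[OF wV Tsum]) (use t(1) in auto)
  have fin: "finite (ev ` t)" using t(1) by simp
  show ?thesis
    by (rule exI[of _ "ev ` t"], rule exI[of _ ?w], rule conjI[OF fin conjI[OF ballI[OF w] sum]])
qed

lemma h_zero: "h 0 = (hscale 0 (d a) :: 'm::finite laurent \<Rightarrow> 'm laurent)"
  by (auto intro!: poly_mapping_eqI simp: fun_eq_iff lookup_h om_linear)

lemma h_tpow': "h r (tpow s) = const (of_int (om r s)) * tpow (r + s)"
  by (rule poly_mapping_eqI) (auto simp: lookup_h lookup_ops lookup_tpow om_linear algebra_simps)

locale irreducible_in_J =
  fixes lam :: "complex ^ 'm::finite index" and J :: "('m, 'v::ab_group_add) ah_mod"
  assumes J_at: "category_J_at lam J" and irr_J: "irreducible_ah_module J"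
begin

abbreviation "A \<equiv> ascale J"
abbreviation "ms \<equiv> mscale J"
abbreviation "act \<equiv> mact J"
abbreviation "car \<equiv> mcarrier J"

lemma J: "category_J J"
  using J_at by (simp add: category_J_at_def)

lemma lie_module_J: "lie_module ham J" and module_A: "module A" and ms_A: "ms c v = A (const c) v"
  and diag: "diagonalizable_on ms car (act (d i))"
  and leibniz: "X \<in> lie_carrier ham \<Longrightarrow> v \<in> car \<Longrightarrow> act X (A f v) = A (X f) v + A f (act X v)"
  using J unfolding category_J_def by blast+

lemma vs: "vector_space ms"
  using lie_moduleD(1)[OF lie_module_J] .

end

sublocale irreducible_in_J \<subseteq> A: module A
  by (rule module_A)

sublocale irreducible_in_J \<subseteq> M: complex_space ms
  using vs by (simp add: complex_space_def)

context irreducible_in_J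
begin

lemma sub_A: "A.subspace car"
  using J unfolding category_J_def by blast

lemma sub_M: "M.subspace car"
  using lie_moduleD(2)[OF lie_module_J] .

lemma endo_act: "X \<in> lie_carrier ham \<Longrightarrow> endo_on ms car (act X)"
  using lie_moduleD(3)[OF lie_module_J] .

lemma act_car: "X \<in> lie_carrier ham \<Longrightarrow> v \<in> car \<Longrightarrow> act X v \<in> car"
  and act_add: "X \<in> lie_carrier ham \<Longrightarrow> u \<in> car \<Longrightarrow> v \<in> car \<Longrightarrow> act X (u + v) = act X u + act X v"
  and act_scale: "X \<in> lie_carrier ham \<Longrightarrow> v \<in> car \<Longrightarrow> act X (ms c v) = ms c (act X v)"
  using endo_act unfolding endo_on_def by blast+

lemma tpow_tpow: "A (tpow r) (A (tpow s) v) = A (tpow (r + s)) v"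
  by (simp add: tpow_def mult_single)

lemma tpow_0: "A (tpow 0) v = v"
  by (simp add: tpow_def)

lemma A_ms: "A f (ms c v) = ms c (A f v)"
  by (simp add: ms_A mult.commute)

lemma ms_mult: "A (const c * f) v = ms c (A f v)" "A (f * const c) v = ms c (A f v)"
  by (simp_all add: ms_A mult.commute)

definition wt :: "'m lattice \<Rightarrow> 'v set" where
  "wt r = {v \<in> car. \<forall>i. act (d i) v = ms (of_int (r $ i) + lam $ i) v}"

lemma wtD: "v \<in> wt r \<Longrightarrow> v \<in> car" "v \<in> wt r \<Longrightarrow> act (d i) v = ms (of_int (r $ i) + lam $ i) v"
  by (simp_all add: wt_def)

lemma A_car: "v \<in> car \<Longrightarrow> A f v \<in> car"
  by (rule A.subspace_scale[OF sub_A])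

lemma tpow_wt: "v \<in> wt r \<Longrightarrow> A (tpow s) v \<in> wt (s + r)"
  unfolding wt_def
  by (auto simp: A_car leibniz[OF ham_closed(1)] d_tpow ms_mult A_ms M.scale_left_distrib algebra_simps)

lemma h_wt: "v \<in> wt r \<Longrightarrow> act (h s) v \<in> wt (s + r)"
proof -
  assume v: "v \<in> wt r"
  note vc = wtD(1)[OF v]
  have "act (d i) (act (h s) v) = ms (of_int ((s + r) $ i) + lam $ i) (act (h s) v)" for i
  proof -
    have "act (lie_bracket ham (d i) (h s)) v = ms (of_int (s $ i)) (act (h s) v)"
      unfolding ham_brackets ham_simps(2)[symmetric] by (rule lie_moduleD(5)[OF lie_module_J ham_closed(2) vc])
    then have "act (d i) (act (h s) v) = ms (of_int (s $ i)) (act (h s) v) + act (h s) (act (d i) v)"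
      unfolding lie_moduleD(6)[OF lie_module_J ham_closed(1,2) vc] by (simp add: algebra_simps)
    also have "\<dots> = ms (of_int ((s + r) $ i) + lam $ i) (act (h s) v)"
      unfolding wtD(2)[OF v] act_scale[OF ham_closed(2) vc] M.scale_left_distrib[symmetric] by (simp add: add.assoc)
    finally show ?thesis .
  qed
  then show ?thesis using act_car[OF ham_closed(2) vc] by (simp add: wt_def)
qed

definition U :: "'v set" where "U = wt 0"

definition D :: "'m lattice \<Rightarrow> 'v \<Rightarrow> 'v" where
  "D r u = A (tpow (- r)) (act (h r) u)"

lemma subspace_wt: "M.subspace (wt r)"
proof (rule M.subspaceI)
  have "act (d i) (ms 0 0) = ms 0 (act (d i) 0)" for i
    by (rule act_scale[OF ham_closed(1) M.subspace_0[OF sub_M]])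
  then show "0 \<in> wt r" using M.subspace_0[OF sub_M] by (simp add: wt_def)
qed (auto simp: wt_def act_add act_scale ham_closed M.subspace_add[OF sub_M] M.subspace_scale[OF sub_M]
    M.scale_right_distrib mult.commute)

lemma U_car: "u \<in> U \<Longrightarrow> u \<in> car"
  by (simp add: U_def wtD)

lemma endo_D: "endo_on ms U (D r)"
  unfolding endo_on_def
proof (intro conjI ballI allI)
  show "D r u \<in> U" if "u \<in> U" for u
    using tpow_wt[OF h_wt[of u 0 r], of "- r"] that by (simp add: D_def U_def)
qed (simp_all add: D_def act_add act_scale ham_closed U_car A.scale_right_distrib A_ms)

lemma act_h_U: "u \<in> U \<Longrightarrow> act (h r) u = A (tpow r) (D r u)"
  by (simp only: D_def tpow_tpow) (simp add: tpow_0)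

lemma D_U: "u \<in> U \<Longrightarrow> D r u \<in> U"
  using endo_D unfolding endo_on_def by blast

lemma act_h_tpow: "u \<in> U \<Longrightarrow> act (h r) (A (tpow s) u) = A (tpow (r + s)) (ms (of_int (om r s)) u + D r u)"
  by (simp add: leibniz[OF ham_closed(2) U_car] h_tpow' ms_mult act_h_U A.scale_right_distrib A_ms
      tpow_tpow add.commute del: A.scale_scale)

lemma act_d_tpow: "u \<in> U \<Longrightarrow> act (d a) (A (tpow s) u) = A (tpow s) (ms (of_int (s $ a) + lam $ a) u)"
  using wtD(2)[of u 0 a]
  by (simp add: leibniz[OF ham_closed(1) U_car] d_tpow ms_mult A_ms U_def M.scale_left_distrib A.scale_right_distrib)

lemma D_0: "u \<in> U \<Longrightarrow> D 0 u = 0"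
  using lie_moduleD(5)[OF lie_module_J ham_closed(1) U_car, of u 0]
  by (simp add: D_def h_zero[of undefined] ham_simps(2) del: M.scale_eq_0_iff)

text \<open>Evaluate the bracket on \<open>u\<close> in two ways and cancel the invertible monomial
  t^(r+s). The terms with \<open>D s u\<close> and \<open>D r u\<close> come from the Leibniz
  rule.\<close>

lemma D_rel:
  assumes u: "u \<in> U"
  shows "D r (D s u) - D s (D r u) = ms (of_int (om r s)) (D (r + s) u - D r u - D s u)"
proof -
  let ?t = "tpow (r + s) :: 'm laurent"
  note uc = U_car[OF u]
  have "act (lie_bracket ham (h r) (h s)) u = ms (of_int (om r s)) (act (h (r + s)) u)"
    unfolding ham_brackets ham_simps(2)[symmetric] by (rule lie_moduleD(5)[OF lie_module_J ham_closed(2) uc])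
  also have "\<dots> = A ?t (ms (of_int (om r s)) (D (r + s) u))"
    by (simp add: act_h_U[OF u] A_ms)
  finally have L: "act (lie_bracket ham (h r) (h s)) u = A ?t (ms (of_int (om r s)) (D (r + s) u))" .
  have "act (lie_bracket ham (h r) (h s)) u =
      A ?t (ms (of_int (om r s)) (D s u) + D r (D s u)) - A (tpow (s + r)) (ms (of_int (om s r)) (D r u) + D s (D r u))"
    unfolding lie_moduleD(6)[OF lie_module_J ham_closed(2,2) uc] act_h_U[OF u] act_h_tpow[OF D_U[OF u]] ..
  also have "\<dots> = A ?t ((ms (of_int (om r s)) (D s u) + D r (D s u)) - (ms (of_int (om s r)) (D r u) + D s (D r u)))"
    by (simp only: add.commute[of s r] A.scale_right_diff_distrib)
  finally have "A (tpow (- (r + s))) (A ?t (ms (of_int (om r s)) (D (r + s) u))) =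
      A (tpow (- (r + s))) (A ?t ((ms (of_int (om r s)) (D s u) + D r (D s u)) - (ms (of_int (om s r)) (D r u) + D s (D r u))))"
    using L by simp
  then have "ms (of_int (om r s)) (D (r + s) u) =
      (ms (of_int (om r s)) (D s u) + D r (D s u)) - (ms (of_int (om s r)) (D r u) + D s (D r u))"
    unfolding tpow_tpow by (simp add: tpow_0)
  then show ?thesis by (simp add: om_commute[of s r] algebra_simps)
qed


section \<open>The multiplication map from A_N (x) U onto the module\<close>

definition Psi :: "('m lattice \<Rightarrow>\<^sub>0 'v) \<Rightarrow> 'v" where
  "Psi g = (\<Sum>s\<in>Poly_Mapping.keys g. A (tpow s) (lookup g s))"

lemma Psi_add: "Psi (f + g) = Psi f + Psi g"
  unfolding Psi_def by (rule setsum_keys_plus_distrib) (simp_all add: A.scale_right_distrib)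

lemma Psi_single: "Psi (single s v) = A (tpow s) v"
  by (simp add: Psi_def)

lemma Psi_ascale: "Psi (tensor_ascale ms f g) = A f (Psi g)"
proof (induction g rule: poly_mapping_additive_induct)
  case (1 u v)
  show ?case
  proof (induction f rule: poly_mapping_additive_induct)
    case (1 r c)
    have "A (single r c) (A (tpow u) v) = A (tpow (r + u)) (A (const c) v)"
      by (simp add: tpow_def const_def mult_single)
    then show ?case
      unfolding M.tensor_ascale_single_single Psi_single ms_A[of c v] ..
  next
    case (2 f f')
    then show ?case by (simp add: M.tensor_ascale_add_left Psi_add A.scale_left_distrib)
  qed
qed (simp add: M.tensor_ascale_add_right Psi_add A.scale_right_distrib)

lemma Psi_scale: "Psi (tensor_ascale ms (const c) g) = ms c (Psi g)"
  by (simp add: Psi_ascale ms_A)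

lemma Psi_car: "g \<in> tensor_carrier U \<Longrightarrow> Psi g \<in> car"
  unfolding Psi_def by (intro M.subspace_sum[OF sub_M]) (rule A_car, rule U_car, rule tensor_carrierD)

text \<open>The summands of \<open>Psi g\<close> have pairwise different weights, so each is zero,
  and monomials act invertibly.\<close>

lemma Psi_zero:
  assumes g: "g \<in> tensor_carrier U" and z: "Psi g = 0"
  shows "g = 0"
proof (rule poly_mapping_eqI)
  fix s
  show "lookup g s = lookup 0 s"
  proof (cases "s \<in> Poly_Mapping.keys g")
    case True
    have wtg: "A (tpow r) (lookup g r) \<in> wt r" for r
      using tpow_wt[of "lookup g r" 0 r] tensor_carrierD[OF g, of r] by (simp add: U_def)
    have "A (tpow s) (lookup g s) \<in> {0}"
    proof (rule weight_components_in_stable_subspace[OF vs M.subspace_single_0 sub_M, where T = "\<lambda>i. act (d i)"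
          and wt = "\<lambda>r i. of_int (r $ i) + lam $ i" and R = "Poly_Mapping.keys g" and w = "\<lambda>r. A (tpow r) (lookup g r)"])
      show "act (d i) v \<in> {0}" if "v \<in> {0}" for i v
        using that act_scale[OF ham_closed(1) M.subspace_0[OF sub_M], of i 0] by simp
      show "endo_on ms car (act (d i))" for i by (rule endo_act[OF ham_closed(1)])
      show "\<exists>i. of_int (r $ i) + lam $ i \<noteq> of_int (s $ i) + lam $ i" if "r \<noteq> s" for r s :: "'m lattice"
        using that by (auto simp: vec_eq_iff)
      show "A (tpow r) (lookup g r) \<in> car" for r using wtg wtD(1) by blast
      show "act (d i) (A (tpow r) (lookup g r)) = ms (of_int (r $ i) + lam $ i) (A (tpow r) (lookup g r))" for r i
        using wtg wtD(2) by blast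
      show "(\<Sum>r\<in>Poly_Mapping.keys g. A (tpow r) (lookup g r)) \<in> {0}" using z by (simp add: Psi_def)
    qed (use True in auto)
    then have "A (tpow (- s)) (A (tpow s) (lookup g s)) = 0" by simp
    then show ?thesis unfolding tpow_tpow by (simp add: tpow_0)
  qed (simp add: in_keys_iff)
qed

lemma Psi_inj: "f \<in> tensor_carrier U \<Longrightarrow> g \<in> tensor_carrier U \<Longrightarrow> Psi f = Psi g \<Longrightarrow> f = g"
proof -
  assume fg: "f \<in> tensor_carrier U" "g \<in> tensor_carrier U" "Psi f = Psi g"
  have "f - g \<in> tensor_carrier U"
    using fg(1,2) subspace_wt[of 0] by (simp add: tensor_carrier_def lookup_minus U_def M.subspace_diff)
  moreover have "Psi (f - g) = 0" using Psi_add[of "f - g" g] fg(3) by simp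
  ultimately have "f - g = 0" by (rule Psi_zero)
  then show ?thesis by simp
qed

text \<open>Simultaneous diagonalization, one operator at a time: the components of a joint
  eigenvector with respect to the next operator stay in its joint eigenspace because the operators
  commute.\<close>

lemma joint_eigenvectors:
  assumes "finite S"
  shows "car \<subseteq> M.span {w \<in> car. \<forall>i\<in>S. \<exists>c. act (d i) w = ms c w}"
  using assms
proof (induction S rule: finite_induct)
  case empty
  then show ?case by (auto intro: M.span_base)
next
  case (insert j S)
  let ?E = "\<lambda>S. {w \<in> car. \<forall>i\<in>S. \<exists>c. act (d i) w = ms c w}"
  have "w \<in> M.span (?E (insert j S))" if w: "w \<in> ?E S" for w
  proof -
    have wc: "w \<in> car" using w by blast
    have "\<exists>\<nu>. \<forall>i\<in>S. act (d i) w = ms (\<nu> i) w" using w by (intro bchoice) blast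
    then obtain \<nu> where \<nu>: "\<And>i. i \<in> S \<Longrightarrow> act (d i) w = ms (\<nu> i) w" by blast
    obtain F v where F: "finite F" "\<forall>c\<in>F. v c \<in> car \<and> act (d j) (v c) = ms c (v c)" "w = (\<Sum>c\<in>F. v c)"
      using eigenvector_decomposition[OF diag vs endo_act[OF ham_closed(1)] wc, of j] by blast
    let ?W = "{x \<in> car. \<forall>i\<in>S. act (d i) x = ms (\<nu> i) x}"
    have W: "M.subspace ?W"
    proof (rule M.subspaceI)
      have "act (d i) (ms 0 0) = ms 0 (act (d i) 0)" for i
        by (rule act_scale[OF ham_closed(1) M.subspace_0[OF sub_M]])
      then show "0 \<in> ?W" using M.subspace_0[OF sub_M] by simp
    qed (auto simp: act_add act_scale ham_closed M.subspace_add[OF sub_M] M.subspace_scale[OF sub_M]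
        M.scale_right_distrib mult.commute)
    have com: "act (d j) (act (d i) x) = act (d i) (act (d j) x)" if x: "x \<in> car" for i x
    proof -
      have "act (lie_bracket ham (d j) (d i)) x = ms 0 (act (d j) x)"
        unfolding ham_brackets ham_simps(2)[symmetric] by (rule lie_moduleD(5)[OF lie_module_J ham_closed(1) x])
      then show ?thesis using lie_moduleD(6)[OF lie_module_J ham_closed(1,1) x, of j i] by simp
    qed
    have "v q \<in> ?W" if q: "q \<in> F" for q
    \<comment> \<open>A single operator, whose eigenvalues serve as the weights.\<close>
    proof (rule weight_components_in_stable_subspace[OF vs W sub_M, where T = "\<lambda>_ :: unit. act (d j)"
          and wt = "\<lambda>c _. c" and R = F and w = v])
      show "act (d j) x \<in> ?W" if "x \<in> ?W" for x
      proof -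
        have x: "x \<in> car" "\<And>i. i \<in> S \<Longrightarrow> act (d i) x = ms (\<nu> i) x" using that by auto
        have "act (d i) (act (d j) x) = ms (\<nu> i) (act (d j) x)" if "i \<in> S" for i
          using com[OF x(1), of i] x(2)[OF that] act_scale[OF ham_closed(1) x(1)] by metis
        then show ?thesis using act_car[OF ham_closed(1) x(1)] by blast
      qed
      show "endo_on ms car (act (d j))" by (rule endo_act[OF ham_closed(1)])
      show "(\<Sum>r\<in>F. v r) \<in> ?W" using F(3) wc \<nu> by simp
    qed (use F q in auto)
    then have "v q \<in> ?E (insert j S)" if "q \<in> F" for q using that F(2) by blast
    then show ?thesis unfolding F(3) by (intro M.span_sum M.span_base)
  qed
  then have "M.span (?E S) \<subseteq> M.span (?E (insert j S))" by (intro M.span_minimal M.subspace_span) blast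
  then show ?case using insert.IH by blast
qed

text \<open>A nonzero joint eigenvector has weight \<open>lam\<close> plus a lattice point r, and
  t^(-r) moves it into \<open>U\<close>.\<close>

lemma Psi_surj: "Psi ` tensor_carrier U = car"
proof
  show "Psi ` tensor_carrier U \<subseteq> car" using Psi_car by blast
  interpret T: vector_space "\<lambda>c. tensor_ascale ms (const c :: 'm laurent)" by (rule M.vector_space_tensor)
  have tc: "T.subspace (tensor_carrier U)"
    using subspace_wt[of 0] unfolding T.subspace_def U_def
    by (auto simp: tensor_carrier_def lookup_add M.lookup_mscale M.subspace_0 M.subspace_add M.subspace_scale)
  have sub: "M.subspace (Psi ` tensor_carrier U)"
  proof (rule M.subspaceI)
    show "0 \<in> Psi ` tensor_carrier U"
      using T.subspace_0[OF tc] by (intro image_eqI[of _ _ 0]) (auto simp: Psi_def)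
    show "x + y \<in> Psi ` tensor_carrier U" if "x \<in> Psi ` tensor_carrier U" "y \<in> Psi ` tensor_carrier U" for x y
      using that T.subspace_add[OF tc] by (auto simp flip: Psi_add intro!: imageI)
    show "ms c x \<in> Psi ` tensor_carrier U" if "x \<in> Psi ` tensor_carrier U" for c x
      using that T.subspace_scale[OF tc] by (auto simp flip: Psi_scale intro!: imageI)
  qed
  have "w \<in> Psi ` tensor_carrier U" if w: "w \<in> car" "\<forall>i. \<exists>c. act (d i) w = ms c w" for w
  proof (cases "w = 0")
    case True then show ?thesis using M.subspace_0[OF sub] by simp
  next
    case False
    obtain \<nu> where \<nu>: "\<And>i. act (d i) w = ms (\<nu> i) w" using w(2) by metis
    have "w \<in> weight_space J (\<chi> i. \<nu> i)" using w(1) \<nu> by (simp add: weight_space_def)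
    then have "weight_space J (\<chi> i. \<nu> i) \<noteq> {0}" using False by blast
    then obtain r :: "'m lattice" where r: "\<forall>i. \<nu> i = lam $ i + of_int (r $ i)"
      using J_at unfolding category_J_at_def by (metis vec_lambda_beta)
    then have "w \<in> wt r" using w(1) \<nu> by (simp add: wt_def add.commute)
    then have "A (tpow (- r)) w \<in> U" using tpow_wt[of w r "- r"] by (simp add: U_def)
    then have "single r (A (tpow (- r)) w) \<in> tensor_carrier U"
      using M.subspace_0[OF subspace_wt[of 0]] by (intro tensor_carrier_single) (simp_all add: U_def)
    moreover have "Psi (single r (A (tpow (- r)) w)) = w"
      unfolding Psi_single tpow_tpow by (simp add: tpow_0)
    ultimately show ?thesis by (metis imageI)
  qed
  then have "M.span {w \<in> car. \<forall>i\<in>UNIV. \<exists>c. act (d i) w = ms c w} \<subseteq> Psi ` tensor_carrier U"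
    using sub by (intro M.span_minimal) auto
  then show "car \<subseteq> Psi ` tensor_carrier U" 
    by (rule order_trans[OF joint_eigenvectors[OF finite]])
qed

text \<open>Lift finitely many generators over A_N along \<open>Psi\<close>. The finitely many
  coefficients of the lifts span \<open>U\<close>, because families with coefficients in their span
  already reach the whole module and \<open>Psi\<close> is injective.\<close>

lemma U_finite_span: "\<exists>S. finite S \<and> U \<subseteq> M.span S"
proof -
  obtain B where B: "finite B" "A.span B = car"
    using J unfolding category_J_def by blast
  have "\<forall>b\<in>B. \<exists>g. g \<in> tensor_carrier U \<and> Psi g = b"
  proof
    fix b assume "b \<in> B"
    then have "b \<in> Psi ` tensor_carrier U" using A.span_base[of b B] B(2) Psi_surj by simp
    then show "\<exists>g. g \<in> tensor_carrier U \<and> Psi g = b" by blast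
  qed
  then obtain G where G: "\<And>b. b \<in> B \<Longrightarrow> G b \<in> tensor_carrier U" "\<And>b. b \<in> B \<Longrightarrow> Psi (G b) = b" by metis
  define S where "S = (\<Union>b\<in>B. lookup (G b) ` Poly_Mapping.keys (G b))"
  have finS: "finite S" using B(1) by (simp add: S_def)
  have SU: "S \<subseteq> U" using G(1) by (auto simp: S_def dest: tensor_carrierD)
  have spU: "M.span S \<subseteq> U" using SU subspace_wt[of 0] unfolding U_def by (intro M.span_minimal)
  interpret F: fd_space ms "M.span S" S
    using finS by unfold_locales auto
  let ?T = "tensor_carrier (M.span S) :: ('m lattice \<Rightarrow>\<^sub>0 'v) set"
  have GT: "G b \<in> ?T" if "b \<in> B" for b
    unfolding tensor_carrier_def
  proof (intro CollectI allI)
    fix s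
    show "lookup (G b) s \<in> M.span S"
    proof (cases "s \<in> Poly_Mapping.keys (G b)")
      case True
      then show ?thesis using that by (intro M.span_base) (auto simp: S_def)
    next
      case False
      then show ?thesis by (simp add: in_keys_iff)
    qed
  qed
  have sub: "A.subspace (Psi ` ?T)"
  proof (rule A.subspaceI)
    show "0 \<in> Psi ` ?T" by (intro image_eqI[of _ _ 0]) (auto simp: Psi_def tensor_carrier_def)
    show "x + y \<in> Psi ` ?T" if "x \<in> Psi ` ?T" "y \<in> Psi ` ?T" for x y
      using that F.tensor_carrier_add by (auto simp flip: Psi_add intro!: imageI)
    show "A c x \<in> Psi ` ?T" if "x \<in> Psi ` ?T" for c x
      using that F.tensor_ascale_in_carrier by (auto simp flip: Psi_ascale intro!: imageI)
  qed
  have "B \<subseteq> Psi ` ?T" using G(2) GT by (metis imageI subsetI)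
  then have car: "car \<subseteq> Psi ` ?T" using sub B(2) A.span_minimal by metis
  have "u \<in> M.span S" if u: "u \<in> U" for u
  proof -
    obtain g where g: "g \<in> ?T" "Psi g = u" using car U_car[OF u] by blast
    have gU: "g \<in> tensor_carrier U" using g(1) spU by (auto simp: tensor_carrier_def)
    have "single 0 u \<in> tensor_carrier U"
      using u M.subspace_0[OF subspace_wt[of 0]] by (intro tensor_carrier_single) (simp_all add: U_def)
    then have "g = single 0 u" using g(2) by (intro Psi_inj[OF gU]) (simp_all add: Psi_single tpow_0)
    then show ?thesis using tensor_carrierD[OF g(1), of 0] by simp
  qed
  then show ?thesis using finS by blast
qed

lemma lattice_rep: "\<exists>S. lattice_rep ms U S D"
proof -
  obtain S where S: "finite S" "U \<subseteq> M.span S" using U_finite_span by blast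
  interpret fd_space ms U S
    using S subspace_wt[of 0] by unfold_locales (simp_all add: U_def)
  have "lattice_rep ms U S D"
    by unfold_locales (simp_all add: endo_D D_rel skew_rel_def)
  then show ?thesis ..
qed

lemma isomorphic_tensor_like:
  assumes K: "tensor_like lam ms U D K"
  shows "isomorphic_ah_modules K J"
proof -
  obtain S where "lattice_rep ms U S D" using lattice_rep by blast
  then interpret L: lattice_rep ms U S D .
  interpret K: tensor_like_module ms U S D lam K by unfold_locales (rule K)
  have "bij_betw Psi K.T car"
    unfolding bij_betw_def inj_on_def using Psi_inj Psi_surj by blast
  moreover have "Psi (mact K X g) = act X (Psi g)" if X: "X \<in> lie_carrier ham" and g: "g \<in> K.T" for X g
  proof (rule ham_intertwine[OF K.lie_module_J lie_module_J _ _ _ _ _ X])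
    show "Psi x \<in> car" if "x \<in> mcarrier K" for x using that Psi_car by (simp add: K.J_simps)
    show "Psi (x + y) = Psi x + Psi y" for x y by (rule Psi_add)
    show "Psi (mscale K c x) = ms c (Psi x)" for c x by (simp add: K.J_simps Psi_scale)
    show "Psi (mact K (d a) x) = act (d a) (Psi x)" if "x \<in> mcarrier K" for a x
    proof -
      have "x \<in> K.T" using that by (simp add: K.J_simps)
      then show ?thesis
      proof (induction rule: L.tensor_carrier_induct)
        case (single s v)
        then show ?case by (simp add: K.act_d_single Psi_single act_d_tpow)
      next
        case (add f g)
        then show ?case by (simp add: K.act_add ham_closed Psi_add act_add Psi_car)
      qed
    qed
    show "Psi (mact K (h r) x) = act (h r) (Psi x)" if "x \<in> mcarrier K" for r x
    proof -
      have "x \<in> K.T" using that by (simp add: K.J_simps)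
      then show ?thesis
      proof (induction rule: L.tensor_carrier_induct)
        case (single s v)
        then show ?case by (simp add: K.act_h_single Psi_single act_h_tpow)
      next
        case (add f g)
        then show ?case by (simp add: K.act_add ham_closed Psi_add act_add Psi_car)
      qed
    qed
    show "g \<in> mcarrier K" using g by (simp add: K.J_simps)
  qed
  ultimately show ?thesis
    unfolding isomorphic_ah_modules_def K.J_simps using Psi_add Psi_ascale by blast
qed

lemma U_nonzero: "U \<noteq> {0}"
proof
  assume "U = {0}"
  then have z: "g = 0" if "g \<in> tensor_carrier U" for g
    using that by (auto intro!: poly_mapping_eqI dest: tensor_carrierD)
  have "x = 0" if "x \<in> car" for x
  proof -
    obtain g where "g \<in> tensor_carrier U" "x = Psi g" using \<open>x \<in> car\<close> Psi_surj by blast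
    then show ?thesis using z[of g] by (simp add: Psi_def)
  qed
  then have "car \<subseteq> {0}" by blast
  then show False
    using irr_J M.subspace_0[OF sub_M] unfolding irreducible_ah_module_def by blast
qed

text \<open>The image of A_N (x) W is a submodule, hence zero or everything, and injectivity of
  \<open>Psi\<close> turns this into the statement about \<open>W\<close>.\<close>

lemma irr_U:
  assumes W: "M.subspace W" "W \<subseteq> U" "\<And>r w. w \<in> W \<Longrightarrow> D r w \<in> W"
  shows "W = {0} \<or> W = U"
proof -
  obtain S where S: "finite S" "U \<subseteq> M.span S" using U_finite_span by blast
  interpret F: fd_space ms W S
    using S W by unfold_locales auto
  let ?T = "tensor_carrier W :: ('m lattice \<Rightarrow>\<^sub>0 'v) set"
  have TU: "?T \<subseteq> tensor_carrier U" using W(2) by (auto simp: tensor_carrier_def)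
  let ?Z = "Psi ` ?T"
  have Zc: "?Z \<subseteq> car" using TU Psi_car by blast
  have sub: "A.subspace ?Z"
  proof (rule A.subspaceI)
    show "0 \<in> ?Z" by (intro image_eqI[of _ _ 0]) (auto simp: Psi_def tensor_carrier_def)
    show "x + y \<in> ?Z" if "x \<in> ?Z" "y \<in> ?Z" for x y
      using that F.tensor_carrier_add by (auto simp flip: Psi_add intro!: imageI)
    show "A c x \<in> ?Z" if "x \<in> ?Z" for c x
      using that F.tensor_ascale_in_carrier by (auto simp flip: Psi_ascale intro!: imageI)
  qed
  have gen: "act X (Psi g) \<in> ?Z"
    if X: "X \<in> range d \<union> range h" and g: "g \<in> ?T" for X g
    using g
  proof (induction rule: F.tensor_carrier_induct)
    case (single s v)
    have v: "v \<in> W" "v \<in> U" using single W(2) by auto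
    from X consider a where "X = d a" | r where "X = h r" by blast
    then show ?case
    proof cases
      case 1
      have "single s (ms (of_int (s $ a) + lam $ a) v) \<in> ?T" using v by (simp add: tensor_carrier_single)
      then show ?thesis
        unfolding 1 Psi_single act_d_tpow[OF v(2)] by (metis Psi_single imageI)
    next
      case 2
      have "single (r + s) (ms (of_int (om r s)) v + D r v) \<in> ?T" using v W(3) by (simp add: tensor_carrier_single)
      then show ?thesis
        unfolding 2 Psi_single act_h_tpow[OF v(2)] by (metis Psi_single imageI)
    qed
  next
    case (add f g)
    have "X \<in> lie_carrier ham" using X ham_closed by blast
    then have "act X (Psi (f + g)) = act X (Psi f) + act X (Psi g)"
      using add(1,2) TU Psi_car by (simp add: Psi_add act_add subset_iff)
    then show ?case using add(3,4) A.subspace_add[OF sub] by simp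
  qed
  have "act X z \<in> ?Z" if X: "X \<in> lie_carrier ham" and z: "z \<in> ?Z" for X z
    using X
  proof (induction rule: ham_induct)
    case (d a) then show ?case using gen z by blast
  next
    case (h r) then show ?case using gen z by blast
  next
    case (add X Y)
    have "z \<in> car" using z Zc by blast
    then show ?case using lie_moduleD(4)[OF lie_module_J add(1,2)] add(3,4) A.subspace_add[OF sub] by metis
  next
    case (scale c X)
    have "z \<in> car" using z Zc by blast
    then have "act (hscale c X) z = A (const c) (act X z)"
      using lie_moduleD(5)[OF lie_module_J scale(1)] by (simp only: ham_simps(2) ms_A)
    then show ?case using scale(2) A.subspace_scale[OF sub] by metis
  qed
  then have "?Z = {0} \<or> ?Z = car"
    using irr_J Zc sub unfolding irreducible_ah_module_def by blast
  then show ?thesis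
  proof
    assume Z: "?Z = {0}"
    have "w = 0" if w: "w \<in> W" for w
    proof -
      have "single 0 w \<in> ?T" using w by (simp add: tensor_carrier_single)
      then have "Psi (single 0 w) = 0" using Z by blast
      then show ?thesis by (simp add: Psi_single tpow_0)
    qed
    then show ?thesis using M.subspace_0[OF W(1)] by blast
  next
    assume Z: "?Z = car"
    have "u \<in> W" if u: "u \<in> U" for u
    proof -
      have "u \<in> ?Z" using Z U_car[OF u] by simp
      then obtain g where g: "g \<in> ?T" "Psi g = u" by blast
      have "single 0 u \<in> tensor_carrier U"
        using u M.subspace_0[OF subspace_wt[of 0]] by (intro tensor_carrier_single) (simp_all add: U_def)
      then have "g = single 0 u" using g TU by (intro Psi_inj) (auto simp: Psi_single tpow_0)
      then show ?thesis using tensor_carrierD[OF g(1), of 0] by simp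
    qed
    then show ?thesis using W(2) by blast
  qed
qed

end

text \<open>The module over sp_N and a_N is carried by the weight space of weight
  \<open>lam\<close>, which is why it lives on the same type as \<open>J\<close>.\<close>

lemma irreducible_in_J_is_tensor_module:
  fixes lam :: "complex ^ ('m::{finite,linorder}) index" and J :: "('m, 'v::ab_group_add) ah_mod"
  assumes "category_J_at lam J" "irreducible_ah_module J"
  shows "\<exists>(V :: ('m spa, 'v) lie_mod) \<mu> K.
           irreducible_lie_module sp_a V \<and> finite_dimensional V \<and>
           acts_by_scalars V \<mu> \<and> tensor_module lam \<mu> V K \<and> isomorphic_ah_modules J K"
proof -
  interpret J: irreducible_in_J lam J using assms by unfold_locales
  obtain S where "lattice_rep J.ms J.U S J.D" using J.lattice_rep by blast
  then interpret L: lattice_rep J.ms J.U S J.D .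
  obtain l where l: "\<And>r s. l (r + s) = l r + l s"
    "\<And>r u. u \<in> J.U \<Longrightarrow> J.D r u - J.D (- r) u = J.ms (2 * l r) u" "\<And>u. u \<in> J.U \<Longrightarrow> pdeg 3 (\<lambda>s. J.D s u)"
    by (rule L.irreducible_structure[OF J.D_0 J.U_nonzero J.irr_U]) blast+
  obtain \<mu> where \<mu>: "\<And>r. l r = ell \<mu> r" using additive_eq_ell[of l, OF l(1)] by blast
  interpret Q: quadratic_lattice_rep J.ms J.U S J.D \<mu>
    using J.D_0 J.U_nonzero J.irr_U l \<mu> by unfold_locales auto
  obtain K where K: "tensor_like lam J.ms J.U J.D K" using L.tensor_like_exists[OF J.D_0] by blast
  interpret K: tensor_like_module J.ms J.U S J.D lam K by unfold_locales (rule K)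
  have "isomorphic_ah_modules J K"
    by (rule isomorphic_ah_modules_sym[OF J.isomorphic_tensor_like[OF K] K.lie_module_J])
      (simp add: K.J_simps L.tensor_ascale_in_carrier)
  then show ?thesis
    using Q.irreducible_V Q.finite_dimensional_V Q.acts_by_scalars_V Q.tensor_module_V[OF K] by blast
qed

lemma irreducible_sp_a_moduleI:
  assumes "irreducible_lie_module sp_a V" "finite_dimensional V"
  shows "\<exists>B. irreducible_sp_a_module V B"
proof -
  obtain B where "finite B" "module.span (mscale V) B = mcarrier V"
    using assms(2) unfolding finite_dimensional_def by blast
  then have "irreducible_sp_a_module V B"
    using assms(1) by unfold_locales (auto simp: irreducible_lie_module_def)
  then show ?thesis ..
qed

text \<open>The correspondence is one of isomorphism classes. The conjuncts give in turn the map,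
  its compatibility with isomorphism together with injectivity, and surjectivity.\<close>

theorem theorem5p2:
  fixes lam :: "complex ^ ('m::{finite,linorder} + 'm)"
  shows
    "(\<forall>V :: ('m spa, 'v::ab_group_add) lie_mod.
        irreducible_lie_module sp_a V \<and> finite_dimensional V \<longrightarrow>
        irreducible_lie_module sp (restrict_sp V) \<and>
        (\<exists>!\<mu>. acts_by_scalars V \<mu>) \<and>
        (\<forall>\<mu>. acts_by_scalars V \<mu> \<longrightarrow>
           (\<exists>J. tensor_module lam \<mu> V J) \<and>
           (\<forall>J. tensor_module lam \<mu> V J \<longrightarrow> category_J_at lam J \<and> irreducible_ah_module J)))
   \<and> (\<forall>(V :: ('m spa, 'v) lie_mod) (W :: ('m spa, 'w::ab_group_add) lie_mod) \<mu> \<nu> J K.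
        irreducible_lie_module sp_a V \<and> finite_dimensional V \<and>
        irreducible_lie_module sp_a W \<and> finite_dimensional W \<and>
        acts_by_scalars V \<mu> \<and> tensor_module lam \<mu> V J \<and>
        acts_by_scalars W \<nu> \<and> tensor_module lam \<nu> W K \<longrightarrow>
        (isomorphic_ah_modules J K \<longleftrightarrow> isomorphic_lie_modules sp_a V W))
   \<and> (\<forall>J :: ('m, 'j::ab_group_add) ah_mod.
        category_J_at lam J \<and> irreducible_ah_module J \<longrightarrow>
        (\<exists>(V :: ('m spa, 'j) lie_mod) \<mu> K.
           irreducible_lie_module sp_a V \<and> finite_dimensional V \<and>
           acts_by_scalars V \<mu> \<and> tensor_module lam \<mu> V K \<and> isomorphic_ah_modules J K))"
proof (intro conjI allI impI)
  fix V :: "('m spa, 'v) lie_mod"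
  assume "irreducible_lie_module sp_a V \<and> finite_dimensional V"
  then obtain B where "irreducible_sp_a_module V B" using irreducible_sp_a_moduleI by blast
  then interpret V: irreducible_sp_a_module V B .
  show "irreducible_lie_module sp (restrict_sp V)" by (rule V.irreducible_restrict)
  show "\<exists>!\<mu>. acts_by_scalars V \<mu>" using V.scalars_exist V.scalars_unique by blast
  fix \<mu>
  interpret D: lattice_rep "mscale V" "mcarrier V" B "V.Dop \<mu>"
    by unfold_locales (simp_all add: V.endo_Dop V.Dop_rel)
  show "\<exists>J. tensor_module lam \<mu> V J"
    unfolding V.tensor_module_iff by (rule D.tensor_like_exists) (rule V.Dop_0)
  fix J assume "tensor_module lam \<mu> V J"
  then interpret J: tensor_like_module "mscale V" "mcarrier V" B "V.Dop \<mu>" lam J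
    by unfold_locales (simp add: V.tensor_module_iff)
  show "category_J_at lam J" by (rule J.category_J_at)
  show "irreducible_ah_module J" by (rule J.irreducible[OF V.nonzero V.irr_Dop])
next
  fix V :: "('m spa, 'v) lie_mod" and W :: "('m spa, 'w) lie_mod" and \<mu> \<nu> J K
  assume asm: "irreducible_lie_module sp_a V \<and> finite_dimensional V \<and>
        irreducible_lie_module sp_a W \<and> finite_dimensional W \<and>
        acts_by_scalars V \<mu> \<and> tensor_module lam \<mu> V J \<and>
        acts_by_scalars W \<nu> \<and> tensor_module lam \<nu> W K"
  obtain B where B: "irreducible_sp_a_module V B" using asm irreducible_sp_a_moduleI by blast
  obtain B' where B': "irreducible_sp_a_module W B'" using asm irreducible_sp_a_moduleI by blast
  interpret V: irreducible_sp_a_module V B by (rule B)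
  interpret W: irreducible_sp_a_module W B' by (rule B')
  interpret P: tensor_like_pair "mscale V" "mcarrier V" B "V.Dop \<mu>" lam J
      "mscale W" "mcarrier W" B' "W.Dop \<nu>" K
    using asm
    by unfold_locales (simp_all add: V.endo_Dop V.Dop_rel W.endo_Dop W.Dop_rel V.tensor_module_iff W.tensor_module_iff)
  have "isomorphic_lie_modules sp_a V W \<longleftrightarrow>
    (\<exists>f. intertwines (mscale V) (mcarrier V) (V.Dop \<mu>) (mscale W) (mcarrier W) (W.Dop \<nu>) f)"
    using asm by (intro isomorphic_sp_a_iff[OF B B']) auto
  then show "isomorphic_ah_modules J K \<longleftrightarrow> isomorphic_lie_modules sp_a V W"
    using P.isomorphic_of_intertwines P.intertwines_of_isomorphic by blast
next
  fix J :: "('m, 'j) ah_mod"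
  assume "category_J_at lam J \<and> irreducible_ah_module J"
  then show "\<exists>(V :: ('m spa, 'j) lie_mod) \<mu> K.
           irreducible_lie_module sp_a V \<and> finite_dimensional V \<and>
           acts_by_scalars V \<mu> \<and> tensor_module lam \<mu> V K \<and> isomorphic_ah_modules J K"
    using irreducible_in_J_is_tensor_module by blast
qed

end
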